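(* Let $\lambda$ be Lebesgue measure on $[0,1]$ and, for each $a>0$, let $P_a\sim \mathrm{DP}(a,\lambda)$ be a Dirichlet process on $[0,1]$ with concentration parameter $a$ and base measure $\lambda$. Write $P_a(t)=P_a([0,t])$ and $\lambda(t)=\lambda([0,t])=t$ for $t\in[0,1]$. Then, as $a\to\infty$, $$\sqrt{a}\,\big(P_a(\cdot)-\lambda(\cdot)\big)\ \xrightarrow{d}\ B_\lambda(\cdot)$$ in $D[0,1]$ with respect to the Skorokhod topology, where $B_\lambda$ is a Brownian bridge on $[0,1]$.
   Context: Dirichlet process: let $(\mathfrak X,\mathcal A)$ be a measurable space, $H$ a probability measure on it, and $a>0$. A random probability measure $P_a=\{P_a(A)\}_{A\in\mathcal A}$ is a Dirichlet process with parameters $a$ and $H$, written $P_a\sim\mathrm{DP}(a,H)$, if for every finite measurable partition $\{A_1,\dots,A_k\}$ of $\mathfrak X$ the vector $(P_a(A_1),\dots,P_a(A_k))$ has the Dirichlet distribution with parameters $(aH(A_1),\dots,aH(A_k))$, with the convention that $P_a(A_j)=0$ almost surely if $H(A_j)=0$. The Dirichlet distribution with parameters $a_1,\dots,a_k>0$ is the law on the simplex $\{y_i\ge 0,\ \sum_{i=1}^k y_i=1\}$ with density $\frac{\Gamma(\sum_{i=1}^k a_i)}{\prod_{i=1}^k\Gamma(a_i)}\prod_{i=1}^k y_i^{a_i-1}$. Here $\mathfrak X=[0,1]$ with its Borel sets. $D[0,1]$ is the space of right-continuous functions with left limits on $[0,1]$. The Brownian bridge $B_\lambda$ is the centered Gaussian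 process on $[0,1]$ with $\mathrm{Cov}(B_\lambda(s),B_\lambda(t))=\min(s,t)-st$ and continuous sample paths. The symbol $\xrightarrow{d}$ denotes convergence in distribution. *)

theory Defs
  imports "HOL-Probability.Probability"
begin

text \<open>
  Paths are functions on all of \<open>real\<close>; they are required to be \<^const>\<open>undefined\<close> outside of
  \<open>[0,1]\<close> (as in \<^const>\<open>PiE\<close>), so that equality of paths is equality on \<open>[0,1]\<close>.
\<close>

definition cadlag :: "(real \<Rightarrow> real) set" where
  "cadlag = {x \<in> extensional {0..1}.
     (\<forall>t\<in>{0..<1}. (x \<longlongrightarrow> x t) (at_right t)) \<and>
     (\<forall>t\<in>{0<..1}. \<exists>l. (x \<longlongrightarrow> l) (at_left t))}"

definition time_change :: "(real \<Rightarrow> real) \<Rightarrow> bool" where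
  "time_change l \<longleftrightarrow> strict_mono_on {0..1} l \<and> continuous_on {0..1} l \<and> l ` {0..1} = {0..1}"

definition skorokhod_close :: "(real \<Rightarrow> real) \<Rightarrow> (real \<Rightarrow> real) \<Rightarrow> real \<Rightarrow> bool" where
  "skorokhod_close x y e \<longleftrightarrow>
     (\<exists>l. time_change l \<and> (\<forall>t\<in>{0..1}. \<bar>l t - t\<bar> \<le> e \<and> \<bar>x t - y (l t)\<bar> \<le> e))"

text \<open>
  The infimum over all time changes \<open>l\<close> of the maximum of \<open>sup \<bar>l t - t\<bar>\<close> and
  \<open>sup \<bar>x t - y (l t)\<bar>\<close>. The value outside of \<^const>\<open>cadlag\<close> is irrelevant; it is fixed to be
  \<open>0\<close> because \<^locale>\<open>Metric_space\<close> asks for symmetry and non-negativity on the whole type.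
\<close>

definition skorokhod_dist :: "(real \<Rightarrow> real) \<Rightarrow> (real \<Rightarrow> real) \<Rightarrow> real" where
  "skorokhod_dist x y =
     (if x \<in> cadlag \<and> y \<in> cadlag then Inf {e. skorokhod_close x y e} else 0)"

lemma cadlag_bounded:
  assumes x: "x \<in> cadlag"
  shows "bounded (x ` {0..1})"
proof -
  define P where "P a b = bounded (x ` ({a..b} \<inter> {0..1}))" for a b
  have "P 0 1"
  proof (rule Bolzano)
    show "(0::real) \<le> 1" by simp
  next
    fix a b c :: real
    assume "P a b" "P b c" "a \<le> b" "b \<le> c"
    moreover from this have "{a..c} = {a..b} \<union> {b..c}" by auto
    ultimately show "P a c"
      by (simp add: P_def Int_Un_distrib2 image_Un)
  next
    fix t :: real assume t: "0 \<le> t" "t \<le> 1"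
    have right: "\<exists>d>0. \<exists>K. \<forall>s\<in>{t<..<t+d} \<inter> {0..1}. \<bar>x s\<bar> \<le> K"
    proof (cases "t < 1")
      case True
      then have "(x \<longlongrightarrow> x t) (at_right t)" using x t by (auto simp: cadlag_def)
      then have "eventually (\<lambda>s. dist (x s) (x t) < 1) (at_right t)"
        by (rule tendstoD) simp
      then obtain b where "b > t" and b: "\<And>s. t < s \<Longrightarrow> s < b \<Longrightarrow> dist (x s) (x t) < 1"
        by (auto simp: eventually_at_right_field)
      have "\<bar>x s\<bar> \<le> \<bar>x t\<bar> + 1" if "s \<in> {t<..<t+(b-t)}" for s
        using b[of s] that by (auto simp: dist_real_def)
      with \<open>b > t\<close> show ?thesis by (intro exI[of _ "b - t"] conjI exI[of _ "\<bar>x t\<bar> + 1"]) auto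
    next
      case False
      with t show ?thesis by (intro exI[of _ 1]) auto
    qed
    have left: "\<exists>d>0. \<exists>K. \<forall>s\<in>{t-d<..<t} \<inter> {0..1}. \<bar>x s\<bar> \<le> K"
    proof (cases "0 < t")
      case True
      with t have "t \<in> {0<..1}" by simp
      with x obtain l where "(x \<longlongrightarrow> l) (at_left t)" unfolding cadlag_def by blast
      then have "eventually (\<lambda>s. dist (x s) l < 1) (at_left t)"
        by (rule tendstoD) simp
      then obtain b where "b < t" and b: "\<And>s. b < s \<Longrightarrow> s < t \<Longrightarrow> dist (x s) l < 1"
        by (auto simp: eventually_at_left_field)
      have "\<bar>x s\<bar> \<le> \<bar>l\<bar> + 1" if "s \<in> {t-(t-b)<..<t}" for s
        using b[of s] that by (auto simp: dist_real_def)
      with \<open>b < t\<close> show ?thesis by (intro exI[of _ "t - b"] conjI exI[of _ "\<bar>l\<bar> + 1"]) auto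
    next
      case False
      with t show ?thesis by (intro exI[of _ 1]) auto
    qed
    from right obtain d1 K1 where 1: "d1 > 0" "\<And>s. s \<in> {t<..<t+d1} \<inter> {0..1} \<Longrightarrow> \<bar>x s\<bar> \<le> K1"
      by blast
    from left obtain d2 K2 where 2: "d2 > 0" "\<And>s. s \<in> {t-d2<..<t} \<inter> {0..1} \<Longrightarrow> \<bar>x s\<bar> \<le> K2"
      by blast
    have "P a b" if "a \<le> t" "t \<le> b" "b - a < min d1 d2" for a b
    proof -
      have "\<bar>x s\<bar> \<le> max (max K1 K2) \<bar>x t\<bar>" if s: "s \<in> {a..b} \<inter> {0..1}" for s
      proof (cases s t rule: linorder_cases)
        case less
        then have "\<bar>x s\<bar> \<le> K2" using s \<open>t \<le> b\<close> \<open>b - a < min d1 d2\<close> by (intro 2) auto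
        then show ?thesis by simp
      next
        case greater
        then have "\<bar>x s\<bar> \<le> K1" using s \<open>a \<le> t\<close> \<open>b - a < min d1 d2\<close> by (intro 1) auto
        then show ?thesis by simp
      qed simp
      then show "P a b" unfolding P_def bounded_iff real_norm_def by blast
    qed
    then show "\<exists>d>0. \<forall>a b. a \<le> t \<and> t \<le> b \<and> b - a < d \<longrightarrow> P a b"
      using 1(1) 2(1) by (intro exI[of _ "min d1 d2"]) auto
  qed
  then show ?thesis by (simp add: P_def)
qed

lemma time_change_range: "time_change l \<Longrightarrow> t \<in> {0..1} \<Longrightarrow> l t \<in> {0..1}"
  by (auto simp: time_change_def)

lemma time_change_id: "time_change (\<lambda>t. t)"
  by (auto simp: time_change_def strict_mono_on_def)

lemma time_change_comp:
  assumes "time_change l" "time_change m"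
  shows "time_change (\<lambda>t. m (l t))"
  unfolding time_change_def
proof (intro conjI)
  show "strict_mono_on {0..1} (\<lambda>t. m (l t))"
    using assms time_change_range[OF assms(1)]
    unfolding time_change_def strict_mono_on_def by blast
  show "continuous_on {0..1} (\<lambda>t. m (l t))"
    using assms by (intro continuous_on_compose2[of "{0..1}" m "{0..1}" l]) (auto simp: time_change_def)
  have "(\<lambda>t. m (l t)) ` {0..1} = m ` (l ` {0..1})" by auto
  then show "(\<lambda>t. m (l t)) ` {0..1} = {0..1}"
    using assms by (simp add: time_change_def)
qed

lemma time_change_inverse:
  assumes l: "time_change l"
  obtains m where "time_change m" "\<And>t. t \<in> {0..1} \<Longrightarrow> l (m t) = t"
proof
  let ?m = "the_inv_into {0..1} l"
  have inj: "inj_on l {0..1}"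
    using l by (auto simp: time_change_def intro: strict_mono_on_imp_inj_on)
  have img: "l ` {0..1} = {0..1}" using l by (simp add: time_change_def)
  show right: "l (?m t) = t" if "t \<in> {0..1}" for t
    using f_the_inv_into_f[OF inj] that img by blast
  have rng: "?m t \<in> {0..1}" if "t \<in> {0..1}" for t
    using the_inv_into_into[OF inj, of t "{0..1}"] that img by blast
  show "time_change ?m"
    unfolding time_change_def
  proof (intro conjI)
    show "strict_mono_on {0..1} ?m"
    proof (rule strict_mono_onI)
      fix s t :: real assume st: "s \<in> {0..1}" "t \<in> {0..1}" "s < t"
      show "?m s < ?m t"
      proof (rule ccontr)
        assume "\<not> ?m s < ?m t"
        then have "?m t \<le> ?m s" by simp
        moreover have "strict_mono_on {0..1} l" using l by (simp add: time_change_def)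
        ultimately have "l (?m t) \<le> l (?m s)"
          using rng st(1,2) by (metis strict_mono_on_leD)
        then show False using right st by auto
      qed
    qed
    have "continuous_on (l ` {0..1}) ?m"
      using l the_inv_into_f_f[OF inj]
      by (intro continuous_on_inv) (auto simp: time_change_def)
    then show "continuous_on {0..1} ?m" by (simp add: img)
    show "?m ` {0..1} = {0..1}"
      using the_inv_into_onto[OF inj] by (simp add: img)
  qed
qed

lemma skorokhod_close_sym:
  assumes "skorokhod_close x y e"
  shows "skorokhod_close y x e"
proof -
  from assms obtain l where l: "time_change l"
    and e: "\<And>t. t \<in> {0..1} \<Longrightarrow> \<bar>l t - t\<bar> \<le> e \<and> \<bar>x t - y (l t)\<bar> \<le> e"
    by (auto simp: skorokhod_close_def)
  obtain m where m: "time_change m" and lm: "\<And>t. t \<in> {0..1} \<Longrightarrow> l (m t) = t"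
    using time_change_inverse[OF l] by blast
  have "\<bar>m t - t\<bar> \<le> e \<and> \<bar>y t - x (m t)\<bar> \<le> e" if "t \<in> {0..1}" for t
    using e[OF time_change_range[OF m that]] lm[OF that] by (simp add: abs_minus_commute)
  with m show ?thesis unfolding skorokhod_close_def by blast
qed

lemma skorokhod_close_trans:
  assumes "skorokhod_close x y e" "skorokhod_close y z e'"
  shows "skorokhod_close x z (e + e')"
proof -
  from assms(1) obtain l where l: "time_change l"
    and e: "\<And>t. t \<in> {0..1} \<Longrightarrow> \<bar>l t - t\<bar> \<le> e \<and> \<bar>x t - y (l t)\<bar> \<le> e"
    by (auto simp: skorokhod_close_def)
  from assms(2) obtain m where m: "time_change m"
    and e': "\<And>t. t \<in> {0..1} \<Longrightarrow> \<bar>m t - t\<bar> \<le> e' \<and> \<bar>y t - z (m t)\<bar> \<le> e'"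
    by (auto simp: skorokhod_close_def)
  have "\<bar>m (l t) - t\<bar> \<le> e + e' \<and> \<bar>x t - z (m (l t))\<bar> \<le> e + e'" if "t \<in> {0..1}" for t
    using e[OF that] e'[OF time_change_range[OF l that]] by linarith
  with time_change_comp[OF l m] show ?thesis unfolding skorokhod_close_def by blast
qed

lemma skorokhod_close_nonneg: "skorokhod_close x y e \<Longrightarrow> 0 \<le> e"
  unfolding skorokhod_close_def
  by (metis abs_ge_zero atLeastAtMost_iff order_trans order_refl zero_le_one)

lemma skorokhod_close_ex:
  assumes "x \<in> cadlag" "y \<in> cadlag"
  shows "\<exists>e. skorokhod_close x y e"
proof -
  obtain K where K: "\<forall>t\<in>{0..1}. \<bar>x t\<bar> \<le> K"
    using cadlag_bounded[OF assms(1)] by (auto simp: bounded_iff)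
  obtain L where L: "\<forall>t\<in>{0..1}. \<bar>y t\<bar> \<le> L"
    using cadlag_bounded[OF assms(2)] by (auto simp: bounded_iff)
  have KL: "\<bar>x t - y t\<bar> \<le> K + L" if "t \<in> {0..1}" for t
    using bspec[OF K that] bspec[OF L that] by linarith
  have "0 \<le> K + L" using KL[of 0] by auto
  then have "skorokhod_close x y (K + L)"
    unfolding skorokhod_close_def using KL time_change_id
    by (intro exI[of _ "\<lambda>t. t"]) simp
  then show ?thesis ..
qed

lemma skorokhod_close_refl: "skorokhod_close x x 0"
  unfolding skorokhod_close_def using time_change_id by (intro exI[of _ "\<lambda>t. t"]) auto

lemma skorokhod_close_eqI:
  assumes x: "x \<in> cadlag" and y: "y \<in> cadlag" and close: "\<And>e. e > 0 \<Longrightarrow> skorokhod_close x y e"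
  shows "x = y"
proof (rule extensionalityI)
  show "x \<in> extensional {0..1}" "y \<in> extensional {0..1}" using x y by (auto simp: cadlag_def)
next
  fix t :: real assume t: "t \<in> {0..1}"
  have "\<bar>x t - y t\<bar> \<le> 3 * d" if "d > 0" for d
  proof (cases "t < 1")
    case True
    then have "(x \<longlongrightarrow> x t) (at_right t)" "(y \<longlongrightarrow> y t) (at_right t)"
      using x y t by (auto simp: cadlag_def)
    then have "eventually (\<lambda>s. dist (x s) (x t) < d \<and> dist (y s) (y t) < d) (at_right t)"
      using \<open>d > 0\<close> by (intro eventually_conj tendstoD)
    then obtain b where b: "b > t"
      "\<And>s. t < s \<Longrightarrow> s < b \<Longrightarrow> dist (x s) (x t) < d \<and> dist (y s) (y t) < d"
      by (auto simp: eventually_at_right_field)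
    define c where "c = min b 1"
    define u where "u = (t + c) / 2"
    define e where "e = min d ((c - t) / 4)"
    have c: "t < c" "c \<le> b" "c \<le> 1" using b True by (auto simp: c_def)
    have e: "e > 0" "e \<le> d" "e \<le> (c - t) / 4" using c(1) \<open>d > 0\<close> unfolding e_def by (simp, linarith, linarith)
    obtain l where l: "\<And>s. s \<in> {0..1} \<Longrightarrow> \<bar>l s - s\<bar> \<le> e \<and> \<bar>x s - y (l s)\<bar> \<le> e"
      using close[OF e(1)] unfolding skorokhod_close_def by blast
    have u: "u \<in> {0..1}" "t < u" "u < b" using c t by (auto simp: u_def)
    have "t < l u" "l u < b" using l[OF u(1)] e c by (auto simp: u_def field_simps abs_le_iff)
    then show ?thesis
      using b(2)[of u] b(2)[of "l u"] l[OF u(1)] u e(2) unfolding dist_real_def by linarith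
  next
    case False
    with t have [simp]: "t = 1" by simp
    obtain l where tc: "time_change l" and l: "\<And>s. s \<in> {0..1} \<Longrightarrow> \<bar>x s - y (l s)\<bar> \<le> d"
      using close[OF \<open>d > 0\<close>] unfolding skorokhod_close_def by blast
    have "1 \<in> l ` {0..1}" using tc by (auto simp: time_change_def)
    then obtain s where s: "s \<in> {0..1}" "l s = 1" by auto
    have "l s \<le> l 1"
      using tc s(1) by (intro strict_mono_on_leD[of "{0..1}" l]) (auto simp: time_change_def)
    then have "l 1 = 1" using time_change_range[OF tc, of 1] s by auto
    then show ?thesis using l[of 1] \<open>d > 0\<close> by auto
  qed
  from this[of "\<bar>x t - y t\<bar> / 6"] show "x t = y t" by (cases "x t = y t") auto
qed

lemma skorokhod_dist_le:
  assumes "x \<in> cadlag" "y \<in> cadlag" "skorokhod_close x y e"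
  shows "skorokhod_dist x y \<le> e"
proof -
  have "bdd_below {e. skorokhod_close x y e}"
    by (rule bdd_belowI[of _ 0]) (simp add: skorokhod_close_nonneg)
  with assms show ?thesis by (simp add: skorokhod_dist_def cInf_lower)
qed

lemma skorokhod_dist_less:
  assumes "x \<in> cadlag" "y \<in> cadlag" "skorokhod_dist x y < e"
  obtains e' where "e' < e" "skorokhod_close x y e'"
proof -
  have "Inf {e. skorokhod_close x y e} < e" using assms by (simp add: skorokhod_dist_def)
  then obtain e' where "e' \<in> {e. skorokhod_close x y e}" "e' < e"
    using cInf_lessD[of "{e. skorokhod_close x y e}" e] skorokhod_close_ex[OF assms(1,2)] by blast
  with that show ?thesis by blast
qed

lemma skorokhod_close_mono: "skorokhod_close x y e \<Longrightarrow> e \<le> e' \<Longrightarrow> skorokhod_close x y e'"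
  unfolding skorokhod_close_def by (meson order_trans)

interpretation skorokhod: Metric_space cadlag skorokhod_dist
proof
  fix x y
  show nonneg: "0 \<le> skorokhod_dist x y" for x y
  proof (cases "x \<in> cadlag \<and> y \<in> cadlag")
    case True
    then have "{e. skorokhod_close x y e} \<noteq> {}" using skorokhod_close_ex by simp
    then have "0 \<le> Inf {e. skorokhod_close x y e}"
      by (rule cInf_greatest) (simp add: skorokhod_close_nonneg)
    with True show ?thesis by (simp add: skorokhod_dist_def)
  next
    case False
    then show ?thesis by (auto simp: skorokhod_dist_def)
  qed
  show "skorokhod_dist x y = skorokhod_dist y x"
  proof -
    have "{e. skorokhod_close x y e} = {e. skorokhod_close y x e}"
      using skorokhod_close_sym by blast
    then show ?thesis by (auto simp: skorokhod_dist_def)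
  qed
  show "skorokhod_dist x y = 0 \<longleftrightarrow> x = y" if xy: "x \<in> cadlag" "y \<in> cadlag"
  proof
    assume 0: "skorokhod_dist x y = 0"
    show "x = y"
    proof (rule skorokhod_close_eqI[OF xy])
      fix e :: real assume "e > 0"
      with 0 obtain e' where "e' < e" "skorokhod_close x y e'"
        using skorokhod_dist_less[OF xy, of e] by auto
      then show "skorokhod_close x y e" using skorokhod_close_mono by auto
    qed
  next
    assume "x = y"
    then have "skorokhod_dist x y \<le> 0"
      using skorokhod_dist_le[OF xy, of 0] skorokhod_close_refl by auto
    with nonneg[of x y] show "skorokhod_dist x y = 0" by simp
  qed
next
  fix x y z assume xyz: "x \<in> cadlag" "y \<in> cadlag" "z \<in> cadlag"
  show "skorokhod_dist x z \<le> skorokhod_dist x y + skorokhod_dist y z"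
  proof (rule field_le_epsilon)
    fix e :: real assume "e > 0"
    obtain e1 where 1: "e1 < skorokhod_dist x y + e / 2" "skorokhod_close x y e1"
      using skorokhod_dist_less[OF xyz(1,2), of "skorokhod_dist x y + e / 2"] \<open>e > 0\<close> by auto
    obtain e2 where 2: "e2 < skorokhod_dist y z + e / 2" "skorokhod_close y z e2"
      using skorokhod_dist_less[OF xyz(2,3), of "skorokhod_dist y z + e / 2"] \<open>e > 0\<close> by auto
    have "skorokhod_dist x z \<le> e1 + e2"
      using xyz 1 2 by (intro skorokhod_dist_le skorokhod_close_trans)
    with 1(1) 2(1) show "skorokhod_dist x z \<le> skorokhod_dist x y + skorokhod_dist y z + e" by simp
  qed
qed

abbreviation skorokhod_topology :: "(real \<Rightarrow> real) topology" where
  "skorokhod_topology \<equiv> skorokhod.mtopology"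

definition borel_of :: "'a topology \<Rightarrow> 'a measure" where
  "borel_of T = sigma (topspace T) {U. openin T U}"

text \<open>
  The random elements \<open>X i\<close> may live on different probability spaces \<open>M i\<close>. Being a random element
  of \<open>T\<close>, i.e. Borel measurable with values in \<open>topspace T\<close>, is part of the notion.
\<close>

definition converges_in_distribution ::
  "'b topology \<Rightarrow> 'i filter \<Rightarrow> ('i \<Rightarrow> 'w measure) \<Rightarrow> ('i \<Rightarrow> 'w \<Rightarrow> 'b) \<Rightarrow>
     'v measure \<Rightarrow> ('v \<Rightarrow> 'b) \<Rightarrow> bool" where
  "converges_in_distribution T F M X N Y \<longleftrightarrow>
     (\<forall>\<^sub>F i in F. prob_space (M i) \<and> X i \<in> measurable (M i) (borel_of T)) \<and>
     prob_space N \<and> Y \<in> measurable N (borel_of T) \<and>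
     (\<forall>f. continuous_map T euclideanreal f \<and> bounded (f ` topspace T) \<longrightarrow>
        ((\<lambda>i. \<integral>\<omega>. f (X i \<omega>) \<partial>M i) \<longlongrightarrow> (\<integral>\<omega>. f (Y \<omega>) \<partial>N)) F)"

text \<open>
  Lebesgue measure on the hyperplane \<open>{y. (\<Sum>i\<in>J. y i) = 1}\<close>, parametrized by all coordinates but
  one. The choice of the eliminated coordinate (here the one with the largest index) does not matter,
  because changing it is a substitution with Jacobian \<open>\<plusminus>1\<close>.
\<close>

definition hyperplane_lebesgue :: "nat set \<Rightarrow> (nat \<Rightarrow> real) measure" where
  "hyperplane_lebesgue J =
     distr (Pi\<^sub>M (J - {Max J}) (\<lambda>_. lborel)) (Pi\<^sub>M J (\<lambda>_. borel))
       (\<lambda>y. y(Max J := 1 - (\<Sum>i\<in>J - {Max J}. y i)))"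

definition dirichlet_density :: "nat set \<Rightarrow> (nat \<Rightarrow> real) \<Rightarrow> (nat \<Rightarrow> real) \<Rightarrow> real" where
  "dirichlet_density J \<alpha> y =
     (if \<forall>i\<in>J. 0 \<le> y i
      then Gamma (\<Sum>i\<in>J. \<alpha> i) / (\<Prod>i\<in>J. Gamma (\<alpha> i)) * (\<Prod>i\<in>J. y i powr (\<alpha> i - 1))
      else 0)"

definition dirichlet :: "nat set \<Rightarrow> (nat \<Rightarrow> real) \<Rightarrow> (nat \<Rightarrow> real) measure" where
  "dirichlet J \<alpha> = density (hyperplane_lebesgue J) (\<lambda>y. ennreal (dirichlet_density J \<alpha> y))"

text \<open>
  Measurability into \<^const>\<open>prob_algebra\<close> says that \<open>P\<close> is a random probability measure on the
  measurable space underlying \<open>H\<close>. In a partition, the cells of positive \<open>H\<close>-measure have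
  jointly a Dirichlet distribution; the \<open>H\<close>-null cells carry no mass almost surely.
\<close>

definition dirichlet_process ::
  "'w measure \<Rightarrow> real \<Rightarrow> 'x measure \<Rightarrow> ('w \<Rightarrow> 'x measure) \<Rightarrow> bool" where
  "dirichlet_process M a H P \<longleftrightarrow>
     prob_space M \<and> prob_space H \<and> a > 0 \<and> P \<in> measurable M (prob_algebra H) \<and>
     (\<forall>(k::nat) A. (\<forall>i<k. A i \<in> sets H) \<and> disjoint_family_on A {..<k} \<and> (\<Union>i<k. A i) = space H \<longrightarrow>
        (let J = {i. i < k \<and> measure H (A i) > 0} in
           distr M (Pi\<^sub>M J (\<lambda>_. borel)) (\<lambda>\<omega>. \<lambda>i\<in>J. measure (P \<omega>) (A i))
             = dirichlet J (\<lambda>i. a * measure H (A i)) \<and>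
           (\<forall>i<k. measure H (A i) = 0 \<longrightarrow> (AE \<omega> in M. measure (P \<omega>) (A i) = 0))))"

definition unit_lebesgue :: "real measure" where
  "unit_lebesgue = restrict_space lborel {0..1}"

text \<open>A Gaussian random variable is allowed to be degenerate, i.e. almost surely constant.\<close>

definition gaussian :: "'w measure \<Rightarrow> ('w \<Rightarrow> real) \<Rightarrow> bool" where
  "gaussian M X \<longleftrightarrow> X \<in> borel_measurable M \<and>
     ((\<exists>\<mu> \<sigma>. \<sigma> > 0 \<and> distributed M lborel X (\<lambda>x. ennreal (normal_density \<mu> \<sigma> x))) \<or>
      (\<exists>\<mu>. AE \<omega> in M. X \<omega> = \<mu>))"

definition gaussian_process :: "'w measure \<Rightarrow> 't set \<Rightarrow> ('t \<Rightarrow> 'w \<Rightarrow> real) \<Rightarrow> bool" where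
  "gaussian_process M T X \<longleftrightarrow> prob_space M \<and>
     (\<forall>S c. finite S \<and> S \<subseteq> T \<longrightarrow> gaussian M (\<lambda>\<omega>. \<Sum>t\<in>S. c t * X t \<omega>))"

definition brownian_bridge :: "'w measure \<Rightarrow> (real \<Rightarrow> 'w \<Rightarrow> real) \<Rightarrow> bool" where
  "brownian_bridge M B \<longleftrightarrow>
     gaussian_process M {0..1} B \<and>
     (\<forall>t\<in>{0..1}. (\<integral>\<omega>. B t \<omega> \<partial>M) = 0) \<and>
     (\<forall>s\<in>{0..1}. \<forall>t\<in>{0..1}.
        (\<integral>\<omega>. (B s \<omega> - (\<integral>\<omega>'. B s \<omega>' \<partial>M)) * (B t \<omega> - (\<integral>\<omega>'. B t \<omega>' \<partial>M)) \<partial>M) = min s t - s * t) \<and>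
     (\<forall>\<omega>\<in>space M. continuous_on {0..1} (\<lambda>t. B t \<omega>))"

end

theory Submission
  imports Defs "HOL-Real_Asymp.Real_Asymp"
begin

text \<open>
  By inf-convolution it is enough to test with bounded Lipschitz functions on the Skorokhod space, and
  both processes are compared with their step interpolations on the grid of mesh \<open>2 ^ (- m)\<close>.

  On a fixed grid one needs convergence of the characteristic functions of linear combinations
  \<open>S = \<Sum>j. c j * Y j\<close> of a symmetric Dirichlet vector with \<open>\<Sum>j. c j = 0\<close>. Size biasing
  (\<open>E\<^sub>\<alpha> (Y j * h Y) = \<alpha> j / a * E h\<close>, the right-hand side with \<open>\<alpha> j\<close> increased by one)
  yields all moments of \<open>S\<close>, and hence the Markov-Krein identity
  \<open>E (1 - s * S) powr (- a) = (\<Prod>j. (1 - s * c j) powr (- \<alpha> j))\<close>. At \<open>s = \<i> / sqrt a\<close> the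
  integrand is close to \<open>exp (\<i> * sqrt a * S)\<close> and the product tends to the Gaussian characteristic
  function.

  The error of the interpolation is controlled by the fourth moments of the increments, which are at most
  \<open>3 * h\<^sup>2 + 6 * h / a\<close>: chaining over the dyadic levels with \<open>2 ^ k \<le> a\<close> bounds it in
  \<open>L\<^sup>1\<close>, and below the finest level the distribution function is monotone and the drift at most
  \<open>sqrt a * 2 ^ (- k)\<close>.
\<close>

text \<open>Lipschitz test functions fit because the Skorokhod distance is below the uniform one
  and, between step paths on a common grid, below the l1 distance of the value vectors:
  interpolation errors become expectations of suprema, and on the grid a continuity theorem for
  Lipschitz functions is enough. Second moments of increments cannot be chained: the
  \<open>2 ^ k\<close> increments of level \<open>k\<close> have second moments of order
  \<open>h = 2 ^ (- k)\<close>, whose sum does not decay, while fourth moments of order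
  \<open>h\<^sup>2\<close> sum to order \<open>h\<close>. The extra term \<open>h / a\<close> is at
  most \<open>h\<^sup>2\<close> only as long as \<open>1 / a \<le> h\<close>, and this is what stops
  the chaining at \<open>2 ^ k \<le> a\<close>. Powers replace exponentials because
  \<open>(1 - \<i> * v / a) powr (- a)\<close> differs from \<open>exp (\<i> * v)\<close> by at most
  \<open>v\<^sup>2 / a\<close>; for \<open>v = sqrt a * S\<close> this is \<open>S\<^sup>2\<close>,
  whose mean is of order \<open>1 / a\<close>. The bridge needs no rate: it is a single process, and
  pathwise convergence of its step paths suffices.\<close>

section \<open>Paths in the Skorokhod space\<close>

text \<open>The finite partition into half-open pieces \<open>[p, q)\<close> of small oscillation;
  "same piece" is encoded as "no point of \<open>S\<close> separates \<open>s\<close> from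
  \<open>t\<close>", which avoids sorting \<open>S\<close>. Bisection glues local partitions, and
  locally one cut suffices because \<open>x\<close> has one-sided limits.\<close>

lemma cadlag_partition:
  assumes x: "x \<in> cadlag" and e: "e > 0"
  obtains S where "finite S" "S \<subseteq> {0..1}"
    "\<And>s t. s \<in> {0..1} \<Longrightarrow> t \<in> {0..1} \<Longrightarrow> (\<And>p. p \<in> S \<Longrightarrow> p \<le> s \<longleftrightarrow> p \<le> t) \<Longrightarrow> \<bar>x s - x t\<bar> \<le> e"
proof -
  define Q where "Q S a b \<longleftrightarrow> finite S \<and> S \<subseteq> {0..1} \<and> (\<forall>s\<in>{a..b} \<inter> {0..1}. \<forall>t\<in>{a..b} \<inter> {0..1}.
     (\<forall>p\<in>S. p \<le> s \<longleftrightarrow> p \<le> t) \<longrightarrow> \<bar>x s - x t\<bar> \<le> e)" for S a b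
  have QD: "\<bar>x s - x t\<bar> \<le> e" if "Q S a b" "s \<in> {a..b} \<inter> {0..1}" "t \<in> {a..b} \<inter> {0..1}"
    "\<forall>p\<in>S. p \<le> s \<longleftrightarrow> p \<le> t" for S a b s t
    using that(1)[unfolded Q_def, THEN conjunct2, THEN conjunct2] that(2-4) by (metis (no_types, lifting))
  define P where "P a b \<longleftrightarrow> (\<exists>S. Q S a b)" for a b
  have "P 0 1"
  proof (rule Bolzano)
    show "(0::real) \<le> 1" by simp
  next
    fix a b c :: real
    assume "P a b" "P b c" "a \<le> b" "b \<le> c"
    then obtain S T where S: "Q S a b" and T: "Q T b c" by (auto simp: P_def)
    \<comment> \<open>With \<open>b\<close> itself as a cut, unseparated points lie on the same side
      of \<open>b\<close>. The intersection is there because the bisection intervals may leave the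
      unit interval.\<close>
    have "Q (S \<union> T \<union> ({b} \<inter> {0..1})) a c"
      unfolding Q_def
    proof (intro conjI ballI impI)
      show "finite (S \<union> T \<union> ({b} \<inter> {0..1}))" "S \<union> T \<union> ({b} \<inter> {0..1}) \<subseteq> {0..1}"
        using S T unfolding Q_def by blast+
      fix s t assume st: "s \<in> {a..c} \<inter> {0..1}" "t \<in> {a..c} \<inter> {0..1}"
        and p: "\<forall>p\<in>S \<union> T \<union> ({b} \<inter> {0..1}). p \<le> s \<longleftrightarrow> p \<le> t"
      have b: "b \<le> s \<longleftrightarrow> b \<le> t"
      proof (cases "b \<in> {0..1}")
        case True
        then show ?thesis by (intro bspec[OF p]) simp
      next
        case False
        with st show ?thesis by auto
      qed
      show "\<bar>x s - x t\<bar> \<le> e"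
      proof (cases "b \<le> s")
        case True
        with b have "b \<le> t" by simp
        with True have "s \<in> {b..c} \<inter> {0..1}" "t \<in> {b..c} \<inter> {0..1}" using st by simp_all
        then show ?thesis by (rule QD[OF T]) (use p in blast)
      next
        case False
        with b have "\<not> b \<le> t" by simp
        with False have "s \<in> {a..b} \<inter> {0..1}" "t \<in> {a..b} \<inter> {0..1}" using st by simp_all
        then show ?thesis by (rule QD[OF S]) (use p in blast)
      qed
    qed
    then show "P a c" unfolding P_def by (rule exI)
  next
    fix t :: real assume t: "0 \<le> t" "t \<le> 1"
    have "\<exists>d>0. \<forall>s\<in>{t..<t+d} \<inter> {0..1}. \<bar>x s - x t\<bar> < e / 2"
    proof (cases "t < 1")
      case True
      then have "(x \<longlongrightarrow> x t) (at_right t)" using x t by (auto simp: cadlag_def)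
      then have "eventually (\<lambda>s. dist (x s) (x t) < e / 2) (at_right t)"
        by (rule tendstoD) (use e in simp)
      then obtain b where "b > t" and b: "\<And>s. t < s \<Longrightarrow> s < b \<Longrightarrow> dist (x s) (x t) < e / 2"
        by (auto simp: eventually_at_right_field)
      have "\<bar>x s - x t\<bar> < e / 2" if "s \<in> {t..<t+(b-t)}" for s
      proof (cases "s = t")
        case False
        with that have "t < s" "s < b" by simp_all
        from b[OF this] show ?thesis by (simp add: dist_real_def)
      qed (use e in simp)
      moreover have "b - t > 0" using \<open>b > t\<close> by simp
      ultimately show ?thesis by blast
    next
      case False
      have "\<bar>x s - x t\<bar> < e / 2" if "s \<in> {t..<t+1} \<inter> {0..1}" for s
      proof -
        have "s = t" using that False t by simp
        then show ?thesis using e by simp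
      qed
      then show ?thesis by (intro exI[of _ 1]) auto
    qed
    then obtain d1 where d1: "d1 > 0" "\<And>s. s \<in> {t..<t+d1} \<inter> {0..1} \<Longrightarrow> \<bar>x s - x t\<bar> < e / 2" by blast
    have "\<exists>l. \<exists>d>0. \<forall>s\<in>{t-d<..<t} \<inter> {0..1}. \<bar>x s - l\<bar> < e / 2"
    proof (cases "0 < t")
      case True
      with t have "t \<in> {0<..1}" by simp
      with x obtain l where "(x \<longlongrightarrow> l) (at_left t)" unfolding cadlag_def by blast
      then have "eventually (\<lambda>s. dist (x s) l < e / 2) (at_left t)"
        by (rule tendstoD) (use e in simp)
      then obtain b where "b < t" and b: "\<And>s. b < s \<Longrightarrow> s < t \<Longrightarrow> dist (x s) l < e / 2"
        by (auto simp: eventually_at_left_field)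
      have "\<bar>x s - l\<bar> < e / 2" if "s \<in> {t-(t-b)<..<t}" for s
        using b[of s] that by (auto simp: dist_real_def)
      moreover have "t - b > 0" using \<open>b < t\<close> by simp
      ultimately show ?thesis by blast
    next
      case False
      with t show ?thesis by (intro exI[of _ 0] exI[of _ 1]) auto
    qed
    then obtain l d2 where d2: "d2 > 0" "\<And>s. s \<in> {t-d2<..<t} \<inter> {0..1} \<Longrightarrow> \<bar>x s - l\<bar> < e / 2" by blast
    \<comment> \<open>Points at or after \<open>t\<close> are compared with \<open>x t\<close>,
      points before \<open>t\<close> with the left limit \<open>l\<close>; the cut at
      \<open>t\<close> never mixes the two.\<close>
    have "Q {t} a b" if ab: "a \<le> t" "t \<le> b" "b - a < min d1 d2" for a b
      unfolding Q_def
    proof (intro conjI ballI impI)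
      show "finite {t}" "{t} \<subseteq> {0..1}" using t by auto
      fix r s assume rs: "r \<in> {a..b} \<inter> {0..1}" "s \<in> {a..b} \<inter> {0..1}"
        and p: "\<forall>p\<in>{t}. (p \<le> r) = (p \<le> s)"
      show "\<bar>x r - x s\<bar> \<le> e"
      proof (cases "t \<le> r")
        case True
        with p have "t \<le> s" by simp
        then have "r \<in> {t..<t+d1} \<inter> {0..1}" "s \<in> {t..<t+d1} \<inter> {0..1}"
          using rs ab True unfolding Int_iff atLeastAtMost_iff atLeastLessThan_iff by linarith+
        from d1(2)[OF this(1)] d1(2)[OF this(2)] show ?thesis by linarith
      next
        case False
        with p have "s < t" by simp
        then have "r \<in> {t-d2<..<t} \<inter> {0..1}" "s \<in> {t-d2<..<t} \<inter> {0..1}"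
          using rs ab False unfolding Int_iff atLeastAtMost_iff greaterThanLessThan_iff by linarith+
        from d2(2)[OF this(1)] d2(2)[OF this(2)] show ?thesis by linarith
      qed
    qed
    then show "\<exists>d>0. \<forall>a b. a \<le> t \<and> t \<le> b \<and> b - a < d \<longrightarrow> P a b"
      using d1(1) d2(1) unfolding P_def by (intro exI[of _ "min d1 d2"]) (simp, blast)
  qed
  then obtain S where "Q S 0 1" by (auto simp: P_def)
  from this have S: "finite S" "S \<subseteq> {0..1}"
    unfolding Q_def by simp_all
  show ?thesis
  proof (rule that[OF S])
    fix s t :: real assume "s \<in> {0..1}" "t \<in> {0..1}" "\<And>p. p \<in> S \<Longrightarrow> p \<le> s \<longleftrightarrow> p \<le> t"
    then show "\<bar>x s - x t\<bar> \<le> e" by (intro QD[OF \<open>Q S 0 1\<close>]) auto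
  qed
qed

lemma finite_separated:
  fixes S :: "real set"
  assumes "finite S"
  obtains h where "h > 0" "\<And>p q. p \<in> S \<Longrightarrow> q \<in> S \<Longrightarrow> p \<noteq> q \<Longrightarrow> h \<le> \<bar>p - q\<bar>"
proof
  \<comment> \<open>The element 1 keeps the set nonempty when \<open>S\<close> has at most one
    point.\<close>
  let ?D = "insert 1 ((\<lambda>(p, q). \<bar>p - q\<bar>) ` {z \<in> S \<times> S. fst z \<noteq> snd z})"
  have fin: "finite ?D" using assms by auto
  show "Min ?D > 0" using fin by (subst Min_gr_iff) auto
  show "Min ?D \<le> \<bar>p - q\<bar>" if "p \<in> S" "q \<in> S" "p \<noteq> q" for p q
  proof (rule Min_le[OF fin])
    have "(\<lambda>(p, q). \<bar>p - q\<bar>) (p, q) \<in> (\<lambda>(p, q). \<bar>p - q\<bar>) ` {z \<in> S \<times> S. fst z \<noteq> snd z}"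
      using that by (intro imageI) simp
    then show "\<bar>p - q\<bar> \<in> ?D" by simp
  qed
qed

text \<open>The displacements are spread by hat functions of width below the gaps of \<open>S\<close>; their slopes
  are too small to spoil monotonicity.\<close>

lemma time_change_interpolation:
  fixes S :: "real set"
  assumes S: "finite S" "{0, 1} \<subseteq> S" and e: "e > 0"
  obtains d where "d > 0"
    "\<And>u. u 0 = 0 \<Longrightarrow> u 1 = 1 \<Longrightarrow> (\<And>p. p \<in> S \<Longrightarrow> \<bar>u p - p\<bar> \<le> d) \<Longrightarrow>
       \<exists>l. time_change l \<and> (\<forall>p\<in>S. l p = u p) \<and> (\<forall>t. \<bar>l t - t\<bar> \<le> e)"
proof -
  obtain h where h: "h > 0" "\<And>p q. p \<in> S \<Longrightarrow> q \<in> S \<Longrightarrow> p \<noteq> q \<Longrightarrow> h \<le> \<bar>p - q\<bar>"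
    using finite_separated[OF S(1)] by blast
  define n where "n = real (card S)"
  have n: "n \<ge> 0" by (simp add: n_def)
  \<comment> \<open>The \<open>n\<close> hats together displace a point by at most
    \<open>n * d\<close> and have total slope at most \<open>n * d / h\<close>. The
    \<open>+ 1\<close> makes this slope strictly less than 1.\<close>
  define d where "d = min h e / (n + 1)"
  have d: "d > 0" "n * d < h" "n * d \<le> e"
  proof -
    show "d > 0" using h e n by (simp add: d_def)
    have "(n + 1) * d = min h e" using n by (simp add: d_def)
    then have "n * d + d = min h e" by (simp add: algebra_simps)
    with \<open>d > 0\<close> show "n * d < h" "n * d \<le> e" by linarith+
  qed
  define hat where "hat p t = max 0 (1 - \<bar>t - p\<bar> / h)" for p t :: real
  have hat_lip: "\<bar>hat p t - hat p s\<bar> \<le> \<bar>t - s\<bar> / h" for p t s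
  proof -
    have "\<bar>\<bar>t - p\<bar> / h - \<bar>s - p\<bar> / h\<bar> \<le> \<bar>t - s\<bar> / h"
      using h(1) by (simp add: diff_divide_distrib[symmetric] divide_right_mono)
    then show ?thesis unfolding hat_def by linarith
  qed
  have hat01: "0 \<le> hat p t" "hat p t \<le> 1" for p t using h(1) by (auto simp: hat_def)
  have hat_S: "hat p q = (if p = q then 1 else 0)" if "p \<in> S" "q \<in> S" for p q
    using h(2)[OF that] h(1) by (auto simp: hat_def abs_minus_commute)
  show ?thesis
  proof (rule that[OF d(1)])
    fix u :: "real \<Rightarrow> real" assume u01: "u 0 = 0" "u 1 = 1" and u: "\<And>p. p \<in> S \<Longrightarrow> \<bar>u p - p\<bar> \<le> d"
    define l where "l t = t + (\<Sum>p\<in>S. (u p - p) * hat p t)" for t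
    have lS: "l q = u q" if "q \<in> S" for q
    proof -
      have "(\<Sum>p\<in>S. (u p - p) * hat p q) = (\<Sum>p\<in>S. if p = q then u q - q else 0)"
        using that by (intro sum.cong) (auto simp: hat_S)
      then show ?thesis using that S by (simp add: l_def)
    qed
    have "\<bar>l t - t\<bar> \<le> e" for t
    proof -
      have "\<bar>(u p - p) * hat p t\<bar> \<le> d" if "p \<in> S" for p
        using mult_mono[of "\<bar>u p - p\<bar>" d "hat p t" 1] u[OF that] hat01[of p t] d(1)
        by (simp add: abs_mult)
      then have "\<bar>\<Sum>p\<in>S. (u p - p) * hat p t\<bar> \<le> (\<Sum>p\<in>S. d)"
        by (intro order_trans[OF sum_abs] sum_mono)
      also have "\<dots> = n * d" by (simp add: n_def)
      finally show ?thesis using d by (simp add: l_def)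
    qed
    moreover have "time_change l"
      unfolding time_change_def
    proof (intro conjI)
      show mono: "strict_mono_on {0..1} l"
      proof (rule strict_mono_onI)
        fix s t :: real assume "s < t"
        have "\<bar>\<Sum>p\<in>S. (u p - p) * (hat p t - hat p s)\<bar> \<le> (\<Sum>p\<in>S. d * (\<bar>t - s\<bar> / h))"
          using u hat_lip d(1) unfolding abs_mult
          by (intro order_trans[OF sum_abs] sum_mono) (unfold abs_mult, intro mult_mono, auto)
        also have "\<dots> = n * d * ((t - s) / h)" using \<open>s < t\<close> by (simp add: n_def)
        also have "\<dots> < h * ((t - s) / h)"
          using d(2) \<open>s < t\<close> h(1) by (intro mult_strict_right_mono) auto
        also have "\<dots> = t - s" using h by simp
        finally have "\<bar>\<Sum>p\<in>S. (u p - p) * (hat p t - hat p s)\<bar> < t - s" .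
        moreover have "l t - l s = (t - s) + (\<Sum>p\<in>S. (u p - p) * (hat p t - hat p s))"
          by (simp add: l_def right_diff_distrib sum_subtractf)
        ultimately show "l s < l t" by linarith
      qed
      show cont: "continuous_on {0..1} l"
        unfolding l_def hat_def using h(1) by (intro continuous_intros) auto
      have l01: "l 0 = 0" "l 1 = 1" using lS u01 S by auto
      show "l ` {0..1} = {0..1}"
      proof
        show "l ` {0..1} \<subseteq> {0..1}"
        proof
          fix y assume "y \<in> l ` {0..1}"
          then obtain t where t: "t \<in> {0..1}" "y = l t" by auto
          have "l 0 \<le> l t" "l t \<le> l 1"
            using mono t by (auto intro!: strict_mono_on_leD[of "{0..1}" l])
          with l01 t show "y \<in> {0..1}" by simp
        qed
        show "{0..1} \<subseteq> l ` {0..1}"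
        proof
          fix y :: real assume "y \<in> {0..1}"
          then obtain t where "0 \<le> t" "t \<le> 1" "l t = y"
            using IVT'[of l 0 y 1] cont l01 by auto
          then show "y \<in> l ` {0..1}" by auto
        qed
      qed
    qed
    ultimately show "\<exists>l. time_change l \<and> (\<forall>p\<in>S. l p = u p) \<and> (\<forall>t. \<bar>l t - t\<bar> \<le> e)"
      using lS by blast
  qed
qed

section \<open>Step paths and their approximation of cadlag paths\<close>

text \<open>The index reaches \<open>n\<close> exactly at \<open>t = 1\<close>, so the path has
  \<open>n + 1\<close> values, and index sets are \<open>{..n}\<close> below.\<close>

definition step_path :: "nat \<Rightarrow> (nat \<Rightarrow> real) \<Rightarrow> real \<Rightarrow> real" where
  "step_path n v = (\<lambda>t\<in>{0..1}. v (nat \<lfloor>real n * t\<rfloor>))"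

lemma step_path_cadlag:
  assumes n: "n > 0"
  shows "step_path n v \<in> cadlag"
  unfolding cadlag_def
proof (intro CollectI conjI ballI)
  show "step_path n v \<in> extensional {0..1}" by (simp add: step_path_def)
next
  fix t :: real assume t: "t \<in> {0..<1}"
  define b where "b = min 1 ((of_int \<lfloor>real n * t\<rfloor> + 1) / real n)"
  have "real n * t < of_int \<lfloor>real n * t\<rfloor> + 1" by linarith
  then have "t < b" using t n by (auto simp: b_def pos_less_divide_eq mult.commute)
  then have "eventually (\<lambda>s. t < s \<and> s < b) (at_right t)"
    by (auto simp: eventually_at_right_field)
  then have "eventually (\<lambda>s. step_path n v s = step_path n v t) (at_right t)"
  proof eventually_elim
    case (elim s)
    have "s < (of_int \<lfloor>real n * t\<rfloor> + 1) / real n" using elim by (simp add: b_def)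
    then have "real n * s < of_int \<lfloor>real n * t\<rfloor> + 1"
      using n by (simp add: pos_less_divide_eq mult.commute)
    moreover have "real n * t \<le> real n * s" using elim by (intro mult_left_mono) simp_all
    ultimately have "\<lfloor>real n * s\<rfloor> = \<lfloor>real n * t\<rfloor>" by linarith
    moreover have "s \<le> 1" using elim by (simp add: b_def)
    ultimately show ?case using elim t by (simp add: step_path_def)
  qed
  then show "(step_path n v \<longlongrightarrow> step_path n v t) (at_right t)" by (rule tendsto_eventually)
next
  fix t :: real assume t: "t \<in> {0<..1}"
  \<comment> \<open>At a grid point \<open>t\<close> the left limit belongs to the preceding cell,
    hence the ceiling minus one instead of the floor.\<close>
  define b where "b = max 0 ((of_int \<lceil>real n * t\<rceil> - 1) / real n)"
  have "of_int \<lceil>real n * t\<rceil> - 1 < real n * t" by linarith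
  then have "b < t" using t n by (auto simp: b_def pos_divide_less_eq mult.commute)
  then have "eventually (\<lambda>s. b < s \<and> s < t) (at_left t)"
    by (auto simp: eventually_at_left_field)
  then have "eventually (\<lambda>s. step_path n v s = v (nat (\<lceil>real n * t\<rceil> - 1))) (at_left t)"
  proof eventually_elim
    case (elim s)
    have "(of_int \<lceil>real n * t\<rceil> - 1) / real n < s" using elim by (simp add: b_def)
    then have "of_int \<lceil>real n * t\<rceil> - 1 < real n * s"
      using n by (simp add: pos_divide_less_eq mult.commute)
    moreover have "real n * s < real n * t" using elim n by (intro mult_strict_left_mono) simp_all
    ultimately have "\<lfloor>real n * s\<rfloor> = \<lceil>real n * t\<rceil> - 1" by linarith
    moreover have "0 \<le> s" using elim by (simp add: b_def)
    ultimately show ?case using elim t by (simp add: step_path_def)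
  qed
  then show "\<exists>l. (step_path n v \<longlongrightarrow> l) (at_left t)" using tendsto_eventually by blast
qed

text \<open>A uniform estimate fails at jumps of \<open>x\<close> off the grid. The time change
  moves every cut to a grid point, after which \<open>t\<close> and the grid point \<open>r\<close>
  sampled at \<open>l t\<close> lie in the same piece of the partition.\<close>

lemma skorokhod_close_step_path:
  assumes x: "x \<in> cadlag" and e: "e > 0"
  shows "\<forall>\<^sub>F n in sequentially. skorokhod_close x (step_path n (\<lambda>i. x (real i / real n))) e"
proof -
  obtain S where S: "finite S" "S \<subseteq> {0..1}"
    and Sx: "\<And>s t. s \<in> {0..1} \<Longrightarrow> t \<in> {0..1} \<Longrightarrow> (\<And>p. p \<in> S \<Longrightarrow> p \<le> s \<longleftrightarrow> p \<le> t) \<Longrightarrow> \<bar>x s - x t\<bar> \<le> e"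
    using cadlag_partition[OF x e] by blast
  \<comment> \<open>The end points join the cuts because the time change must fix them.\<close>
  define T where "T = insert 0 (insert 1 S)"
  have T: "finite T" "{0, 1} \<subseteq> T" "T \<subseteq> {0..1}" "S \<subseteq> T" using S by (auto simp: T_def)
  obtain d where d: "d > 0" and ex: "\<And>u. u 0 = 0 \<Longrightarrow> u 1 = 1 \<Longrightarrow> (\<And>p. p \<in> T \<Longrightarrow> \<bar>u p - p\<bar> \<le> d) \<Longrightarrow>
       \<exists>l. time_change l \<and> (\<forall>p\<in>T. l p = u p) \<and> (\<forall>t. \<bar>l t - t\<bar> \<le> e)"
    using time_change_interpolation[OF T(1,2) e] by blast
  have "eventually (\<lambda>n. inverse (real n) < d) sequentially"
    using d by (intro order_tendstoD(2)[OF tendsto_inverse_0_at_top[OF filterlim_real_sequentially]]) 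
  then show ?thesis using eventually_gt_at_top[of 0]
  proof eventually_elim
    case (elim n)
    \<comment> \<open>Each cut is rounded up: the grid point \<open>u p\<close> is not before
      \<open>p\<close>, so the step path already takes a value from the right-hand piece there.
      Rounding down would sample the piece before the cut.\<close>
    define u where "u p = of_int \<lceil>real n * p\<rceil> / real n" for p
    have "\<bar>u p - p\<bar> \<le> d" for p
    proof -
      have "\<bar>of_int \<lceil>real n * p\<rceil> - real n * p\<bar> / real n \<le> 1 / real n"
        by (intro divide_right_mono) (linarith, simp)
      also have "\<bar>of_int \<lceil>real n * p\<rceil> - real n * p\<bar> / real n = \<bar>u p - p\<bar>"
        using elim by (subst abs_div_pos) (auto simp: u_def diff_divide_distrib)
      finally have "\<bar>u p - p\<bar> \<le> inverse (real n)" by (simp add: inverse_eq_divide)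
      with elim show ?thesis by simp
    qed
    then obtain l where l: "time_change l" "\<And>p. p \<in> T \<Longrightarrow> l p = u p" "\<And>t. \<bar>l t - t\<bar> \<le> e"
      using ex[of u] elim by (auto simp: u_def)
    show ?case unfolding skorokhod_close_def
    proof (intro exI[of _ l] conjI ballI l)
      fix t :: real assume t: "t \<in> {0..1}"
      define r where "r = of_int \<lfloor>real n * l t\<rfloor> / real n"
      have lt: "l t \<in> {0..1}" using time_change_range[OF l(1) t] .
      have r: "r \<in> {0..1}"
      proof -
        have "real n * l t \<le> real n * 1" using lt elim by (intro mult_left_mono) auto
        then have "of_int \<lfloor>real n * l t\<rfloor> \<le> real n" by linarith
        then show ?thesis using lt elim by (auto simp: r_def)
      qed
      have "p \<le> t \<longleftrightarrow> p \<le> r" if "p \<in> S" for p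
      proof -
        have "p \<le> t \<longleftrightarrow> l p \<le> l t"
          using l(1) t that S by (intro strict_mono_on_less_eq[of "{0..1}" l, symmetric]) (auto simp: time_change_def)
        also have "\<dots> \<longleftrightarrow> of_int \<lceil>real n * p\<rceil> \<le> real n * l t"
          using that T(4) elim by (subst l(2)) (auto simp: u_def field_simps)
        also have "\<dots> \<longleftrightarrow> real n * p \<le> of_int \<lfloor>real n * l t\<rfloor>"
          by (simp add: le_floor_iff[symmetric] ceiling_le_iff)
        also have "\<dots> \<longleftrightarrow> p \<le> r" using elim by (auto simp: r_def field_simps)
        finally show ?thesis .
      qed
      moreover have "step_path n (\<lambda>i. x (real i / real n)) (l t) = x r"
        using lt elim by (simp add: step_path_def r_def)
      ultimately show "\<bar>x t - step_path n (\<lambda>i. x (real i / real n)) (l t)\<bar> \<le> e"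
        using Sx[OF t r] by simp
    qed
  qed
qed

lemma skorokhod_dist_sup:
  assumes "x \<in> cadlag" "y \<in> cadlag" "\<And>t. t \<in> {0..1} \<Longrightarrow> \<bar>x t - y t\<bar> \<le> e"
  shows "skorokhod_dist x y \<le> e"
proof (rule skorokhod_dist_le[OF assms(1,2)])
  have "0 \<le> e" using assms(3)[of 0] by simp
  then show "skorokhod_close x y e"
    unfolding skorokhod_close_def using assms(3) time_change_id by (intro exI[of _ "\<lambda>t. t"]) auto
qed

lemma skorokhod_dist_step_path:
  assumes x: "x \<in> cadlag"
  shows "(\<lambda>n. skorokhod_dist (step_path n (\<lambda>i. x (real i / real n))) x) \<longlonglongrightarrow> 0"
proof (rule tendstoI)
  fix e :: real assume e: "e > 0"
  have "\<forall>\<^sub>F n in sequentially. skorokhod_close x (step_path n (\<lambda>i. x (real i / real n))) (e / 2)"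
    using e by (intro skorokhod_close_step_path x) simp
  with eventually_gt_at_top[of 0]
  show "\<forall>\<^sub>F n in sequentially. dist (skorokhod_dist (step_path n (\<lambda>i. x (real i / real n))) x) 0 < e"
  proof eventually_elim
    case (elim n)
    then have "skorokhod_dist x (step_path n (\<lambda>i. x (real i / real n))) \<le> e / 2"
      by (intro skorokhod_dist_le x step_path_cadlag)
    then show ?case using e skorokhod.nonneg skorokhod.commute by simp
  qed
qed

section \<open>Measurability of random paths\<close>

lemma sets_borel_of: "sets (borel_of T) = sigma_sets (topspace T) {U. openin T U}"
  unfolding borel_of_def by (rule sets_measure_of) (auto dest: openin_subset)

lemma space_borel_of: "space (borel_of T) = topspace T"
  unfolding borel_of_def by (rule space_measure_of) (auto dest: openin_subset)

lemma continuous_map_measurable: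
  assumes "continuous_map T euclideanreal f"
  shows "f \<in> borel_measurable (borel_of T)"
proof (rule borel_measurableI)
  fix S :: "real set" assume "open S"
  then have "openin T {x \<in> topspace T. f x \<in> S}"
    using assms by (intro openin_continuous_map_preimage[OF assms]) simp
  moreover have "f -` S \<inter> space (borel_of T) = {x \<in> topspace T. f x \<in> S}"
    by (auto simp: space_borel_of)
  ultimately show "f -` S \<inter> space (borel_of T) \<in> sets (borel_of T)"
    by (auto simp: sets_borel_of)
qed

text \<open>Every cadlag path is the limit of step paths with values in a fixed countable set.\<close>

lemma measurable_skorokhod:
  fixes X :: "'a \<Rightarrow> real \<Rightarrow> real"
  assumes cad: "\<And>w. w \<in> space M \<Longrightarrow> X w \<in> cadlag"
    and meas: "\<And>t. t \<in> {0..1} \<Longrightarrow> (\<lambda>w. X w t) \<in> borel_measurable M"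
  shows "X \<in> measurable M (borel_of skorokhod_topology)"
proof -
  define code where "code n w = map (\<lambda>i. \<lfloor>real n * X w (real i / real n)\<rfloor>) [0..<Suc n]" for n w
  define Y where "Y n w = step_path n (\<lambda>i. of_int (code n w ! i) / real n)" for n w
  \<comment> \<open>Integer lists are countable, so this holds for an arbitrary set
    \<open>L\<close>. Hence no measurability of the sets \<open>V k\<close> of paths below has to be
    shown.\<close>
  have code: "{w \<in> space M. code n w \<in> L} \<in> sets M" if "n > 0" for n L
  proof -
    have "{w \<in> space M. code n w = l} \<in> sets M" for l
    proof -
      have [measurable]: "(\<lambda>w. X w (real i / real n)) \<in> borel_measurable M" if "i < Suc n" for i
        using that \<open>n > 0\<close> by (intro meas) auto
      have "{w \<in> space M. \<lfloor>real n * X w (real i / real n)\<rfloor> = l ! i} \<in> sets M" if "i < Suc n" for i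
        using that by measurable
      then have "{w \<in> space M. \<forall>i\<in>{..<Suc n}. \<lfloor>real n * X w (real i / real n)\<rfloor> = l ! i} \<in> sets M"
        by (intro sets.sets_Collect_finite_All') auto
      moreover have "{w \<in> space M. code n w = l} = (if length l = Suc n then
          {w \<in> space M. \<forall>i\<in>{..<Suc n}. \<lfloor>real n * X w (real i / real n)\<rfloor> = l ! i} else {})"
        by (auto simp: code_def list_eq_iff_nth_eq simp del: upt_Suc)
      ultimately show ?thesis by auto
    qed
    then have "(\<Union>l\<in>L. {w \<in> space M. code n w = l}) \<in> sets M"
      by (intro sets.countable_UN') auto
    moreover have "(\<Union>l\<in>L. {w \<in> space M. code n w = l}) = {w \<in> space M. code n w \<in> L}" by auto
    ultimately show ?thesis by simp
  qed
  have Ycad: "Y n w \<in> cadlag" if "n > 0" for n w using that by (simp add: Y_def step_path_cadlag)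
  have lim: "(\<lambda>n. skorokhod_dist (Y n w) (X w)) \<longlonglongrightarrow> 0" if w: "w \<in> space M" for w
  proof (rule tendsto_sandwich[OF _ _ tendsto_const])
    let ?Z = "\<lambda>n. step_path n (\<lambda>i. X w (real i / real n))"
    show "\<forall>\<^sub>F n in sequentially. 0 \<le> skorokhod_dist (Y n w) (X w)"
      using skorokhod.nonneg by simp
    show "(\<lambda>n. 1 / real n + skorokhod_dist (?Z n) (X w)) \<longlonglongrightarrow> 0"
      by (rule tendsto_add_zero[OF lim_1_over_n skorokhod_dist_step_path[OF cad[OF w]]])
    show "\<forall>\<^sub>F n in sequentially. skorokhod_dist (Y n w) (X w) \<le> 1 / real n + skorokhod_dist (?Z n) (X w)"
      using eventually_gt_at_top[of 0]
    proof eventually_elim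
      case (elim n)
      have "skorokhod_dist (Y n w) (?Z n) \<le> 1 / real n"
      proof (rule skorokhod_dist_sup)
        fix t :: real assume t: "t \<in> {0..1}"
        define i where "i = nat \<lfloor>real n * t\<rfloor>"
        have "real n * t \<le> real n * 1" using t elim by (intro mult_left_mono) auto
        then have i: "i < Suc n" unfolding i_def by linarith
        have "\<bar>of_int \<lfloor>real n * X w (real i / real n)\<rfloor> - real n * X w (real i / real n)\<bar> / real n \<le> 1 / real n"
          by (intro divide_right_mono) (linarith, simp)
        also have "\<bar>of_int \<lfloor>real n * X w (real i / real n)\<rfloor> - real n * X w (real i / real n)\<bar> / real n
            = \<bar>of_int (code n w ! i) / real n - X w (real i / real n)\<bar>"
          using i elim by (subst abs_div_pos) (auto simp: code_def diff_divide_distrib simp del: upt_Suc)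
        finally have "\<bar>of_int (code n w ! i) / real n - X w (real i / real n)\<bar> \<le> 1 / real n" .
        then show "\<bar>Y n w t - ?Z n t\<bar> \<le> 1 / real n"
          using t by (simp add: Y_def step_path_def i_def)
      qed (use Ycad elim step_path_cadlag in auto)
      moreover have "skorokhod_dist (Y n w) (X w) \<le> skorokhod_dist (Y n w) (?Z n) + skorokhod_dist (?Z n) (X w)"
        using elim by (intro skorokhod.triangle Ycad step_path_cadlag cad w) auto
      ultimately show ?case by simp
    qed
  qed
  show ?thesis
    unfolding borel_of_def
  proof (rule measurable_measure_of)
    show "{U. openin skorokhod_topology U} \<subseteq> Pow (topspace skorokhod_topology)"
      using openin_subset by blast
    show "X \<in> space M \<rightarrow> topspace skorokhod_topology" using cad by simp
    fix U assume "U \<in> {U. openin skorokhod_topology U}"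
    then have U: "U \<subseteq> cadlag" "\<And>x. x \<in> U \<Longrightarrow> \<exists>r>0. skorokhod.mball x r \<subseteq> U"
      by (auto simp: skorokhod.openin_mtopology)
    \<comment> \<open>\<open>V k\<close> is \<open>U\<close> shrunk by the margin
      \<open>1 / Suc k\<close>. The limit \<open>X w\<close> lies in the open set \<open>U\<close>
      iff some \<open>V k\<close> contains a tail of the \<open>Y n w\<close>, which involves only
      countably many events about codes.\<close>
    define V where "V k = {x. \<forall>y\<in>cadlag. skorokhod_dist x y < 1 / real (Suc k) \<longrightarrow> y \<in> U}" for k
    have "X w \<in> U \<longleftrightarrow> (\<exists>k. \<exists>m. \<forall>n. n \<ge> m \<and> n > 0 \<longrightarrow> Y n w \<in> V k)" if w: "w \<in> space M" for w
    proof
      assume "X w \<in> U"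
      then obtain r where r: "r > 0" "skorokhod.mball (X w) r \<subseteq> U" using U by blast
      then obtain k where k: "1 / real (Suc k) < r / 2"
        using nat_approx_posE[of "r / 2"] by auto
      have "eventually (\<lambda>n. skorokhod_dist (Y n w) (X w) < r / 2) sequentially"
        using r by (intro order_tendstoD(2)[OF lim[OF w]]) auto
      then obtain m where m: "\<And>n. n \<ge> m \<Longrightarrow> skorokhod_dist (Y n w) (X w) < r / 2"
        by (auto simp: eventually_sequentially)
      have "Y n w \<in> V k" if n: "n \<ge> m" "n > 0" for n
        unfolding V_def
      proof (intro CollectI ballI impI)
        fix y assume y: "y \<in> cadlag" "skorokhod_dist (Y n w) y < 1 / real (Suc k)"
        have "skorokhod_dist (X w) y \<le> skorokhod_dist (X w) (Y n w) + skorokhod_dist (Y n w) y"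
          using n y by (intro skorokhod.triangle Ycad cad w)
        also have "\<dots> < r" using m[OF n(1)] y(2) k by (simp add: skorokhod.commute)
        finally show "y \<in> U" using r(2) y(1) cad[OF w] by auto
      qed
      then show "\<exists>k. \<exists>m. \<forall>n. n \<ge> m \<and> n > 0 \<longrightarrow> Y n w \<in> V k" by blast
    next
      assume "\<exists>k. \<exists>m. \<forall>n. n \<ge> m \<and> n > 0 \<longrightarrow> Y n w \<in> V k"
      then obtain k m where km: "\<And>n. n \<ge> m \<Longrightarrow> n > 0 \<Longrightarrow> Y n w \<in> V k" by blast
      have "eventually (\<lambda>n. skorokhod_dist (Y n w) (X w) < 1 / real (Suc k)) sequentially"
        by (intro order_tendstoD(2)[OF lim[OF w]]) auto
      with eventually_ge_at_top[of m] eventually_gt_at_top[of 0]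
      have "eventually (\<lambda>n. X w \<in> U) sequentially"
      proof eventually_elim
        case (elim n)
        with km[of n] cad[OF w] show ?case by (auto simp: V_def)
      qed
      then show "X w \<in> U" by simp
    qed
    then have "X -` U \<inter> space M = {w \<in> space M. \<exists>k. \<exists>m. \<forall>n. n \<ge> m \<and> n > 0 \<longrightarrow> Y n w \<in> V k}" by auto
    also have "\<dots> \<in> sets M"
    proof (intro sets.sets_Collect_countable_Ex sets.sets_Collect_countable_All)
      fix k m n :: nat
      have "{w \<in> space M. Y n w \<in> V k} \<in> sets M" if "n > 0"
        using code[OF that, of "{c. step_path n (\<lambda>i. of_int (c ! i) / real n) \<in> V k}"]
        by (simp add: Y_def)
      then show "{w \<in> space M. n \<ge> m \<and> n > 0 \<longrightarrow> Y n w \<in> V k} \<in> sets M"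
        by (cases "n \<ge> m \<and> n > 0") auto
    qed
    finally show "X -` U \<inter> space M \<in> sets M" .
  qed
qed

lemma restrict_cadlag:
  assumes right: "\<And>t. t \<in> {0..<1} \<Longrightarrow> (x \<longlongrightarrow> x t) (at_right t)"
    and left: "\<And>t. t \<in> {0<..1} \<Longrightarrow> \<exists>l. (x \<longlongrightarrow> l) (at_left t)"
  shows "restrict x {0..1} \<in> cadlag"
  unfolding cadlag_def
proof (intro CollectI conjI ballI)
  fix t :: real assume t: "t \<in> {0..<1}"
  have "eventually (\<lambda>s. x s = restrict x {0..1} s) (at_right t)"
    using t by (auto simp: eventually_at_right_field intro!: exI[of _ 1])
  then show "(restrict x {0..1} \<longlongrightarrow> restrict x {0..1} t) (at_right t)"
    using t right[OF t] tendsto_cong[of x "restrict x {0..1}"] by simp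
next
  fix t :: real assume t: "t \<in> {0<..1}"
  have "eventually (\<lambda>s. x s = restrict x {0..1} s) (at_left t)"
    using t by (auto simp: eventually_at_left_field intro!: exI[of _ 0])
  then show "\<exists>l. (restrict x {0..1} \<longlongrightarrow> l) (at_left t)"
    using left[OF t] tendsto_cong[of x "restrict x {0..1}"] by blast
qed simp

lemma continuous_cadlag:
  assumes "continuous_on {0..1} x"
  shows "restrict x {0..1} \<in> cadlag"
proof (rule restrict_cadlag)
  fix t :: real assume t: "t \<in> {0..<1}"
  then have "(x \<longlongrightarrow> x t) (at t within {0..1})" using assms by (auto simp: continuous_on_def)
  then have "(x \<longlongrightarrow> x t) (at t within {t..1})" using t by (elim tendsto_within_subset) auto
  then show "(x \<longlongrightarrow> x t) (at_right t)" using t by (simp add: at_within_Icc_at_right)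
next
  fix t :: real assume t: "t \<in> {0<..1}"
  then have "(x \<longlongrightarrow> x t) (at t within {0..1})" using assms by (auto simp: continuous_on_def)
  then have "(x \<longlongrightarrow> x t) (at t within {0..t})" using t by (elim tendsto_within_subset) auto
  then have "(x \<longlongrightarrow> x t) (at_left t)" using t by (simp add: at_within_Icc_at_left)
  then show "\<exists>l. (x \<longlongrightarrow> l) (at_left t)" ..
qed

section \<open>Reduction to Lipschitz test functions\<close>

lemma (in Metric_space) Lipschitz_continuous_map:
  fixes f :: "'a \<Rightarrow> real"
  assumes lip: "\<And>x y. x \<in> M \<Longrightarrow> y \<in> M \<Longrightarrow> \<bar>f x - f y\<bar> \<le> L * d x y"
  shows "continuous_map mtopology euclideanreal f"
  unfolding continuous_map
proof (intro conjI allI impI)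
  show "f ` topspace mtopology \<subseteq> topspace euclideanreal" by simp
  fix U :: "real set" assume "openin euclideanreal U"
  then have U: "open U" by simp
  show "openin mtopology {x \<in> topspace mtopology. f x \<in> U}"
    unfolding openin_mtopology
  proof (intro conjI ballI allI impI)
    show "{x \<in> topspace mtopology. f x \<in> U} \<subseteq> M" by auto
    fix x assume "x \<in> {x \<in> topspace mtopology. f x \<in> U}"
    then have x: "x \<in> M" "f x \<in> U" by auto
    obtain e where e: "e > 0" "\<And>z. \<bar>z - f x\<bar> < e \<Longrightarrow> z \<in> U"
      using U x(2) by (auto simp: open_dist dist_real_def)
    \<comment> \<open>The constant \<open>L\<close> may be negative or zero;
      \<open>\<bar>L\<bar> + 1\<close> is a positive replacement.\<close>
    define r where "r = e / (\<bar>L\<bar> + 1)"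
    have r: "r > 0" using e by (simp add: r_def)
    have "mball x r \<subseteq> {x \<in> topspace mtopology. f x \<in> U}"
    proof
      fix y assume y: "y \<in> mball x r"
      then have yM: "y \<in> M" and dy: "d x y < r" by auto
      have "\<bar>f y - f x\<bar> \<le> L * d y x" using lip[OF yM x(1)] .
      also have "\<dots> \<le> (\<bar>L\<bar> + 1) * d x y"
        using nonneg[of x y] by (subst commute, intro mult_right_mono) auto
      also have "\<dots> < (\<bar>L\<bar> + 1) * r" using dy by (intro mult_strict_left_mono) auto
      also have "\<dots> = e" by (simp add: r_def)
      finally show "y \<in> {x \<in> topspace mtopology. f x \<in> U}" using e(2) yM by simp
    qed
    with r show "\<exists>r>0. mball x r \<subseteq> {x \<in> topspace mtopology. f x \<in> U}" by blast
  qed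
qed

text \<open>The Pasch-Hausdorff envelope: \<open>g k\<close> is the largest
  \<open>k\<close>-Lipschitz minorant of \<open>f\<close>. It tends to \<open>f\<close> because a
  point at distance at least \<open>r\<close> from \<open>x\<close> pays a penalty
  \<open>k * r\<close>, which exceeds the possible drop \<open>2 * C\<close> of \<open>f\<close> for
  large \<open>k\<close>, while closer points have values near \<open>f x\<close> by
  continuity.\<close>

lemma (in Metric_space) inf_convolution:
  fixes f :: "'a \<Rightarrow> real"
  assumes ne: "M \<noteq> {}" and C: "\<And>x. x \<in> M \<Longrightarrow> \<bar>f x\<bar> \<le> C"
    and f: "continuous_map mtopology euclideanreal f"
  obtains g :: "nat \<Rightarrow> 'a \<Rightarrow> real" where
    "\<And>k x y. x \<in> M \<Longrightarrow> y \<in> M \<Longrightarrow> \<bar>g k x - g k y\<bar> \<le> real k * d x y"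
    "\<And>k x. x \<in> M \<Longrightarrow> \<bar>g k x\<bar> \<le> C" "\<And>k x. x \<in> M \<Longrightarrow> g k x \<le> f x"
    "\<And>x. x \<in> M \<Longrightarrow> (\<lambda>k. g k x) \<longlonglongrightarrow> f x"
proof -
  define g where "g k x = (INF y\<in>M. f y + real k * d x y)" for k :: nat and x
  have bdd: "bdd_below ((\<lambda>y. f y + real k * d x y) ` M)" for k x
  proof (rule bdd_belowI2[of _ "-C"])
    fix y assume "y \<in> M"
    then have "- C \<le> f y" using C[of y] by (simp add: abs_le_iff)
    moreover have "0 \<le> real k * d x y" by (intro mult_nonneg_nonneg) auto
    ultimately show "- C \<le> f y + real k * d x y" by linarith
  qed
  have le: "g k x \<le> f x" if "x \<in> M" for k x
    using cINF_lower[OF bdd[of k x] that] that by (simp add: g_def)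
  have lower: "c \<le> g k x" if "\<And>y. y \<in> M \<Longrightarrow> c \<le> f y + real k * d x y" for c k x
    unfolding g_def using ne that by (intro cINF_greatest)
  have gC: "\<bar>g k x\<bar> \<le> C" if x: "x \<in> M" for k x
  proof -
    have "- C \<le> g k x"
    proof (rule lower)
      fix y assume "y \<in> M"
      then have "- C \<le> f y" using C[of y] by (simp add: abs_le_iff)
      moreover have "0 \<le> real k * d x y" by (intro mult_nonneg_nonneg) auto
      ultimately show "- C \<le> f y + real k * d x y" by linarith
    qed
    with le[OF x, of k] C[OF x] show ?thesis by linarith
  qed
  have lip1: "g k x - real k * d x y \<le> g k y" if "x \<in> M" "y \<in> M" for k x y
  proof (rule lower)
    fix z assume z: "z \<in> M"
    have "g k x \<le> f z + real k * d x z"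
      unfolding g_def using bdd z by (intro cINF_lower)
    moreover have "real k * d x z \<le> real k * (d x y + d y z)"
      using that z by (intro mult_left_mono triangle) auto
    ultimately show "g k x - real k * d x y \<le> f z + real k * d y z" by (simp add: distrib_left)
  qed
  have lip: "\<bar>g k x - g k y\<bar> \<le> real k * d x y" if "x \<in> M" "y \<in> M" for k x y
    using lip1[OF that, of k] lip1[OF that(2,1), of k] by (simp add: commute abs_le_iff)
  have conv: "(\<lambda>k. g k x) \<longlonglongrightarrow> f x" if x: "x \<in> M" for x
  proof (rule tendstoI)
    fix e :: real assume e: "e > 0"
    have "openin mtopology {z \<in> topspace mtopology. f z \<in> {f x - e / 2<..}}"
      by (rule openin_continuous_map_preimage[OF f]) simp
    then obtain r where r: "r > 0" "mball x r \<subseteq> {z \<in> topspace mtopology. f z \<in> {f x - e / 2<..}}"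
      using x e unfolding openin_mtopology by auto
    have "eventually (\<lambda>k. 2 * C / r \<le> real k) sequentially"
      using filterlim_real_sequentially by (simp add: filterlim_at_top)
    then show "eventually (\<lambda>k. dist (g k x) (f x) < e) sequentially"
    proof eventually_elim
      case (elim k)
      have "f x - e / 2 \<le> g k x"
      proof (rule lower)
        fix y assume y: "y \<in> M"
        show "f x - e / 2 \<le> f y + real k * d x y"
        proof (cases "d x y < r")
          case True
          then have "f x - e / 2 < f y" using r(2) x y by auto
          moreover have "0 \<le> real k * d x y" by (intro mult_nonneg_nonneg) auto
          ultimately show ?thesis by linarith
        next
          case False
          have "2 * C \<le> real k * r" using elim r(1) by (simp add: pos_divide_le_eq)
          also have "\<dots> \<le> real k * d x y" using False by (intro mult_left_mono) auto
          finally show ?thesis using C[OF x] C[OF y] e by linarith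
        qed
      qed
      with le[OF x, of k] e show ?case by (simp add: dist_real_def)
    qed
  qed
  show ?thesis using that[of g] lip gC le conv by blast
qed

text \<open>The approximation by envelopes is only pointwise, so it is passed to the limit under the
  single law of \<open>Y\<close>. For the varying laws of \<open>X i\<close> just the inequality
  \<open>g k \<le> f\<close> is used.\<close>

lemma (in Metric_space) converges_in_distributionI_Lipschitz:
  assumes X: "\<forall>\<^sub>F i in F. prob_space (P i) \<and> X i \<in> measurable (P i) (borel_of mtopology)"
    and N: "prob_space N" and Y: "Y \<in> measurable N (borel_of mtopology)"
    and lip: "\<And>f L C. (\<And>x y. x \<in> M \<Longrightarrow> y \<in> M \<Longrightarrow> \<bar>f x - f y\<bar> \<le> L * d x y) \<Longrightarrow>
        (\<And>x. x \<in> M \<Longrightarrow> \<bar>f x\<bar> \<le> C) \<Longrightarrow> ((\<lambda>i. \<integral>\<omega>. f (X i \<omega>) \<partial>P i) \<longlongrightarrow> (\<integral>\<omega>. f (Y \<omega>) \<partial>N)) F"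
  shows "converges_in_distribution mtopology F P X N Y"
proof -
  interpret N: prob_space N by fact
  have YM: "Y \<omega> \<in> M" if "\<omega> \<in> space N" for \<omega>
    using measurable_space[OF Y that] by (simp add: space_borel_of)
  obtain \<omega>0 where "\<omega>0 \<in> space N" using N.not_empty by blast
  then have ne: "M \<noteq> {}" using YM by blast
  have int: "integrable Q (\<lambda>\<omega>. g (Z \<omega>))"
    if "prob_space Q" "Z \<in> measurable Q (borel_of mtopology)" "g \<in> borel_measurable (borel_of mtopology)"
      "\<And>x. x \<in> M \<Longrightarrow> \<bar>g x\<bar> \<le> C" for Q :: "'q measure" and Z and g :: "'a \<Rightarrow> real" and C
  proof -
    interpret Q: prob_space Q by fact
    have "Z \<omega> \<in> M" if "\<omega> \<in> space Q" for \<omega>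
      using measurable_space[OF \<open>Z \<in> _\<close> that] by (simp add: space_borel_of)
    with that show ?thesis
      by (intro Q.integrable_const_bound[of _ C] AE_I2 measurable_compose[OF that(2,3)]) auto
  qed
  have lower: "\<forall>\<^sub>F i in F. (\<integral>\<omega>. f (Y \<omega>) \<partial>N) - e < (\<integral>\<omega>. f (X i \<omega>) \<partial>P i)"
    if f: "continuous_map mtopology euclideanreal f" and C: "\<And>x. x \<in> M \<Longrightarrow> \<bar>f x\<bar> \<le> C" and e: "e > 0"
    for f C e
  proof -
    obtain g :: "nat \<Rightarrow> 'a \<Rightarrow> real" where
      glip: "\<And>k x y. x \<in> M \<Longrightarrow> y \<in> M \<Longrightarrow> \<bar>g k x - g k y\<bar> \<le> real k * d x y"
      and gC: "\<And>k x. x \<in> M \<Longrightarrow> \<bar>g k x\<bar> \<le> C" and gf: "\<And>k x. x \<in> M \<Longrightarrow> g k x \<le> f x"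
      and conv: "\<And>x. x \<in> M \<Longrightarrow> (\<lambda>k. g k x) \<longlonglongrightarrow> f x"
      using inf_convolution[OF ne C f] by blast
    have gm: "g k \<in> borel_measurable (borel_of mtopology)" for k
      using glip by (intro continuous_map_measurable Lipschitz_continuous_map)
    have fm: "f \<in> borel_measurable (borel_of mtopology)" by (intro continuous_map_measurable f)
    have "(\<lambda>k. \<integral>\<omega>. g k (Y \<omega>) \<partial>N) \<longlonglongrightarrow> (\<integral>\<omega>. f (Y \<omega>) \<partial>N)"
      using YM gC conv
      by (intro integral_dominated_convergence[where w="\<lambda>_. C"] measurable_compose[OF Y] gm fm) auto
    then have "\<forall>\<^sub>F k in sequentially. (\<integral>\<omega>. f (Y \<omega>) \<partial>N) - e / 2 < (\<integral>\<omega>. g k (Y \<omega>) \<partial>N)"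
      by (rule order_tendstoD) (use e in simp)
    then obtain k where k: "(\<integral>\<omega>. f (Y \<omega>) \<partial>N) - e / 2 < (\<integral>\<omega>. g k (Y \<omega>) \<partial>N)"
      by (auto simp: eventually_sequentially)
    have "((\<lambda>i. \<integral>\<omega>. g k (X i \<omega>) \<partial>P i) \<longlongrightarrow> (\<integral>\<omega>. g k (Y \<omega>) \<partial>N)) F"
      using glip gC by (rule lip)
    then have "\<forall>\<^sub>F i in F. (\<integral>\<omega>. g k (Y \<omega>) \<partial>N) - e / 2 < (\<integral>\<omega>. g k (X i \<omega>) \<partial>P i)"
      by (rule order_tendstoD) (use e in simp)
    with X show ?thesis
    proof eventually_elim
      case (elim i)
      then have Xi: "prob_space (P i)" "X i \<in> measurable (P i) (borel_of mtopology)" by auto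
      have "(\<integral>\<omega>. g k (X i \<omega>) \<partial>P i) \<le> (\<integral>\<omega>. f (X i \<omega>) \<partial>P i)"
      proof (rule integral_mono)
        show "integrable (P i) (\<lambda>\<omega>. g k (X i \<omega>))" using gC by (intro int[OF Xi gm])
        show "integrable (P i) (\<lambda>\<omega>. f (X i \<omega>))" using C by (intro int[OF Xi fm])
        show "g k (X i \<omega>) \<le> f (X i \<omega>)" if "\<omega> \<in> space (P i)" for \<omega>
          using measurable_space[OF Xi(2) that] by (intro gf) (simp add: space_borel_of)
      qed
      with elim k show ?case by linarith
    qed
  qed
  show ?thesis
    unfolding converges_in_distribution_def
  proof (intro conjI allI impI X N Y)
    fix f assume "continuous_map mtopology euclideanreal f \<and> bounded (f ` topspace mtopology)"
    then have f: "continuous_map mtopology euclideanreal f" and "bounded (f ` M)" by auto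
    then obtain C where C: "\<And>x. x \<in> M \<Longrightarrow> \<bar>f x\<bar> \<le> C" by (auto simp: bounded_iff)
    show "((\<lambda>i. \<integral>\<omega>. f (X i \<omega>) \<partial>P i) \<longlongrightarrow> (\<integral>\<omega>. f (Y \<omega>) \<partial>N)) F"
    proof (rule tendstoI)
      fix e :: real assume e: "e > 0"
      \<comment> \<open>Envelopes from below give lower bounds only; the upper bound is the lower
        bound for \<open>- f\<close>.\<close>
      have "continuous_map mtopology euclideanreal (\<lambda>x. - f x)"
        using f by (rule continuous_map_minus)
      then have "\<forall>\<^sub>F i in F. (\<integral>\<omega>. - f (Y \<omega>) \<partial>N) - e < (\<integral>\<omega>. - f (X i \<omega>) \<partial>P i)"
        using C e by (intro lower[of _ C]) auto
      moreover have "\<forall>\<^sub>F i in F. (\<integral>\<omega>. f (Y \<omega>) \<partial>N) - e < (\<integral>\<omega>. f (X i \<omega>) \<partial>P i)"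
        using f C e by (rule lower)
      ultimately show "\<forall>\<^sub>F i in F. dist (\<integral>\<omega>. f (X i \<omega>) \<partial>P i) (\<integral>\<omega>. f (Y \<omega>) \<partial>N) < e"
        by eventually_elim (simp add: dist_real_def abs_less_iff)
    qed
  qed
qed

section \<open>Moments and characteristic functions of Dirichlet laws\<close>

lemma sets_dirichlet [measurable_cong]: "sets (dirichlet J \<alpha>) = sets (Pi\<^sub>M J (\<lambda>_. borel))"
  by (simp add: dirichlet_def hyperplane_lebesgue_def)

lemma sets_hyperplane_lebesgue [measurable_cong]:
  "sets (hyperplane_lebesgue J) = sets (Pi\<^sub>M J (\<lambda>_. borel))"
  by (simp add: hyperplane_lebesgue_def)

lemma borel_measurable_dirichlet_density [measurable]:
  assumes "finite J"
  shows "dirichlet_density J \<alpha> \<in> borel_measurable (Pi\<^sub>M J (\<lambda>_. borel))"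
proof -
  have "Measurable.pred (Pi\<^sub>M J (\<lambda>_. borel)) (\<lambda>y. \<forall>i\<in>J. 0 \<le> (y i :: real))"
    using assms by measurable
  then show ?thesis unfolding dirichlet_density_def by measurable
qed

lemma AE_hyperplane_lebesgue:
  assumes J: "finite J" "J \<noteq> {}"
  shows "AE y in hyperplane_lebesgue J. (\<Sum>i\<in>J. y i) = 1"
proof -
  have mx: "Max J \<in> J" using J by simp
  let ?f = "\<lambda>y. y(Max J := 1 - (\<Sum>i\<in>J - {Max J}. y i))"
  have meas: "?f \<in> measurable (Pi\<^sub>M (J - {Max J}) (\<lambda>_. lborel :: real measure)) (Pi\<^sub>M J (\<lambda>_. borel))"
  proof -
    have "?f \<in> measurable (Pi\<^sub>M (J - {Max J}) (\<lambda>_. borel)) (Pi\<^sub>M (insert (Max J) (J - {Max J})) (\<lambda>_. borel :: real measure))"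
      by (rule measurable_fun_upd[where J="J - {Max J}"]) auto
    moreover have "insert (Max J) (J - {Max J}) = J" using mx by auto
    moreover have "measurable (Pi\<^sub>M (J - {Max J}) (\<lambda>_. lborel :: real measure)) (Pi\<^sub>M J (\<lambda>_. borel :: real measure))
        = measurable (Pi\<^sub>M (J - {Max J}) (\<lambda>_. borel)) (Pi\<^sub>M J (\<lambda>_. borel))"
      by (intro measurable_cong_sets sets_PiM_cong) auto
    ultimately show ?thesis by (simp only:)
  qed
  have "(\<Sum>i\<in>J. ?f y i) = 1" for y :: "nat \<Rightarrow> real"
    using J mx by (simp add: sum.remove[of J "Max J"])
  then show ?thesis
    unfolding hyperplane_lebesgue_def using meas J(1) by (subst AE_distr_iff) auto
qed

lemma AE_dirichlet:
  assumes J: "finite J" "J \<noteq> {}"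
  shows "AE y in dirichlet J \<alpha>. (\<forall>i\<in>J. 0 \<le> y i) \<and> (\<Sum>i\<in>J. y i) = 1"
proof -
  have "AE y in hyperplane_lebesgue J. 0 < ennreal (dirichlet_density J \<alpha> y) \<longrightarrow>
     (\<forall>i\<in>J. 0 \<le> y i) \<and> (\<Sum>i\<in>J. y i) = 1"
    using AE_hyperplane_lebesgue[OF J] by eventually_elim (auto simp: dirichlet_density_def)
  then show ?thesis unfolding dirichlet_def using J by (subst AE_density) auto
qed

text \<open>The factor \<open>y j\<close> raises one exponent by one, and
  \<open>Gamma (x + 1) = x * Gamma x\<close>, applied to \<open>\<alpha> j\<close> and to the total
  mass, accounts for the change of the normalizing constant.\<close>

lemma dirichlet_density_size_bias:
  assumes J: "finite J" "j \<in> J" and \<alpha>: "\<And>i. i \<in> J \<Longrightarrow> 0 < \<alpha> i"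
  shows "dirichlet_density J \<alpha> y * y j =
     \<alpha> j / (\<Sum>i\<in>J. \<alpha> i) * dirichlet_density J (\<alpha>(j := \<alpha> j + 1)) y"
proof (cases "\<forall>i\<in>J. 0 \<le> y i")
  case True
  define a where "a = (\<Sum>i\<in>J. \<alpha> i)"
  have a: "a > 0" unfolding a_def using J \<alpha> by (intro sum_pos) auto
  have aj: "\<alpha> j > 0" using J \<alpha> by auto
  let ?\<beta> = "\<alpha>(j := \<alpha> j + 1)"
  have Gamma_Suc: "Gamma (x + 1) = x * Gamma x" if "x > 0" for x :: real
    using that by (intro Gamma_plus1) (auto elim!: nonpos_Ints_cases)
  have sum: "(\<Sum>i\<in>J. ?\<beta> i) = a + 1"
    using J by (simp add: a_def sum.remove[of J j])
  have G: "(\<Prod>i\<in>J. Gamma (?\<beta> i)) = \<alpha> j * (\<Prod>i\<in>J. Gamma (\<alpha> i))"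
    using J aj by (simp add: prod.remove[of J j] Gamma_Suc)
  have "(\<Prod>i\<in>J. y i powr (?\<beta> i - 1)) = (\<Prod>i\<in>J. y i powr (\<alpha> i - 1)) * y j"
  proof -
    \<comment> \<open>At \<open>y j = 0\<close> both sides vanish, since \<open>0 powr x = 0\<close>
      for every \<open>x\<close>.\<close>
    have "y j powr \<alpha> j = y j powr (\<alpha> j - 1) * y j"
      using True J powr_add[of "y j" "\<alpha> j - 1" 1] by (cases "y j = 0") auto
    then show ?thesis using J by (simp add: prod.remove[of J j] mult_ac)
  qed
  moreover have "Gamma (a + 1) = a * Gamma a" using a by (rule Gamma_Suc)
  moreover have "(\<Prod>i\<in>J. Gamma (\<alpha> i)) > 0" using \<alpha> by (intro prod_pos) (auto intro: Gamma_real_pos)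
  ultimately show ?thesis
    unfolding dirichlet_density_def sum G using True a aj by (simp add: a_def[symmetric])
qed (auto simp: dirichlet_density_def)

lemma integral_dirichlet:
  fixes f :: "_ \<Rightarrow> 'b::{banach, second_countable_topology}"
  assumes J: "finite J" and \<alpha>: "\<And>i. i \<in> J \<Longrightarrow> 0 < \<alpha> i"
    and f: "f \<in> borel_measurable (Pi\<^sub>M J (\<lambda>_. borel))"
  shows "(\<integral>y. f y \<partial>dirichlet J \<alpha>) = (\<integral>y. dirichlet_density J \<alpha> y *\<^sub>R f y \<partial>hyperplane_lebesgue J)"
proof -
  have "0 \<le> dirichlet_density J \<alpha> y" for y
  proof (cases "J = {}")
    case True
    then show ?thesis by (simp add: dirichlet_density_def)
  next
    case False
    then have "(\<Sum>i\<in>J. \<alpha> i) > 0" using J \<alpha> by (intro sum_pos) auto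
    then show ?thesis
      unfolding dirichlet_density_def using \<alpha>
      by (auto intro!: mult_nonneg_nonneg divide_nonneg_nonneg prod_nonneg less_imp_le[OF Gamma_real_pos])
  qed
  then show ?thesis unfolding dirichlet_def using J f by (intro integral_density) auto
qed

lemma integral_dirichlet_size_bias:
  fixes h :: "_ \<Rightarrow> real"
  assumes J: "finite J" "j \<in> J" and \<alpha>: "\<And>i. i \<in> J \<Longrightarrow> 0 < \<alpha> i"
    and h: "h \<in> borel_measurable (Pi\<^sub>M J (\<lambda>_. borel))"
  shows "(\<integral>y. y j * h y \<partial>dirichlet J \<alpha>) =
     \<alpha> j / (\<Sum>i\<in>J. \<alpha> i) * (\<integral>y. h y \<partial>dirichlet J (\<alpha>(j := \<alpha> j + 1)))"
proof -
  have m: "(\<lambda>y. y j) \<in> borel_measurable (Pi\<^sub>M J (\<lambda>_. borel))" using J by measurable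
  have "(\<integral>y. y j * h y \<partial>dirichlet J \<alpha>) =
      (\<integral>y. dirichlet_density J \<alpha> y * y j * h y \<partial>hyperplane_lebesgue J)"
    using J \<alpha> h m by (subst integral_dirichlet) (auto simp: mult_ac)
  also have "\<dots> = \<alpha> j / (\<Sum>i\<in>J. \<alpha> i) *
      (\<integral>y. dirichlet_density J (\<alpha>(j := \<alpha> j + 1)) y * h y \<partial>hyperplane_lebesgue J)"
    by (subst dirichlet_density_size_bias[OF J \<alpha>]) (auto simp: mult.assoc)
  also have "(\<integral>y. dirichlet_density J (\<alpha>(j := \<alpha> j + 1)) y * h y \<partial>hyperplane_lebesgue J)
      = (\<integral>y. h y \<partial>dirichlet J (\<alpha>(j := \<alpha> j + 1)))"
  proof -
    have "0 < (\<alpha>(j := \<alpha> j + 1)) i" if "i \<in> J" for i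
      using \<alpha>[OF that] by (cases "i = j") auto
    then show ?thesis using J h by (subst integral_dirichlet) auto
  qed
  finally show ?thesis .
qed

text \<open>The moments of \<open>\<Sum>i\<in>J. c i * y i\<close> under a Dirichlet law, without their common denominators
  \<open>pochhammer (\<Sum>i\<in>J. \<alpha> i) n\<close>.\<close>

primrec dirichlet_moment :: "nat set \<Rightarrow> (nat \<Rightarrow> real) \<Rightarrow> nat \<Rightarrow> (nat \<Rightarrow> real) \<Rightarrow> real" where
  "dirichlet_moment J c 0 \<alpha> = 1"
| "dirichlet_moment J c (Suc n) \<alpha> = (\<Sum>j\<in>J. c j * \<alpha> j * dirichlet_moment J c n (\<alpha>(j := \<alpha> j + 1)))"

section \<open>Power series of the moments\<close>

text \<open>The expansion of \<open>(1 - c * z) powr (- \<alpha>)\<close> at 0. The coefficients are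
  complex because it is evaluated at imaginary \<open>z\<close>.\<close>

definition binomial_fps :: "real \<Rightarrow> real \<Rightarrow> complex fps" where
  "binomial_fps \<alpha> c = Abs_fps (\<lambda>n. of_real (pochhammer \<alpha> n / fact n * c ^ n))"

lemma pochhammer_series:
  fixes z :: complex
  assumes "norm z < 1"
  shows "(\<lambda>n. of_real (pochhammer \<alpha> n / fact n) * z ^ n) sums (1 - z) powr (- of_real \<alpha>)"
proof -
  have "(\<lambda>n. (- of_real \<alpha> gchoose n) * (- z) ^ n) sums (1 + - z) powr (- of_real \<alpha>)"
    using assms by (intro gen_binomial_complex) simp
  moreover have "(- of_real \<alpha> gchoose n) * (- z) ^ n = of_real (pochhammer \<alpha> n / fact n) * z ^ n" for n
  proof -
    have "(- 1) ^ n * (- 1) ^ n = (1 :: complex)" by (simp add: power_mult_distrib[symmetric])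
    then show ?thesis
      by (simp add: gbinomial_pochhammer power_minus[of z] pochhammer_of_real mult_ac)
  qed
  ultimately show ?thesis by simp
qed

lemma binomial_fps_series:
  fixes z :: complex
  assumes "norm z * \<bar>c\<bar> < 1"
  shows "(\<lambda>n. fps_nth (binomial_fps \<alpha> c) n * z ^ n) sums (1 - z * of_real c) powr (- of_real \<alpha>)"
  using pochhammer_series[of "z * of_real c" \<alpha>] assms
  by (simp add: binomial_fps_def norm_mult power_mult_distrib mult_ac)

text \<open>Differentiation shifts \<open>\<alpha>\<close> by one, which is the shift in the
  recursion of \<open>dirichlet_moment\<close>.\<close>

lemma fps_deriv_binomial_fps:
  "fps_deriv (binomial_fps \<alpha> c) = fps_const (of_real (c * \<alpha>)) * binomial_fps (\<alpha> + 1) c"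
  by (rule fps_ext) (simp add: binomial_fps_def pochhammer_rec field_simps del: of_nat_Suc)

lemma fps_deriv_prod:
  assumes "finite J"
  shows "fps_deriv (\<Prod>j\<in>J. f j) = (\<Sum>j\<in>J. fps_deriv (f j) * (\<Prod>i\<in>J - {j}. f i :: 'a::comm_ring_1 fps))"
  using assms
proof (induction J)
  case (insert k J)
  have "(\<Prod>i\<in>insert k J - {j}. f i) = f k * (\<Prod>i\<in>J - {j}. f i)" if "j \<in> J" for j
  proof -
    have "insert k J - {j} = insert k (J - {j})" using insert that by auto
    then show ?thesis using insert by simp
  qed
  then have "(\<Sum>j\<in>J. fps_deriv (f j) * (\<Prod>i\<in>insert k J - {j}. f i)) =
      f k * (\<Sum>j\<in>J. fps_deriv (f j) * (\<Prod>i\<in>J - {j}. f i))"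
    by (simp add: sum_distrib_left mult_ac)
  moreover have "insert k J - {k} = J" using insert by auto
  ultimately show ?case using insert by (simp add: mult_ac add_ac)
qed simp

text \<open>By the product rule the derivative of the product obeys the recursion of
  \<open>dirichlet_moment\<close>. The induction is over all parameter vectors because each step
  changes one parameter. No integral is involved, so positivity of the parameters is no issue
  here.\<close>

lemma fps_nth_prod_binomial_fps:
  assumes J: "finite J"
  shows "fps_nth (\<Prod>j\<in>J. binomial_fps (\<alpha> j) (c j)) n = of_real (dirichlet_moment J c n \<alpha> / fact n)"
proof (induction n arbitrary: \<alpha>)
  case 0
  have "fps_nth (\<Prod>j\<in>J. f j) 0 = (\<Prod>j\<in>J. fps_nth (f j) 0)" for f :: "nat \<Rightarrow> complex fps"
    using J by (induction J) auto
  then show ?case by (simp add: binomial_fps_def)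
next
  case (Suc n)
  let ?A = "\<lambda>\<alpha>. \<Prod>j\<in>J. binomial_fps (\<alpha> j) (c j)"
  have "fps_deriv (?A \<alpha>) = (\<Sum>j\<in>J. fps_const (of_real (c j * \<alpha> j)) * ?A (\<alpha>(j := \<alpha> j + 1)))"
  proof -
    have "?A (\<alpha>(j := \<alpha> j + 1)) = binomial_fps (\<alpha> j + 1) (c j) * (\<Prod>i\<in>J - {j}. binomial_fps (\<alpha> i) (c i))"
      if "j \<in> J" for j
      using J that by (simp add: prod.remove[of J j])
    then show ?thesis
      using J by (simp add: fps_deriv_prod fps_deriv_binomial_fps mult.assoc)
  qed
  then have "fps_nth (fps_deriv (?A \<alpha>)) n =
      (\<Sum>j\<in>J. of_real (c j * \<alpha> j) * fps_nth (?A (\<alpha>(j := \<alpha> j + 1))) n)"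
    by (simp add: fps_sum_nth)
  also have "\<dots> = (\<Sum>j\<in>J. of_real (c j * \<alpha> j) *
      of_real (dirichlet_moment J c n (\<alpha>(j := \<alpha> j + 1)) / fact n))"
    by (simp only: Suc.IH)
  also have "\<dots> = of_real (dirichlet_moment J c (Suc n) \<alpha> / fact n)"
    by (simp add: sum_divide_distrib)
  finally have "of_nat (Suc n) * fps_nth (?A \<alpha>) (Suc n) = of_real (dirichlet_moment J c (Suc n) \<alpha> / fact n)"
    by (simp del: dirichlet_moment.simps)
  then have "fps_nth (?A \<alpha>) (Suc n) = of_real (dirichlet_moment J c (Suc n) \<alpha> / fact n) / of_nat (Suc n)"
    by (simp add: field_simps del: dirichlet_moment.simps of_nat_Suc)
  then show ?case by (simp add: field_simps del: dirichlet_moment.simps)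
qed

lemma dirichlet_moment_series:
  fixes s :: complex
  assumes J: "finite J" and c: "\<And>j. j \<in> J \<Longrightarrow> \<bar>c j\<bar> \<le> K" and s: "norm s * K < 1"
  shows "(\<lambda>n. of_real (dirichlet_moment J c n \<alpha> / fact n) * s ^ n) sums
     (\<Prod>j\<in>J. (1 - s * of_real (c j)) powr (- of_real (\<alpha> j)))"
proof -
  \<comment> \<open>Products of series are evaluated strictly inside the discs of convergence;
    \<open>t\<close> is a common radius with room beyond \<open>norm s\<close>.\<close>
  have "\<exists>t>norm s. t * K < 1"
  proof (cases "K \<le> 0")
    case True
    then have "(norm s + 1) * K < 1" using mult_nonneg_nonpos[of "norm s + 1" K] by simp
    then show ?thesis by (intro exI[of _ "norm s + 1"]) simp
  next
    case False
    then have "norm s < 1 / K" using s by (simp add: field_simps)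
    then obtain t where "norm s < t" "t < 1 / K" using dense by blast
    then show ?thesis using False by (intro exI[of _ t]) (simp add: field_simps)
  qed
  then obtain t where t: "norm s < t" "t * K < 1" by blast
  have t0: "t \<ge> 0" using t norm_ge_zero[of s] by linarith
  have rad1: "ereal t \<le> fps_conv_radius (binomial_fps (\<alpha> j) (c j))" if "j \<in> J" for j
  proof -
    have "t * \<bar>c j\<bar> \<le> t * K" using c[OF that] t0 by (intro mult_left_mono)
    with t t0 have "norm (complex_of_real t) * \<bar>c j\<bar> < 1" by simp
    from binomial_fps_series[OF this] have "summable (\<lambda>n. fps_nth (binomial_fps (\<alpha> j) (c j)) n * of_real t ^ n)"
      by (rule sums_summable)
    from conv_radius_geI[OF this] t0 show ?thesis by (simp add: fps_conv_radius_def)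
  qed
  have "ereal t \<le> fps_conv_radius (\<Prod>j\<in>I. binomial_fps (\<alpha> j) (c j)) \<and>
     eval_fps (\<Prod>j\<in>I. binomial_fps (\<alpha> j) (c j)) s = (\<Prod>j\<in>I. (1 - s * of_real (c j)) powr (- of_real (\<alpha> j)))"
    if "I \<subseteq> J" for I
    using finite_subset[OF that J] that
  proof (induction I)
    case (insert j I)
    let ?B = "binomial_fps (\<alpha> j) (c j)" and ?A = "\<Prod>j\<in>I. binomial_fps (\<alpha> j) (c j)"
    have r: "ereal t \<le> fps_conv_radius ?B" "ereal t \<le> fps_conv_radius ?A"
      using rad1 insert by auto
    have s: "ereal (norm s) < ereal t" using t by simp
    have "ereal t \<le> fps_conv_radius (?B * ?A)"
      using r by (intro order_trans[OF _ fps_conv_radius_mult]) auto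
    moreover have "eval_fps (?B * ?A) s = eval_fps ?B s * eval_fps ?A s"
      by (rule eval_fps_mult[OF less_le_trans[OF s r(1)] less_le_trans[OF s r(2)]])
    moreover have "eval_fps ?B s = (1 - s * of_real (c j)) powr (- of_real (\<alpha> j))"
    proof -
      have "norm s * \<bar>c j\<bar> \<le> t * K" using c[of j] insert t t0 by (intro mult_mono) auto
      with t have "norm s * \<bar>c j\<bar> < 1" by simp
      from sums_unique[OF binomial_fps_series[OF this]] show ?thesis by (simp add: eval_fps_def)
    qed
    ultimately show ?case using insert by simp
  qed simp
  from this[of J] have r: "ereal t \<le> fps_conv_radius (\<Prod>j\<in>J. binomial_fps (\<alpha> j) (c j))"
    and e: "eval_fps (\<Prod>j\<in>J. binomial_fps (\<alpha> j) (c j)) s = (\<Prod>j\<in>J. (1 - s * of_real (c j)) powr (- of_real (\<alpha> j)))"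
    by auto
  have "ereal (norm s) < ereal t" using t by simp
  from sums_eval_fps[OF less_le_trans[OF this r]] show ?thesis
    by (simp add: e fps_nth_prod_binomial_fps[OF J])
qed

text \<open>The polar form, from
  \<open>Ln (1 - \<i> * x) = ln (1 + x\<^sup>2) / 2 - \<i> * arctan x\<close>. It separates the
  damping from the phase and makes measurability evident.\<close>

lemma one_minus_ii_powr:
  "(1 - \<i> * of_real x) powr (- of_real b) = exp (of_real (- (b / 2 * ln (1 + x\<^sup>2))) + \<i> * of_real (b * arctan x))"
proof -
  define w where "w = Complex (ln (1 + x\<^sup>2) / 2) (- arctan x)"
  have pos: "1 + x\<^sup>2 > 0" by (simp add: add_pos_nonneg)
  have "exp (ln (1 + x\<^sup>2) / 2) = sqrt (1 + x\<^sup>2)"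
    using pos by (simp add: ln_sqrt[symmetric])
  then have "exp w = 1 - \<i> * of_real x"
    using pos by (simp add: complex_eq_iff w_def Re_exp Im_exp cos_arctan sin_arctan)
  \<comment> \<open>The bounds on \<open>arctan\<close> keep the imaginary part inside the strip of
    the principal branch.\<close>
  moreover have "Ln (exp w) = w"
    using arctan_bounded[of x] by (intro Ln_exp) (auto simp: w_def)
  ultimately have "(1 - \<i> * of_real x) powr (- of_real b) = exp (- of_real b * w)"
    by (metis exp_not_eq_zero powr_def)
  also have "- of_real b * w = of_real (- (b / 2 * ln (1 + x\<^sup>2))) + \<i> * of_real (b * arctan x)"
    by (simp add: complex_eq_iff w_def)
  finally show ?thesis .
qed

section \<open>Moments and the Markov-Krein identity\<close>

text \<open>The normalization is assumed for all positive parameters at once, because size biasing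
  changes them. It is supplied later by \<open>dirichlet_family_lessThan\<close>.\<close>

locale dirichlet_family =
  fixes J :: "nat set"
  assumes finite: "finite J" and nonempty: "J \<noteq> {}"
    and prob: "(\<And>i. i \<in> J \<Longrightarrow> 0 < \<alpha> i) \<Longrightarrow> prob_space (dirichlet J \<alpha>)"
begin

lemma AE_bounded:
  assumes "\<And>j. j \<in> J \<Longrightarrow> \<bar>c j\<bar> \<le> K"
  shows "AE y in dirichlet J \<alpha>. \<bar>\<Sum>i\<in>J. c i * y i\<bar> \<le> K"
  using AE_dirichlet[OF finite nonempty]
proof eventually_elim
  case (elim y)
  have "\<bar>\<Sum>i\<in>J. c i * y i\<bar> \<le> (\<Sum>i\<in>J. K * y i)"
    using elim assms by (intro order_trans[OF sum_abs] sum_mono) (auto simp: abs_mult intro!: mult_right_mono)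
  also have "\<dots> = K" using elim by (simp add: sum_distrib_left[symmetric])
  finally show ?case .
qed

lemma measurable_linear [measurable]:
  "(\<lambda>y. \<Sum>i\<in>J. c i * y i :: real) \<in> borel_measurable (Pi\<^sub>M J (\<lambda>_. borel))"
  by measurable

lemma measurable_linear_powr [measurable]:
  "(\<lambda>y. (1 - \<i> * of_real (r * (\<Sum>i\<in>J. c i * y i :: real))) powr (- of_real b)) \<in> borel_measurable (Pi\<^sub>M J (\<lambda>_. borel))"
  unfolding one_minus_ii_powr by measurable

lemma integrable_power:
  assumes \<alpha>: "\<And>i. i \<in> J \<Longrightarrow> 0 < \<alpha> i"
  shows "integrable (dirichlet J \<alpha>) (\<lambda>y. (\<Sum>i\<in>J. c i * y i) ^ n)"
proof -
  interpret prob_space "dirichlet J \<alpha>" using \<alpha> by (rule prob)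
  define K where "K = (\<Sum>j\<in>J. \<bar>c j\<bar>)"
  have "\<bar>c j\<bar> \<le> K" if "j \<in> J" for j
    unfolding K_def using that finite by (intro member_le_sum) auto
  then have "AE y in dirichlet J \<alpha>. \<bar>\<Sum>i\<in>J. c i * y i\<bar> \<le> K" by (rule AE_bounded)
  then have "AE y in dirichlet J \<alpha>. norm ((\<Sum>i\<in>J. c i * y i) ^ n) \<le> K ^ n"
    by eventually_elim (auto simp: power_abs intro!: power_mono)
  then show ?thesis by (rule integrable_const_bound) measurable
qed

text \<open>One factor of the power is written as \<open>\<Sum>j. c j * y j\<close> and removed by
  size biasing. The total mass then grows by one, in step with
  \<open>pochhammer a (Suc n) = a * pochhammer (a + 1) n\<close>.\<close>

lemma moment:
  assumes \<alpha>: "\<And>i. i \<in> J \<Longrightarrow> 0 < \<alpha> i"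
  shows "pochhammer (\<Sum>i\<in>J. \<alpha> i) n * (\<integral>y. (\<Sum>i\<in>J. c i * y i) ^ n \<partial>dirichlet J \<alpha>) = dirichlet_moment J c n \<alpha>"
  using \<alpha>
proof (induction n arbitrary: \<alpha>)
  case 0
  interpret prob_space "dirichlet J \<alpha>" using 0 by (rule prob)
  show ?case using prob_space by simp
next
  case (Suc n)
  let ?S = "\<lambda>y. \<Sum>i\<in>J. c i * y i" and ?a = "\<Sum>i\<in>J. \<alpha> i" and ?\<beta> = "\<lambda>j. \<alpha>(j := \<alpha> j + 1)"
  interpret prob_space "dirichlet J \<alpha>" using Suc.prems by (rule prob)
  have a: "?a > 0" using Suc.prems finite nonempty by (intro sum_pos) auto
  have \<beta>: "0 < ?\<beta> j i" if "i \<in> J" for i j using Suc.prems[OF that] by (cases "i = j") auto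
  have sum\<beta>: "(\<Sum>i\<in>J. ?\<beta> j i) = ?a + 1" if "j \<in> J" for j
    using finite that by (simp add: sum.remove[of J j])
  have int: "integrable (dirichlet J \<alpha>) (\<lambda>y. c j * (y j * ?S y ^ n))" if j: "j \<in> J" for j
  proof -
    have "AE y in dirichlet J \<alpha>. norm (y j * ?S y ^ n) \<le> norm (?S y ^ n)"
      using AE_dirichlet[OF finite nonempty, of \<alpha>]
    proof eventually_elim
      case (elim y)
      then have "y j \<le> (\<Sum>i\<in>J. y i)" using j finite by (intro member_le_sum) auto
      with elim j show ?case by (auto simp: abs_mult intro!: mult_left_le_one_le)
    qed
    then have "integrable (dirichlet J \<alpha>) (\<lambda>y. y j * ?S y ^ n)"
      using j by (intro Bochner_Integration.integrable_bound[OF integrable_power[of \<alpha> c n, OF Suc.prems]])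
        measurable
    then show ?thesis by simp
  qed
  have "(\<integral>y. ?S y ^ Suc n \<partial>dirichlet J \<alpha>) = (\<integral>y. (\<Sum>j\<in>J. c j * (y j * ?S y ^ n)) \<partial>dirichlet J \<alpha>)"
    by (simp add: sum_distrib_right mult.assoc)
  also have "\<dots> = (\<Sum>j\<in>J. c j * (\<integral>y. y j * ?S y ^ n \<partial>dirichlet J \<alpha>))"
    using int by (subst Bochner_Integration.integral_sum) auto
  also have "\<dots> = (\<Sum>j\<in>J. c j * (\<alpha> j / ?a * (\<integral>y. ?S y ^ n \<partial>dirichlet J (?\<beta> j))))"
    using finite Suc.prems
    by (intro sum.cong refl arg_cong2[where f="(*)"] integral_dirichlet_size_bias) measurable
  finally have "?a * (\<integral>y. ?S y ^ Suc n \<partial>dirichlet J \<alpha>) =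
      ?a * (\<Sum>j\<in>J. c j * (\<alpha> j / ?a * (\<integral>y. ?S y ^ n \<partial>dirichlet J (?\<beta> j))))" by simp
  also have "\<dots> = (\<Sum>j\<in>J. c j * \<alpha> j * (\<integral>y. ?S y ^ n \<partial>dirichlet J (?\<beta> j)))"
    using a by (simp add: sum_distrib_left mult.assoc)
  finally have eq: "?a * (\<integral>y. ?S y ^ Suc n \<partial>dirichlet J \<alpha>) =
      (\<Sum>j\<in>J. c j * \<alpha> j * (\<integral>y. ?S y ^ n \<partial>dirichlet J (?\<beta> j)))" .
  have "pochhammer ?a (Suc n) * (\<integral>y. ?S y ^ Suc n \<partial>dirichlet J \<alpha>) =
      pochhammer (?a + 1) n * (?a * (\<integral>y. ?S y ^ Suc n \<partial>dirichlet J \<alpha>))"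
    by (simp only: pochhammer_rec mult.assoc mult.left_commute)
  also have "\<dots> =
      pochhammer (?a + 1) n * (\<Sum>j\<in>J. c j * \<alpha> j * (\<integral>y. ?S y ^ n \<partial>dirichlet J (?\<beta> j)))"
    by (simp only: eq)
  also have "\<dots> = (\<Sum>j\<in>J. c j * \<alpha> j * (pochhammer (\<Sum>i\<in>J. ?\<beta> j i) n * (\<integral>y. ?S y ^ n \<partial>dirichlet J (?\<beta> j))))"
    unfolding sum_distrib_left by (intro sum.cong refl) (simp only: sum\<beta> mult_ac)
  also have "\<dots> = dirichlet_moment J c (Suc n) \<alpha>"
    by (simp only: Suc.IH[OF \<beta>] dirichlet_moment.simps)
  finally show ?case .
qed

text \<open>Expand both sides into power series in \<open>r\<close> and compare the moments.\<close>

lemma integral_linear_powr: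
  assumes \<alpha>: "\<And>i. i \<in> J \<Longrightarrow> 0 < \<alpha> i" and c: "\<And>j. j \<in> J \<Longrightarrow> \<bar>c j\<bar> \<le> K" and r: "\<bar>r\<bar> * K < 1"
  shows "(\<integral>y. (1 - \<i> * of_real (r * (\<Sum>i\<in>J. c i * y i))) powr (- of_real (\<Sum>i\<in>J. \<alpha> i)) \<partial>dirichlet J \<alpha>) =
    (\<Prod>j\<in>J. (1 - \<i> * of_real (r * c j)) powr (- of_real (\<alpha> j)))"
proof -
  let ?D = "dirichlet J \<alpha>" and ?S = "\<lambda>y. \<Sum>i\<in>J. c i * y i" and ?a = "\<Sum>i\<in>J. \<alpha> i"
  define s where "s = \<i> * complex_of_real r"
  have s: "norm s * K < 1" using r by (simp add: s_def norm_mult)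
  have sr: "\<i> * of_real (r * x) = s * of_real x" for x by (simp add: s_def)
  interpret prob_space ?D using \<alpha> by (rule prob)
  have a: "?a > 0" using \<alpha> finite nonempty by (intro sum_pos) auto
  have AE_K: "AE y in ?D. \<bar>?S y\<bar> \<le> K" using c by (rule AE_bounded)
  have K: "K \<ge> 0" using nonempty c by (meson abs_ge_zero all_not_in_conv order_trans)
  define f where "f n y = of_real (pochhammer ?a n / fact n) * (s * of_real (?S y)) ^ n" for n y
  have bound: "norm (f n y) \<le> pochhammer ?a n / fact n * (norm s * K) ^ n" if "\<bar>?S y\<bar> \<le> K" for n y
  proof -
    have "norm (f n y) = pochhammer ?a n / fact n * (norm s * \<bar>?S y\<bar>) ^ n"
      using a by (simp add: f_def norm_mult norm_power norm_divide pochhammer_nonneg del: of_real_sum of_real_mult)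
    also have "\<dots> \<le> pochhammer ?a n / fact n * (norm s * K) ^ n"
      using that a by (intro mult_left_mono power_mono) (auto intro: divide_nonneg_pos pochhammer_nonneg)
    finally show ?thesis .
  qed
  \<comment> \<open>The majorant is the expansion of \<open>(1 - norm s * K) powr (- a)\<close>,
    with \<open>a\<close> the total mass. It does not depend on \<open>y\<close> and justifies the
    exchange of sum and integral.\<close>
  have summ: "summable (\<lambda>n. pochhammer ?a n / fact n * (norm s * K) ^ n)"
  proof -
    have "norm (complex_of_real (norm s * K)) < 1" unfolding norm_of_real using s K by simp
    from sums_summable[OF pochhammer_series[OF this, of ?a]]
    have "summable (\<lambda>n. complex_of_real (pochhammer ?a n / fact n * (norm s * K) ^ n))" by simp
    then show ?thesis by (simp only: summable_of_real_iff)
  qed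
  have fm: "f n \<in> borel_measurable ?D" for n unfolding f_def by measurable
  have int: "integrable ?D (f n)" for n
    by (rule integrable_const_bound[where B="pochhammer ?a n / fact n * (norm s * K) ^ n", OF _ fm])
       (use AE_K bound in auto)
  have "(\<lambda>n. integral\<^sup>L ?D (f n)) sums (\<integral>y. (\<Sum>n. f n y) \<partial>?D)"
  proof (rule sums_integral[OF int])
    show "AE y in ?D. summable (\<lambda>n. norm (f n y))"
      using AE_K
    proof eventually_elim
      case (elim y)
      then show ?case
        using bound by (intro summable_comparison_test[OF _ summ] exI[of _ 0]) simp
    qed
    show "summable (\<lambda>n. \<integral>y. norm (f n y) \<partial>?D)"
    proof (rule summable_comparison_test[OF _ summ], intro exI[of _ 0] allI impI)
      fix n
      have "(\<integral>y. norm (f n y) \<partial>?D) \<le> (\<integral>y. pochhammer ?a n / fact n * (norm s * K) ^ n \<partial>?D)"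
      proof (rule integral_mono_AE)
        show "AE y in ?D. norm (f n y) \<le> pochhammer ?a n / fact n * (norm s * K) ^ n"
          using AE_K by eventually_elim (rule bound)
      qed (use int in auto)
      then show "norm (\<integral>y. norm (f n y) \<partial>?D) \<le> pochhammer ?a n / fact n * (norm s * K) ^ n"
        using prob_space by simp
    qed
  qed
  moreover have "integral\<^sup>L ?D (f n) = of_real (dirichlet_moment J c n \<alpha> / fact n) * s ^ n" for n
  proof -
    have "integral\<^sup>L ?D (f n) = of_real (pochhammer ?a n / fact n) * s ^ n * of_real (\<integral>y. ?S y ^ n \<partial>?D)"
      unfolding f_def power_mult_distrib of_real_power[symmetric]
      by (simp add: integral_complex_of_real mult.assoc[symmetric] del: of_real_power of_real_sum)
    also have "\<dots> = of_real (pochhammer ?a n * (\<integral>y. ?S y ^ n \<partial>?D) / fact n) * s ^ n" by simp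
    finally show ?thesis by (simp only: moment[OF \<alpha>])
  qed
  ultimately have "(\<lambda>n. of_real (dirichlet_moment J c n \<alpha> / fact n) * s ^ n) sums (\<integral>y. (\<Sum>n. f n y) \<partial>?D)"
    by simp
  then have "(\<integral>y. (\<Sum>n. f n y) \<partial>?D) = (\<Prod>j\<in>J. (1 - s * of_real (c j)) powr (- of_real (\<alpha> j)))"
    using dirichlet_moment_series[OF finite c s] by (rule sums_unique2)
  moreover have "(\<integral>y. (\<Sum>n. f n y) \<partial>?D) = (\<integral>y. (1 - s * of_real (?S y)) powr (- of_real ?a) \<partial>?D)"
  proof (rule integral_cong_AE)
    show "(\<lambda>y. \<Sum>n. f n y) \<in> borel_measurable ?D" using fm by measurable
    show "(\<lambda>y. (1 - s * of_real (?S y)) powr (- of_real ?a)) \<in> borel_measurable ?D"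
      unfolding sr[symmetric] by measurable
    show "AE y in ?D. (\<Sum>n. f n y) = (1 - s * of_real (?S y)) powr (- of_real ?a)"
      using AE_K
    proof eventually_elim
      case (elim y)
      have "norm s * \<bar>?S y\<bar> \<le> norm s * K" using elim by (intro mult_left_mono) auto
      with s have "norm (s * of_real (?S y)) < 1" by (simp add: norm_mult del: of_real_sum)
      from sums_unique[OF pochhammer_series[OF this, of ?a]] show ?case by (simp add: f_def)
    qed
  qed
  ultimately show ?thesis unfolding sr by simp
qed

end

section \<open>Low moments and the Gaussian limit\<close>

text \<open>Centring makes the inner first moment equal to the contribution \<open>c j\<close> of
  the one parameter that was raised.\<close>

lemma dirichlet_moment_2:
  assumes J: "finite J" and c: "(\<Sum>j\<in>J. c j * \<alpha> j) = 0"
  shows "dirichlet_moment J c 2 \<alpha> = (\<Sum>j\<in>J. (c j)\<^sup>2 * \<alpha> j)"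
proof -
  have "(\<Sum>i\<in>J. c i * (\<alpha>(j := \<alpha> j + 1)) i) = c j" if "j \<in> J" for j
    using c J that by (simp add: sum.remove[of J j] algebra_simps)
  then show ?thesis by (simp add: numeral_2_eq_2 power2_eq_square mult_ac del: fun_upd_apply)
qed

text \<open>Two cells describe an increment, and \<open>c\<close> is the indicator of the first cell
  minus its mean \<open>h\<close>. The logarithm of the generating product has second cumulant
  \<open>\<Sum>j. (c j)\<^sup>2 * \<alpha> j\<close> and fourth cumulant
  \<open>6 * (\<Sum>j. c j ^ 4 * \<alpha> j)\<close>, so the value is three times the square of the
  former plus the latter.\<close>

lemma dirichlet_moment_4:
  assumes "\<alpha> = (\<lambda>i. if i = 0 then a * h else a * (1 - h))" "c = (\<lambda>i. if i = 0 then 1 - h else - h)"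
  shows "dirichlet_moment {..<2} c 4 \<alpha> = 3 * (a * h * (1 - h))\<^sup>2 + 6 * (a * h * (1 - h) * ((1 - h) ^ 3 + h ^ 3))"
  unfolding assms by (simp add: numeral_eq_Suc lessThan_Suc) (simp add: algebra_simps power_numeral_reduce)

text \<open>The triangle inequality through \<open>exp (\<i> * v)\<close>: removing the damping
  costs \<open>1 - exp (- u)\<close>, changing the phase costs at most the arc length.\<close>

lemma norm_exp_damped:
  assumes "u \<ge> 0"
  shows "norm (exp (of_real (- u) + \<i> * of_real v) - exp (\<i> * of_real w)) \<le> u + \<bar>v - w\<bar>"
proof -
  have "norm (exp (of_real (- u) + \<i> * of_real v) - exp (\<i> * of_real v)) = 1 - exp (- u)"
  proof -
    have "exp (of_real (- u) + \<i> * of_real v) - exp (\<i> * of_real v) = of_real (exp (- u) - 1) * exp (\<i> * of_real v)"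
      unfolding exp_add of_real_diff exp_of_real[symmetric] by (simp add: algebra_simps)
    then show ?thesis using assms by (simp add: norm_mult del: of_real_diff of_real_exp)
  qed
  moreover have "1 - exp (- u) \<le> u" using exp_ge_add_one_self[of "- u"] by simp
  moreover have "norm (exp (\<i> * of_real v) - exp (\<i> * of_real w)) \<le> \<bar>v - w\<bar>"
  proof -
    have "exp (\<i> * of_real v) - exp (\<i> * of_real w) = exp (\<i> * of_real w) * (exp (\<i> * of_real (v - w)) - 1)"
      by (simp add: right_diff_distrib exp_add[symmetric] del: exp_add)
    then show ?thesis
      using iexp_approx1[of "v - w" 0] by (simp add: norm_mult del: of_real_diff)
  qed
  ultimately show ?thesis
    using norm_triangle_ineq[of "exp (of_real (- u) + \<i> * of_real v) - exp (\<i> * of_real v)"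
        "exp (\<i> * of_real v) - exp (\<i> * of_real w)"] by simp
qed

text \<open>The difference is of third order at 0. The quadratic bound is valid everywhere and has
  the same form as \<open>ln (1 + x\<^sup>2) \<le> x\<^sup>2\<close>, with which it is
  combined.\<close>

lemma abs_arctan_diff_le: "\<bar>arctan x - x\<bar> \<le> x\<^sup>2 / 2"
proof -
  have pos: "\<bar>arctan x - x\<bar> \<le> x\<^sup>2 / 2" if "x \<ge> 0" for x :: real
  proof -
    have "0 - arctan 0 \<le> x - arctan x"
    proof (rule DERIV_nonneg_imp_nondecreasing[OF that])
      fix t :: real
      have "((\<lambda>t. t - arctan t) has_real_derivative 1 - inverse (1 + t\<^sup>2)) (at t)"
        by (auto intro!: derivative_eq_intros)
      moreover have "0 \<le> 1 - inverse (1 + t\<^sup>2)" by (simp add: inverse_le_1_iff)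
      ultimately show "\<exists>y. ((\<lambda>t. t - arctan t) has_real_derivative y) (at t) \<and> 0 \<le> y" by blast
    qed
    moreover have "0\<^sup>2 / 2 - 0 + arctan 0 \<le> x\<^sup>2 / 2 - x + arctan x"
    proof (rule DERIV_nonneg_imp_nondecreasing[OF that])
      fix t :: real assume t: "0 \<le> t"
      have "((\<lambda>t. t\<^sup>2 / 2 - t + arctan t) has_real_derivative t - 1 + inverse (1 + t\<^sup>2)) (at t)"
        by (auto intro!: derivative_eq_intros)
      moreover have "0 \<le> t - 1 + inverse (1 + t\<^sup>2)"
      proof -
        have p: "1 + t\<^sup>2 > 0" by (simp add: add_pos_nonneg)
        have "t - 1 + inverse (1 + t\<^sup>2) = t * (1 - t + t\<^sup>2) / (1 + t\<^sup>2)"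
          using p by (simp add: field_simps power2_eq_square)
        moreover have "1 - t + t\<^sup>2 = (t - 1 / 2)\<^sup>2 + 3 / 4" by (simp add: power2_eq_square algebra_simps)
        then have "0 \<le> 1 - t + t\<^sup>2" by simp
        ultimately show ?thesis using t p by simp
      qed
      ultimately show "\<exists>y. ((\<lambda>t. t\<^sup>2 / 2 - t + arctan t) has_real_derivative y) (at t) \<and> 0 \<le> y" by blast
    qed
    ultimately show ?thesis by (simp add: abs_le_iff)
  qed
  show ?thesis
    using pos[of x] pos[of "- x"] by (cases "x \<ge> 0") (auto simp: arctan_minus abs_minus_commute)
qed

text \<open>Modulus and phase each contribute at most \<open>v\<^sup>2 / (2 * a)\<close>.\<close>

lemma one_minus_ii_powr_approx:
  assumes a: "a > 0"
  shows "norm ((1 - \<i> * of_real (v / a)) powr (- of_real a) - exp (\<i> * of_real v)) \<le> v\<^sup>2 / a"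
proof -
  let ?x = "v / a"
  have "0 \<le> a / 2 * ln (1 + ?x\<^sup>2)" using a by simp
  note norm_exp_damped[OF this, of "a * arctan ?x" v]
  also have "a / 2 * ln (1 + ?x\<^sup>2) + \<bar>a * arctan ?x - v\<bar> \<le> a / 2 * ?x\<^sup>2 + a * (?x\<^sup>2 / 2)"
  proof (rule add_mono)
    show "a / 2 * ln (1 + ?x\<^sup>2) \<le> a / 2 * ?x\<^sup>2"
      using a by (intro mult_left_mono ln_add_one_self_le_self) auto
    have "a * arctan ?x - v = a * (arctan ?x - ?x)"
      using a by (simp add: right_diff_distrib)
    then have "\<bar>a * arctan ?x - v\<bar> = a * \<bar>arctan ?x - ?x\<bar>"
      using a by (simp only: abs_mult abs_of_pos)
    also have "\<dots> \<le> a * (?x\<^sup>2 / 2)" using a by (intro mult_left_mono abs_arctan_diff_le) auto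
    finally show "\<bar>a * arctan ?x - v\<bar> \<le> a * (?x\<^sup>2 / 2)" .
  qed
  also have "\<dots> = v\<^sup>2 / a" using a by (simp add: power2_eq_square)
  finally show ?thesis by (simp only: one_minus_ii_powr)
qed

lemma ln_limit: "((\<lambda>a. a / 2 * ln (1 + (c / sqrt a)\<^sup>2)) \<longlongrightarrow> c\<^sup>2 / 2) at_top"
proof (cases c "0::real" rule: linorder_cases)
  case equal then show ?thesis by simp
next
  case less
  then have "((\<lambda>a. a / 2 * ln (1 + (- (- c) / sqrt a)\<^sup>2)) \<longlongrightarrow> (- c)\<^sup>2 / 2) at_top"
    unfolding power2_eq_square by real_asymp
  then show ?thesis by simp
next
  case greater
  then show ?thesis unfolding power2_eq_square by real_asymp
qed

lemma arctan_limit: "((\<lambda>a. a * arctan (c / sqrt a) - sqrt a * c) \<longlongrightarrow> 0) at_top"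
proof (cases c "0::real" rule: linorder_cases)
  case equal then show ?thesis by simp
next
  case less
  then show ?thesis by real_asymp
next
  case greater
  then show ?thesis by real_asymp
qed

context dirichlet_family
begin

text \<open>Three quantities are compared: the characteristic function \<open>\<Psi>\<close>, its
  counterpart \<open>\<Phi>\<close> with a power in place of the exponential, and the closed form
  \<open>e\<close> that the Markov-Krein identity gives for \<open>\<Phi>\<close>.\<close>

lemma char_limit:
  assumes p: "\<And>j. j \<in> J \<Longrightarrow> 0 < p j" and sum: "(\<Sum>j\<in>J. p j) = 1" and mean: "(\<Sum>j\<in>J. c j * p j) = 0"
  shows "((\<lambda>a. \<integral>y. exp (\<i> * of_real (sqrt a * (\<Sum>j\<in>J. c j * y j))) \<partial>dirichlet J (\<lambda>j. a * p j))
     \<longlongrightarrow> exp (of_real (- (\<Sum>j\<in>J. (c j)\<^sup>2 * p j) / 2))) at_top"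
proof -
  define v where "v = (\<Sum>j\<in>J. (c j)\<^sup>2 * p j)"
  define K where "K = (\<Sum>j\<in>J. \<bar>c j\<bar>)"
  have cK: "\<bar>c j\<bar> \<le> K" if "j \<in> J" for j
    unfolding K_def using that finite by (intro member_le_sum) auto
  let ?D = "\<lambda>a. dirichlet J (\<lambda>j. a * p j)" and ?S = "\<lambda>y. \<Sum>j\<in>J. c j * y j"
  define \<Phi> where "\<Phi> a = (\<integral>y. (1 - \<i> * of_real (1 / sqrt a * ?S y)) powr (- of_real a) \<partial>?D a)" for a
  define \<Psi> where "\<Psi> a = (\<integral>y. exp (\<i> * of_real (sqrt a * ?S y)) \<partial>?D a)" for a
  \<comment> \<open>The subtracted terms \<open>sqrt a * c j\<close>, weighted by
    \<open>p j\<close>, sum to zero by \<open>mean\<close>. Without them the individual phases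
    diverge as soon as \<open>c j\<close> is not 0.\<close>
  define e where "e a = exp (of_real (- (\<Sum>j\<in>J. p j * (a / 2 * ln (1 + (c j / sqrt a)\<^sup>2)))) +
      \<i> * of_real (\<Sum>j\<in>J. p j * (a * arctan (c j / sqrt a) - sqrt a * c j)))" for a
  have sum_a: "(\<Sum>j\<in>J. a * p j) = a" for a by (simp add: sum_distrib_left[symmetric] sum)
  have "((\<lambda>a. e a) \<longlongrightarrow> exp (of_real (- (\<Sum>j\<in>J. p j * ((c j)\<^sup>2 / 2))) + \<i> * of_real (\<Sum>j\<in>J. p j * 0))) at_top"
    unfolding e_def by (intro tendsto_intros ln_limit arctan_limit)
  then have e_lim: "(e \<longlongrightarrow> exp (of_real (- v / 2))) at_top"
    by (simp add: v_def sum_divide_distrib mult.commute)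
  have "\<forall>\<^sub>F a in at_top. \<Phi> a = e a"
    using eventually_gt_at_top[of 0] eventually_gt_at_top[of "K\<^sup>2"]
  proof eventually_elim
    case (elim a)
    \<comment> \<open>For \<open>a > K\<^sup>2\<close> the argument \<open>1 / sqrt a\<close> is in
      the range of \<open>integral_linear_powr\<close>.\<close>
    have "K < sqrt a" using elim by (intro real_less_rsqrt)
    then have K: "\<bar>1 / sqrt a\<bar> * K < 1"
      using elim by (simp add: pos_divide_less_eq)
    have ap: "0 < a * p j" if "j \<in> J" for j using elim p[OF that] by simp
    have "\<Phi> a = (\<Prod>j\<in>J. (1 - \<i> * of_real (1 / sqrt a * c j)) powr (- of_real (a * p j)))"
      unfolding \<Phi>_def using integral_linear_powr[of "\<lambda>j. a * p j" c K, OF ap cK K] by (simp only: sum_a)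
    also have "\<dots> = exp (\<Sum>j\<in>J. of_real (- (a * p j / 2 * ln (1 + (1 / sqrt a * c j)\<^sup>2))) +
        \<i> * of_real (a * p j * arctan (1 / sqrt a * c j)))"
      unfolding one_minus_ii_powr using finite by (rule exp_sum[symmetric])
    also have "\<dots> = exp (of_real (- (\<Sum>j\<in>J. p j * (a / 2 * ln (1 + (c j / sqrt a)\<^sup>2)))) +
        \<i> * of_real (\<Sum>j\<in>J. p j * (a * arctan (c j / sqrt a))))"
    proof -
      have "(\<Sum>j\<in>J. of_real (- (a * p j / 2 * ln (1 + (1 / sqrt a * c j)\<^sup>2)))) =
          complex_of_real (- (\<Sum>j\<in>J. p j * (a / 2 * ln (1 + (c j / sqrt a)\<^sup>2))))"
        unfolding of_real_sum[symmetric] sum_negf[symmetric]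
        by (intro arg_cong[where f=complex_of_real] sum.cong) (auto simp: mult_ac)
      moreover have "(\<Sum>j\<in>J. \<i> * of_real (a * p j * arctan (1 / sqrt a * c j))) =
          \<i> * complex_of_real (\<Sum>j\<in>J. p j * (a * arctan (c j / sqrt a)))"
        unfolding of_real_sum sum_distrib_left by (intro sum.cong) (auto simp: mult_ac)
      ultimately show ?thesis unfolding sum.distrib by (simp only:)
    qed
    also have "(\<Sum>j\<in>J. p j * (a * arctan (c j / sqrt a))) =
        (\<Sum>j\<in>J. p j * (a * arctan (c j / sqrt a) - sqrt a * c j))"
    proof -
      have "(\<Sum>j\<in>J. p j * (sqrt a * c j)) = sqrt a * (\<Sum>j\<in>J. c j * p j)"
        by (simp add: sum_distrib_left mult_ac)
      then show ?thesis using mean by (simp add: right_diff_distrib sum_subtractf)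
    qed
    finally show ?case by (simp only: e_def)
  qed
  then have \<Phi>: "(\<Phi> \<longlongrightarrow> exp (of_real (- v / 2))) at_top"
    using e_lim by (simp add: tendsto_cong)
  \<comment> \<open>The integrands differ by at most the square of the linear form, and the second
    moment of this centred form is \<open>v / (a + 1)\<close>.\<close>
  have "((\<lambda>a. \<Psi> a - \<Phi> a) \<longlongrightarrow> 0) at_top"
  proof (rule Lim_null_comparison)
    show "((\<lambda>a. v / a) \<longlongrightarrow> 0) at_top" by (rule tendsto_divide_0[OF tendsto_const filterlim_at_top_imp_at_infinity[OF filterlim_ident]])
    show "\<forall>\<^sub>F a in at_top. norm (\<Psi> a - \<Phi> a) \<le> v / a"
      using eventually_gt_at_top[of 0]
    proof eventually_elim
      case (elim a)
      have ap: "0 < a * p j" if "j \<in> J" for j using elim p[OF that] by simp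
      interpret D: prob_space "?D a" using ap by (rule prob)
      let ?f = "\<lambda>y. (1 - \<i> * of_real (1 / sqrt a * ?S y)) powr (- of_real a)"
      let ?g = "\<lambda>y. exp (\<i> * of_real (sqrt a * ?S y))"
      have fg: "norm (?g y - ?f y) \<le> (?S y)\<^sup>2" for y
      proof -
        have "1 / sqrt a = sqrt a / a" using elim by (subst frac_eq_eq) simp_all
        then have "1 / sqrt a * ?S y = sqrt a * ?S y / a" by simp
        with one_minus_ii_powr_approx[OF elim, of "sqrt a * ?S y"]
        have "norm (?f y - ?g y) \<le> (sqrt a * ?S y)\<^sup>2 / a" by (simp only:)
        also have "\<dots> = (?S y)\<^sup>2" using elim by (simp add: power_mult_distrib)
        finally show ?thesis by (simp only: norm_minus_commute)
      qed
      have gm: "?g \<in> borel_measurable (?D a)" by measurable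
      have fm: "?f \<in> borel_measurable (?D a)" by measurable
      have gi: "integrable (?D a) ?g" using gm by (intro D.integrable_const_bound[of _ 1]) auto
      have di: "integrable (?D a) (\<lambda>y. ?g y - ?f y)"
        by (rule Bochner_Integration.integrable_bound[OF integrable_power[of "\<lambda>j. a * p j" c 2, OF ap]])
          (use fg gm fm in auto)
      have fi: "integrable (?D a) ?f"
        using Bochner_Integration.integrable_diff[OF gi di] by simp
      have "\<Psi> a - \<Phi> a = (\<integral>y. ?g y - ?f y \<partial>?D a)"
        unfolding \<Psi>_def \<Phi>_def using gi fi by (rule Bochner_Integration.integral_diff[symmetric])
      also have "norm \<dots> \<le> (\<integral>y. (?S y)\<^sup>2 \<partial>?D a)"
        using fg di
        by (intro order_trans[OF integral_norm_bound integral_mono] integrable_power[of "\<lambda>j. a * p j" c 2, OF ap]) auto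
      also have "\<dots> = a * v / (a * (a + 1))"
      proof -
        have "(\<Sum>j\<in>J. c j * (a * p j)) = a * (\<Sum>j\<in>J. c j * p j)"
          by (simp add: sum_distrib_left mult_ac)
        then have mean_a: "(\<Sum>j\<in>J. c j * (a * p j)) = 0" using mean by simp
        have "pochhammer a 2 * (\<integral>y. (?S y)\<^sup>2 \<partial>?D a) = (\<Sum>j\<in>J. (c j)\<^sup>2 * (a * p j))"
          using moment[of "\<lambda>j. a * p j" 2 c, OF ap] dirichlet_moment_2[OF finite mean_a]
          by (simp only: sum_a)
        also have "\<dots> = a * v" by (simp add: v_def sum_distrib_left mult_ac)
        finally have "a * (a + 1) * (\<integral>y. (?S y)\<^sup>2 \<partial>?D a) = a * v"
          by (simp add: numeral_2_eq_2 pochhammer_rec)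
        then show ?thesis using elim by (subst nonzero_eq_divide_eq) (simp_all add: mult.commute)
      qed
      also have "\<dots> \<le> v / a"
      proof -
        have "v \<ge> 0" unfolding v_def using p by (intro sum_nonneg mult_nonneg_nonneg) (auto simp: less_imp_le)
        then show ?thesis using elim by (simp add: frac_le)
      qed
      finally show ?case .
    qed
  qed
  from tendsto_add[OF this \<Phi>] show ?thesis by (simp add: \<Psi>_def v_def)
qed

end

section \<open>Partitions under a Dirichlet process\<close>

lemma sets_unit_lebesgue: "A \<in> sets unit_lebesgue \<longleftrightarrow> A \<in> sets borel \<and> A \<subseteq> {0..1}"
  unfolding unit_lebesgue_def by (subst sets_restrict_space_iff) auto

lemma space_unit_lebesgue: "space unit_lebesgue = {0..1}"
  unfolding unit_lebesgue_def by (simp add: space_restrict_space)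

lemma measure_unit_lebesgue: "A \<subseteq> {0..1} \<Longrightarrow> measure unit_lebesgue A = measure lborel A"
  unfolding unit_lebesgue_def by (intro measure_restrict_space) auto

lemma prob_algebra_D:
  assumes "P \<in> measurable M (prob_algebra H)" "\<omega> \<in> space M"
  shows "prob_space (P \<omega>)" "sets (P \<omega>) = sets H" "space (P \<omega>) = space H"
  using measurable_space[OF assms] sets_eq_imp_space_eq[of "P \<omega>" H] by (auto simp: space_prob_algebra)

lemma dirichlet_cong:
  assumes "\<And>i. i \<in> J \<Longrightarrow> \<alpha> i = \<beta> i"
  shows "dirichlet J \<alpha> = dirichlet J \<beta>"
proof -
  have "sum \<alpha> J = sum \<beta> J" "(\<Prod>i\<in>J. Gamma (\<alpha> i)) = (\<Prod>i\<in>J. Gamma (\<beta> i))"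
    "\<And>y. (\<Prod>i\<in>J. y i powr (\<alpha> i - 1)) = (\<Prod>i\<in>J. y i powr (\<beta> i - 1))"
    using assms by (intro sum.cong prod.cong refl; simp)+
  then show ?thesis unfolding dirichlet_def dirichlet_density_def by (simp only:)
qed

context
  fixes M :: "'w measure" and a :: real and H :: "'x measure" and P :: "'w \<Rightarrow> 'x measure"
  assumes DP: "dirichlet_process M a H P"
begin

lemma dirichlet_process_D:
  shows "prob_space M" "prob_space H" "a > 0" "P \<in> measurable M (prob_algebra H)"
  using DP by (auto simp: dirichlet_process_def)

text \<open>\<open>J\<close> is tied down by an equation so that a simplified form of the index set,
  such as \<open>{..<k}\<close>, can be substituted.\<close>

lemma dirichlet_process_law:
  fixes k :: nat
  assumes "\<forall>i<k. A i \<in> sets H" "disjoint_family_on A {..<k}" "(\<Union>i<k. A i) = space H"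
    and J: "J = {i. i < k \<and> measure H (A i) > 0}"
  shows "distr M (Pi\<^sub>M J (\<lambda>_. borel)) (\<lambda>\<omega>. \<lambda>i\<in>J. measure (P \<omega>) (A i)) = dirichlet J (\<lambda>i. a * measure H (A i))"
    and "\<forall>i<k. measure H (A i) = 0 \<longrightarrow> (AE \<omega> in M. measure (P \<omega>) (A i) = 0)"
proof -
  have "\<forall>(k::nat) A. (\<forall>i<k. A i \<in> sets H) \<and> disjoint_family_on A {..<k} \<and> (\<Union>i<k. A i) = space H \<longrightarrow>
        (let J = {i. i < k \<and> measure H (A i) > 0} in
           distr M (Pi\<^sub>M J (\<lambda>_. borel)) (\<lambda>\<omega>. \<lambda>i\<in>J. measure (P \<omega>) (A i))
             = dirichlet J (\<lambda>i. a * measure H (A i)) \<and>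
           (\<forall>i<k. measure H (A i) = 0 \<longrightarrow> (AE \<omega> in M. measure (P \<omega>) (A i) = 0)))"
    using DP unfolding dirichlet_process_def by (elim conjE)
  from this[THEN spec, THEN spec, THEN mp, OF conjI[OF assms(1) conjI[OF assms(2,3)]]]
  show "distr M (Pi\<^sub>M J (\<lambda>_. borel)) (\<lambda>\<omega>. \<lambda>i\<in>J. measure (P \<omega>) (A i)) = dirichlet J (\<lambda>i. a * measure H (A i))"
    and "\<forall>i<k. measure H (A i) = 0 \<longrightarrow> (AE \<omega> in M. measure (P \<omega>) (A i) = 0)"
    unfolding Let_def J by (rule conjunct1, rule conjunct2)
qed

lemma dirichlet_process_measurable:
  "A \<in> sets H \<Longrightarrow> (\<lambda>\<omega>. measure (P \<omega>) A) \<in> borel_measurable M"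
  by (rule measurable_compose[OF dirichlet_process_D(4) measurable_measure_prob_algebra])

lemma dirichlet_process_partition:
  fixes k :: nat
  assumes A: "\<And>i. i < k \<Longrightarrow> A i \<in> sets H" "disjoint_family_on A {..<k}" "(\<Union>i<k. A i) = space H"
    and \<alpha>: "\<And>i. i < k \<Longrightarrow> measure H (A i) > 0" "\<And>i. i < k \<Longrightarrow> a * measure H (A i) = \<alpha> i"
  shows "(\<lambda>\<omega>. \<lambda>i\<in>{..<k}. measure (P \<omega>) (A i)) \<in> measurable M (Pi\<^sub>M {..<k} (\<lambda>_. borel))"
    and "distr M (Pi\<^sub>M {..<k} (\<lambda>_. borel)) (\<lambda>\<omega>. \<lambda>i\<in>{..<k}. measure (P \<omega>) (A i)) = dirichlet {..<k} \<alpha>"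
proof -
  show "(\<lambda>\<omega>. \<lambda>i\<in>{..<k}. measure (P \<omega>) (A i)) \<in> measurable M (Pi\<^sub>M {..<k} (\<lambda>_. borel))"
    using A(1) by (intro measurable_restrict dirichlet_process_measurable) auto
  have J: "{i. i < k \<and> 0 < measure H (A i)} = {..<k}" using \<alpha> by auto
  have "distr M (Pi\<^sub>M {..<k} (\<lambda>_. borel)) (\<lambda>\<omega>. \<lambda>i\<in>{..<k}. measure (P \<omega>) (A i)) =
      dirichlet {..<k} (\<lambda>i. a * measure H (A i))"
    using A by (intro dirichlet_process_law(1)[OF _ _ _ J[symmetric]]) auto
  also have "\<dots> = dirichlet {..<k} \<alpha>" using \<alpha> by (intro dirichlet_cong) auto
  finally show "distr M (Pi\<^sub>M {..<k} (\<lambda>_. borel)) (\<lambda>\<omega>. \<lambda>i\<in>{..<k}. measure (P \<omega>) (A i)) = dirichlet {..<k} \<alpha>" .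
qed

text \<open>The clause on null cells is applied to the partition of the space into \<open>A\<close>
  and its complement.\<close>

lemma dirichlet_process_null:
  assumes A: "A \<in> sets H" "measure H A = 0"
  shows "AE \<omega> in M. measure (P \<omega>) A = 0"
proof -
  define B where "B i = (if i = (0::nat) then A else space H - A)" for i
  have "\<forall>i<2. B i \<in> sets H" using A by (auto simp: B_def)
  moreover have "disjoint_family_on B {..<2}" by (auto simp: B_def disjoint_family_on_def)
  moreover have "(\<Union>i<2. B i) = space H"
    using sets.sets_into_space[OF A(1)] by (auto simp: B_def numeral_2_eq_2 lessThan_Suc)
  ultimately have "\<forall>i<2. measure H (B i) = 0 \<longrightarrow> (AE \<omega> in M. measure (P \<omega>) (B i) = 0)"
    by (rule dirichlet_process_law(2)[OF _ _ _ refl])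
  from this[rule_format, of 0] A show ?thesis by (simp add: B_def)
qed

end

section \<open>Partitions of the unit interval into consecutive cells\<close>

text \<open>Cells are closed on the right and the first one also contains 0. Thus the first
  \<open>i\<close> cells (\<open>i > 0\<close>) unite to an interval \<open>{0..t}\<close>, and
  partial sums of cell masses are values of the distribution function.\<close>

definition interval_cell :: "(nat \<Rightarrow> real) \<Rightarrow> nat \<Rightarrow> real set" where
  "interval_cell p i = {t\<in>{0..1}. (i = 0 \<or> (\<Sum>j<i. p j) < t) \<and> t \<le> (\<Sum>j<Suc i. p j)}"

context
  fixes p :: "nat \<Rightarrow> real" and k :: nat
  assumes pos: "\<And>i. i < k \<Longrightarrow> 0 < p i" and sum: "(\<Sum>i<k. p i) = 1"
begin

lemma cumulative_mono: "i \<le> j \<Longrightarrow> j \<le> k \<Longrightarrow> (\<Sum>l<i. p l) \<le> (\<Sum>l<j. p l)"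
  using pos by (intro sum_mono2) (auto intro: less_imp_le)

lemma interval_cell_eq:
  assumes "i < k"
  shows "interval_cell p i = (if i = 0 then {0..p 0} else {(\<Sum>j<i. p j)<..(\<Sum>j<Suc i. p j)})"
proof -
  have "(\<Sum>j<Suc i. p j) \<le> 1" using cumulative_mono[of "Suc i" k] assms sum by simp
  moreover have "0 \<le> (\<Sum>j<i. p j)" using pos assms by (intro sum_nonneg) (auto intro: less_imp_le)
  ultimately show ?thesis unfolding interval_cell_def by auto
qed

lemma interval_cell_sets: "interval_cell p i \<in> sets unit_lebesgue"
proof -
  have "interval_cell p i = {t. 0 \<le> t \<and> t \<le> 1 \<and> (i = 0 \<or> (\<Sum>j<i. p j) < t) \<and> t \<le> (\<Sum>j<Suc i. p j)}"
    by (auto simp: interval_cell_def)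
  also have "\<dots> \<in> sets borel" by measurable
  finally show ?thesis by (auto simp: sets_unit_lebesgue interval_cell_def)
qed

lemma interval_cell_measure:
  assumes i: "i < k"
  shows "measure unit_lebesgue (interval_cell p i) = p i"
proof -
  have "interval_cell p i \<subseteq> {0..1}" unfolding interval_cell_def by blast
  then have "measure unit_lebesgue (interval_cell p i) = measure lborel (interval_cell p i)"
    by (rule measure_unit_lebesgue)
  also have "\<dots> = p i"
    using pos[OF i] unfolding interval_cell_eq[OF i] by (cases "i = 0") simp_all
  finally show ?thesis .
qed

lemma interval_cell_disjoint: "disjoint_family_on (interval_cell p) {..<k}"
proof -
  have "interval_cell p i \<inter> interval_cell p j = {}" if "i < j" "j < k" for i j
  proof -
    have "(\<Sum>l<Suc i. p l) \<le> (\<Sum>l<j. p l)" using that by (intro cumulative_mono) auto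
    moreover have "j \<noteq> 0" using that by simp
    ultimately show ?thesis unfolding interval_cell_def by force
  qed
  then show ?thesis unfolding disjoint_family_on_def by (metis inf_commute lessThan_iff linorder_neqE_nat)
qed

lemma interval_cell_Union:
  assumes i: "0 < i" "i \<le> k"
  shows "(\<Union>j<i. interval_cell p j) = {0..(\<Sum>j<i. p j)}"
proof
  show "(\<Union>j<i. interval_cell p j) \<subseteq> {0..(\<Sum>j<i. p j)}"
  proof
    fix t assume "t \<in> (\<Union>j<i. interval_cell p j)"
    then obtain j where j: "j < i" "t \<in> interval_cell p j" by auto
    then show "t \<in> {0..(\<Sum>j<i. p j)}"
      using cumulative_mono[of "Suc j" i] i by (auto simp: interval_cell_def)
  qed
  show "{0..(\<Sum>j<i. p j)} \<subseteq> (\<Union>j<i. interval_cell p j)"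
  proof
    fix t assume t: "t \<in> {0..(\<Sum>j<i. p j)}"
    define l where "l = (LEAST l. t \<le> (\<Sum>j<Suc l. p j))"
    have ex: "t \<le> (\<Sum>j<Suc (i - 1). p j)" using t i by simp
    then have l: "t \<le> (\<Sum>j<Suc l. p j)" "l \<le> i - 1" unfolding l_def by (rule LeastI, rule Least_le)
    have "(\<Sum>j<l. p j) < t" if "l \<noteq> 0"
      using not_less_Least[of "l - 1" "\<lambda>l. t \<le> (\<Sum>j<Suc l. p j)"] that unfolding l_def[symmetric] by simp
    moreover have "t \<le> 1" using t cumulative_mono[of i k] i sum by auto
    ultimately have "t \<in> interval_cell p l" using t l by (auto simp: interval_cell_def)
    then show "t \<in> (\<Union>j<i. interval_cell p j)" using l i by auto
  qed
qed

lemma interval_cell_cover: "(\<Union>i<k. interval_cell p i) = {0..1}"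
  using interval_cell_Union[of k] sum by (cases "k = 0") auto

end

text \<open>Every Dirichlet law with index set \<open>{..<k}\<close> is the joint law of a partition under one of the
  processes, so its normalization comes for free.\<close>

lemma dirichlet_family_lessThan:
  assumes DP: "\<And>a. a > 0 \<Longrightarrow> dirichlet_process (M a) a unit_lebesgue (P a)" and k: "k > 0"
  shows "dirichlet_family {..<k}"
proof (rule dirichlet_family.intro)
  show "finite {..<k}" "{..<k} \<noteq> {}" using k by auto
  fix \<alpha> :: "nat \<Rightarrow> real" assume \<alpha>: "\<And>i. i \<in> {..<k} \<Longrightarrow> 0 < \<alpha> i"
  \<comment> \<open>The total mass selects the process, and the normalized weights become the
    lengths of the cells.\<close>
  define a where "a = (\<Sum>i<k. \<alpha> i)"
  define p where "p i = \<alpha> i / a" for i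
  have a: "a > 0" unfolding a_def using \<alpha> k by (intro sum_pos) auto
  have p: "\<And>i. i < k \<Longrightarrow> 0 < p i" "(\<Sum>i<k. p i) = 1"
    using \<alpha> a by (auto simp: p_def sum_divide_distrib[symmetric] a_def)
  note cell = interval_cell_measure[of k p, OF p]
  have dp: "(\<lambda>\<omega>. \<lambda>i\<in>{..<k}. measure (P a \<omega>) (interval_cell p i)) \<in> measurable (M a) (Pi\<^sub>M {..<k} (\<lambda>_. borel))"
    "distr (M a) (Pi\<^sub>M {..<k} (\<lambda>_. borel)) (\<lambda>\<omega>. \<lambda>i\<in>{..<k}. measure (P a \<omega>) (interval_cell p i)) = dirichlet {..<k} \<alpha>"
    by (rule dirichlet_process_partition[OF DP[OF a]];
        use cell p a interval_cell_sets[of k p, OF p] interval_cell_disjoint[of k p, OF p]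
          interval_cell_cover[of k p, OF p] in \<open>simp add: p_def space_unit_lebesgue\<close>)+
  interpret prob_space "M a" by (rule dirichlet_process_D(1)[OF DP[OF a]])
  show "prob_space (dirichlet {..<k} \<alpha>)"
    using prob_space_distr[OF dp(1)] by (simp only: dp(2))
qed

section \<open>Increments and grid values of the distribution function\<close>

text \<open>The increment and its complement form a two-cell partition; \<open>t - s < 1\<close>
  gives the complement positive length. The second term of the bound comes from the fourth cumulant
  and takes over once the length falls below order \<open>1 / a\<close>.\<close>

lemma dirichlet_increment_moment:
  assumes DP: "\<And>a. a > 0 \<Longrightarrow> dirichlet_process (M a) a unit_lebesgue (P a)" and a: "a > 0"
    and st: "0 \<le> s" "s < t" "t \<le> 1" "t - s < 1"
  shows "integrable (M a) (\<lambda>\<omega>. (sqrt a * (measure (P a \<omega>) {s<..t} - (t - s))) ^ 4)"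
    and "(\<integral>\<omega>. (sqrt a * (measure (P a \<omega>) {s<..t} - (t - s))) ^ 4 \<partial>M a) \<le> 3 * (t - s)\<^sup>2 + 6 * (t - s) / a"
proof -
  define h where "h = t - s"
  have h: "0 < h" "h < 1" using st by (auto simp: h_def)
  note D = DP[OF a]
  interpret prob_space "M a" by (rule dirichlet_process_D(1)[OF D])
  define A where "A i = (if i = (0::nat) then {s<..t} else {0..1} - {s<..t})" for i
  define \<alpha> where "\<alpha> = (\<lambda>i::nat. if i = 0 then a * h else a * (1 - h))"
  define c where "c = (\<lambda>i::nat. if i = 0 then 1 - h else - h)"
  have two: "{..<2::nat} = {0, 1}" by auto
  interpret H: prob_space unit_lebesgue by (rule dirichlet_process_D(2)[OF D])
  have A0: "{s<..t} \<in> sets unit_lebesgue" using st by (auto simp: sets_unit_lebesgue)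
  have mA0: "measure unit_lebesgue {s<..t} = h" using st by (subst measure_unit_lebesgue) (auto simp: h_def)
  have mA1: "measure unit_lebesgue ({0..1} - {s<..t}) = 1 - h"
    using H.prob_compl[OF A0] by (simp add: space_unit_lebesgue mA0)
  have A: "A i \<in> sets unit_lebesgue" "0 < measure unit_lebesgue (A i)" "a * measure unit_lebesgue (A i) = \<alpha> i" for i
    using A0 st h by (auto simp: A_def \<alpha>_def mA0 mA1 sets_unit_lebesgue)
  have A2: "disjoint_family_on A {..<2}" "(\<Union>i<2. A i) = space unit_lebesgue"
    using st by (auto simp: A_def two space_unit_lebesgue disjoint_family_on_def)
  note part = dirichlet_process_partition[OF D A(1) A2 A(2,3)]
  interpret F: dirichlet_family "{..<2}" by (rule dirichlet_family_lessThan[OF DP]) auto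
  have \<alpha>: "0 < \<alpha> i" for i using h a by (simp add: \<alpha>_def)
  let ?S = "\<lambda>y. \<Sum>i<2. c i * y i"
  have S: "?S (\<lambda>i\<in>{..<2}. measure (P a \<omega>) (A i)) = measure (P a \<omega>) {s<..t} - h" if "\<omega> \<in> space (M a)" for \<omega>
  proof -
    note P = prob_algebra_D[OF dirichlet_process_D(4)[OF D] that]
    interpret P: prob_space "P a \<omega>" by (rule P(1))
    have compl: "measure (P a \<omega>) ({0..1} - {s<..t}) = 1 - measure (P a \<omega>) {s<..t}"
      using P.prob_compl[of "{s<..t}"] A0 P(2,3) by (simp add: space_unit_lebesgue)
    have "?S (\<lambda>i\<in>{..<2}. measure (P a \<omega>) (A i)) =
        (1 - h) * measure (P a \<omega>) {s<..t} - h * measure (P a \<omega>) ({0..1} - {s<..t})"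
      by (simp add: two A_def c_def)
    also have "\<dots> = measure (P a \<omega>) {s<..t} - h" unfolding compl by (simp add: algebra_simps)
    finally show ?thesis .
  qed
  have m: "(\<lambda>y. ?S y ^ 4) \<in> borel_measurable (Pi\<^sub>M {..<2} (\<lambda>_. borel))" by measurable
  have "integrable (dirichlet {..<2} \<alpha>) (\<lambda>y. ?S y ^ 4)" by (intro F.integrable_power \<alpha>)
  then have "integrable (M a) (\<lambda>\<omega>. ?S (\<lambda>i\<in>{..<2}. measure (P a \<omega>) (A i)) ^ 4)"
    unfolding part(2)[symmetric] by (rule integrable_distr[OF part(1)])
  then have int: "integrable (M a) (\<lambda>\<omega>. (measure (P a \<omega>) {s<..t} - h) ^ 4)"
    by (rule Bochner_Integration.integrable_cong[THEN iffD1, rotated -1]) (simp_all only: S)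
  have sqrt4: "(sqrt a * x) ^ 4 = a\<^sup>2 * x ^ 4" for x
    using a power_mult[of "sqrt a" 2 2] by (simp add: power_mult_distrib)
  show "integrable (M a) (\<lambda>\<omega>. (sqrt a * (measure (P a \<omega>) {s<..t} - (t - s))) ^ 4)"
    unfolding sqrt4 using int by (simp add: h_def)
  have "(\<integral>\<omega>. (measure (P a \<omega>) {s<..t} - h) ^ 4 \<partial>M a) =
      (\<integral>\<omega>. ?S (\<lambda>i\<in>{..<2}. measure (P a \<omega>) (A i)) ^ 4 \<partial>M a)"
    by (rule Bochner_Integration.integral_cong) (simp_all only: S)
  also have "\<dots> = (\<integral>y. ?S y ^ 4 \<partial>dirichlet {..<2} \<alpha>)"
    unfolding part(2)[symmetric] by (rule integral_distr[OF part(1) m, symmetric])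
  finally have eq: "(\<integral>\<omega>. (measure (P a \<omega>) {s<..t} - h) ^ 4 \<partial>M a) = (\<integral>y. ?S y ^ 4 \<partial>dirichlet {..<2} \<alpha>)" .
  define m4 where "m4 = (\<integral>y. ?S y ^ 4 \<partial>dirichlet {..<2} \<alpha>)"
  have "(\<Sum>i<2. \<alpha> i) = a" by (simp add: two \<alpha>_def algebra_simps)
  then have mom: "pochhammer a 4 * m4 = 3 * (a * h * (1 - h))\<^sup>2 + 6 * (a * h * (1 - h) * ((1 - h) ^ 3 + h ^ 3))"
    using F.moment[of \<alpha> 4 c, OF \<alpha>] dirichlet_moment_4[OF \<alpha>_def c_def] by (simp add: m4_def)
  have m4: "0 \<le> m4" unfolding m4_def by (intro Bochner_Integration.integral_nonneg) auto
  have "a ^ 4 \<le> pochhammer a 4"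
  proof -
    have "a * (a * (a * a)) \<le> a * ((a + 1) * ((a + 2) * (a + 3)))"
      using a by (intro mult_mono mult_nonneg_nonneg) auto
    then show ?thesis by (simp add: numeral_eq_Suc pochhammer_rec add_ac)
  qed
  then have "a ^ 4 * m4 \<le> pochhammer a 4 * m4" using m4 by (rule mult_right_mono)
  also have "\<dots> \<le> 3 * (a * h)\<^sup>2 + 6 * (a * h)"
  proof -
    have h1: "0 \<le> h * (1 - h)" "h * (1 - h) \<le> h * 1" using h by (auto intro!: mult_left_mono mult_nonneg_nonneg)
    then have h2: "0 \<le> a * h * (1 - h)" "a * h * (1 - h) \<le> a * h"
      using a mult_left_mono[of "h * (1 - h)" h a] by (auto simp: mult.assoc)
    have h3: "(1 - h) ^ 3 + h ^ 3 \<le> 1" "0 \<le> (1 - h) ^ 3 + h ^ 3"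
    proof -
      have "(1 - h) ^ 3 + h ^ 3 = 1 - 3 * (h * (1 - h))" by (simp add: power3_eq_cube algebra_simps)
      then show "(1 - h) ^ 3 + h ^ 3 \<le> 1" using h1 by simp
      show "0 \<le> (1 - h) ^ 3 + h ^ 3" using h by simp
    qed
    have "(a * h * (1 - h))\<^sup>2 \<le> (a * h)\<^sup>2" using h2 by (rule power_mono[rotated])
    moreover have "a * h * (1 - h) * ((1 - h) ^ 3 + h ^ 3) \<le> a * h * 1"
      by (rule mult_mono[OF h2(2) h3(1) _ h3(2)]) (use a h in simp)
    ultimately show ?thesis unfolding mom by simp
  qed
  finally have "a\<^sup>2 * m4 \<le> (3 * (a * h)\<^sup>2 + 6 * (a * h)) / a\<^sup>2"
    using a by (simp add: pos_le_divide_eq power_mult_distrib numeral_eq_Suc mult_ac)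
  also have "\<dots> = 3 * h\<^sup>2 + 6 * h / a" using a by (simp add: add_divide_distrib power_mult_distrib power2_eq_square)
  finally have "a\<^sup>2 * m4 \<le> 3 * h\<^sup>2 + 6 * h / a" .
  moreover have "(\<integral>\<omega>. (sqrt a * (measure (P a \<omega>) {s<..t} - (t - s))) ^ 4 \<partial>M a) = a\<^sup>2 * m4"
    unfolding sqrt4 by (simp add: m4_def eq h_def[symmetric])
  ultimately show "(\<integral>\<omega>. (sqrt a * (measure (P a \<omega>) {s<..t} - (t - s))) ^ 4 \<partial>M a) \<le> 3 * (t - s)\<^sup>2 + 6 * (t - s) / a"
    by (simp add: h_def)
qed

lemma sum_step_eq:
  fixes x :: "nat \<Rightarrow> real"
  assumes "i \<le> n"
  shows "(\<Sum>j<n. if j < i then x j else 0) = (\<Sum>j<i. x j)"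
proof -
  have "{..<n} \<inter> {j. j < i} = {..<i}" using assms by auto
  then show ?thesis by (simp add: sum.If_cases)
qed

text \<open>Summation by parts turns the weights on distribution function values into weights on
  cells: cell \<open>j\<close> receives \<open>d j\<close>, the sum of all \<open>\<theta> i\<close>
  with \<open>j < i\<close>. The covariance arises since two initial segments of cells of lengths
  \<open>s\<close> and \<open>t\<close> overlap in length \<open>min s t\<close>.\<close>

lemma dirichlet_grid_char_limit:
  assumes DP: "\<And>a. a > 0 \<Longrightarrow> dirichlet_process (M a) a unit_lebesgue (P a)" and n: "n > 0"
  shows "((\<lambda>a. \<integral>\<omega>. exp (\<i> * of_real (\<Sum>i\<le>n. \<theta> i * (sqrt a * (measure (P a \<omega>) {0..real i / real n} - real i / real n)))) \<partial>M a)
     \<longlongrightarrow> exp (of_real (- (\<Sum>i\<le>n. \<Sum>k\<le>n. \<theta> i * \<theta> k *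
        (min (real i / real n) (real k / real n) - real i / real n * (real k / real n))) / 2))) at_top"
proof -
  define p where "p = (\<lambda>j::nat. 1 / real n)"
  define d where "d j = (\<Sum>i\<le>n. if j < i then \<theta> i else 0)" for j
  define m where "m = (\<Sum>i\<le>n. \<theta> i * (real i / real n))"
  \<comment> \<open>\<open>m\<close> is the mean of \<open>d\<close>. Subtracting it yields the
    centring that \<open>char_limit\<close> requires, absorbs the drift because the cell masses sum
    to 1, and is the source of the term \<open>- s * t\<close> in the covariance.\<close>
  define c where "c j = d j - m" for j
  have p: "\<And>i. i < n \<Longrightarrow> 0 < p i" "(\<Sum>i<n. p i) = 1" using n by (auto simp: p_def)
  have cum: "(\<Sum>j<i. p j) = real i / real n" for i by (simp add: p_def)
  have sum_d: "(\<Sum>j<n. d j * x j) = (\<Sum>i\<le>n. \<theta> i * (\<Sum>j<i. x j))" for x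
  proof -
    have "(\<Sum>j<n. d j * x j) = (\<Sum>j<n. \<Sum>i\<le>n. \<theta> i * (if j < i then x j else 0))"
      unfolding d_def sum_distrib_right by (intro sum.cong refl) auto
    also have "\<dots> = (\<Sum>i\<le>n. \<theta> i * (\<Sum>j<n. if j < i then x j else 0))"
      unfolding sum_distrib_left by (rule sum.swap)
    also have "\<dots> = (\<Sum>i\<le>n. \<theta> i * (\<Sum>j<i. x j))"
      by (intro sum.cong refl) (simp only: sum_step_eq atMost_iff)
    finally show ?thesis .
  qed
  have mean_d: "(\<Sum>j<n. d j * p j) = m" by (simp only: sum_d cum m_def)
  have mean: "(\<Sum>j<n. c j * p j) = 0"
    using p(2) by (simp add: c_def left_diff_distrib sum_subtractf mean_d sum_distrib_left[symmetric])
  have var: "(\<Sum>j<n. (c j)\<^sup>2 * p j) = (\<Sum>i\<le>n. \<Sum>k\<le>n. \<theta> i * \<theta> k *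
        (min (real i / real n) (real k / real n) - real i / real n * (real k / real n)))"
  proof -
    have "(\<Sum>j<n. (c j)\<^sup>2 * p j) = (\<Sum>j<n. (d j)\<^sup>2 * p j) - 2 * m * (\<Sum>j<n. d j * p j) + m\<^sup>2 * (\<Sum>j<n. p j)"
      unfolding sum_distrib_left sum_subtractf[symmetric] sum.distrib[symmetric]
      by (intro sum.cong refl) (simp add: c_def power2_eq_square algebra_simps)
    also have "\<dots> = (\<Sum>j<n. d j * (d j * p j)) - m\<^sup>2" by (simp add: mean_d p(2) power2_eq_square mult_ac)
    also have "(\<Sum>j<n. d j * (d j * p j)) =
        (\<Sum>i\<le>n. \<theta> i * (\<Sum>k\<le>n. \<theta> k * min (real i / real n) (real k / real n)))"
      unfolding sum_d
    proof (rule sum.cong[OF refl], rule arg_cong[where f="(*) _"])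
      fix i assume "i \<in> {..n}"
      then have i: "i \<le> n" by simp
      have "(\<Sum>j<i. d j * p j) = (\<Sum>j<n. d j * (if j < i then p j else 0))"
        unfolding sum_step_eq[OF i, of "\<lambda>j. d j * p j", symmetric] by (intro sum.cong) auto
      also have "\<dots> = (\<Sum>k\<le>n. \<theta> k * (\<Sum>j<k. if j < i then p j else 0))" by (rule sum_d)
      also have "\<dots> = (\<Sum>k\<le>n. \<theta> k * min (real i / real n) (real k / real n))"
      proof (rule sum.cong[OF refl], rule arg_cong[where f="(*) _"])
        fix k
        show "(\<Sum>j<k. if j < i then p j else 0) = min (real i / real n) (real k / real n)"
        proof (cases "i \<le> k")
          case True
          then show ?thesis
            using n by (simp only: sum_step_eq cum) (simp add: min_def divide_right_mono)
        next
          case False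
          then have "(\<Sum>j<k. if j < i then p j else 0) = (\<Sum>j<k. p j)" by (intro sum.cong) auto
          with False show ?thesis using n by (simp add: cum min_def divide_le_cancel)
        qed
      qed
      finally show "(\<Sum>j<i. d j * p j) = (\<Sum>k\<le>n. \<theta> k * min (real i / real n) (real k / real n))" .
    qed
    also have "m\<^sup>2 = (\<Sum>i\<le>n. \<Sum>k\<le>n. \<theta> i * \<theta> k * (real i / real n * (real k / real n)))"
      unfolding m_def power2_eq_square sum_product by (intro sum.cong refl) (simp only: mult_ac)
    finally show ?thesis
      by (simp only: sum_distrib_left sum_subtractf[symmetric] right_diff_distrib mult.assoc)
  qed
  interpret F: dirichlet_family "{..<n}" by (rule dirichlet_family_lessThan[OF DP n])
  have lim: "((\<lambda>a. \<integral>y. exp (\<i> * of_real (sqrt a * (\<Sum>j<n. c j * y j))) \<partial>dirichlet {..<n} (\<lambda>j. a * p j))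
     \<longlongrightarrow> exp (of_real (- (\<Sum>j<n. (c j)\<^sup>2 * p j) / 2))) at_top"
    using p mean by (intro F.char_limit) auto
  have "(\<integral>\<omega>. exp (\<i> * of_real (\<Sum>i\<le>n. \<theta> i * (sqrt a * (measure (P a \<omega>) {0..real i / real n} - real i / real n)))) \<partial>M a)
      = (\<integral>y. exp (\<i> * of_real (sqrt a * (\<Sum>j<n. c j * y j))) \<partial>dirichlet {..<n} (\<lambda>j. a * p j))"
    if a: "a > 0" for a
  proof -
    note D = DP[OF a]
    let ?C = "interval_cell p" and ?Y = "\<lambda>\<omega>. \<lambda>i\<in>{..<n}. measure (P a \<omega>) (interval_cell p i)"
    have C: "\<And>i. ?C i \<in> sets unit_lebesgue" "disjoint_family_on ?C {..<n}" "(\<Union>i<n. ?C i) = {0..1}"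
      "\<And>i. i < n \<Longrightarrow> measure unit_lebesgue (?C i) = p i"
      "\<And>i. 0 < i \<Longrightarrow> i \<le> n \<Longrightarrow> (\<Union>j<i. ?C j) = {0..real i / real n}"
      using interval_cell_sets[of n p, OF p] interval_cell_disjoint[of n p, OF p] interval_cell_cover[of n p, OF p]
        interval_cell_measure[of n p, OF p] interval_cell_Union[of n p, OF p] cum by auto
    have part: "?Y \<in> measurable (M a) (Pi\<^sub>M {..<n} (\<lambda>_. borel))"
      "distr (M a) (Pi\<^sub>M {..<n} (\<lambda>_. borel)) ?Y = dirichlet {..<n} (\<lambda>j. a * p j)"
      using C p by (intro dirichlet_process_partition[OF D]; simp add: space_unit_lebesgue)+
    have em: "(\<lambda>y. exp (\<i> * of_real (sqrt a * (\<Sum>j<n. c j * y j)))) \<in> borel_measurable (Pi\<^sub>M {..<n} (\<lambda>_. borel))"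
      by measurable
    have Icc: "{0..real i / real n} \<in> sets unit_lebesgue" if "i \<le> n" for i
      using that n by (auto simp: sets_unit_lebesgue pos_divide_le_eq)
    \<comment> \<open>For \<open>i = 0\<close> the interval \<open>{0..0}\<close> is a point and not
      a union of cells. Its mass vanishes only almost surely, so the integrands agree only almost
      everywhere.\<close>
    have "{0} \<in> sets unit_lebesgue" "measure unit_lebesgue {0} = 0"
      using measure_unit_lebesgue[of "{0}"] by (auto simp: sets_unit_lebesgue)
    then have null: "AE \<omega> in M a. measure (P a \<omega>) {0} = 0" by (rule dirichlet_process_null[OF D])
    have "(\<integral>\<omega>. exp (\<i> * of_real (\<Sum>i\<le>n. \<theta> i * (sqrt a * (measure (P a \<omega>) {0..real i / real n} - real i / real n)))) \<partial>M a)
      = (\<integral>\<omega>. exp (\<i> * of_real (sqrt a * (\<Sum>j<n. c j * ?Y \<omega> j))) \<partial>M a)"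
    proof (rule integral_cong_AE)
      show "(\<lambda>\<omega>. exp (\<i> * of_real (sqrt a * (\<Sum>j<n. c j * ?Y \<omega> j)))) \<in> borel_measurable (M a)"
        using measurable_compose[OF part(1) em] .
      have [measurable]: "(\<lambda>\<omega>. measure (P a \<omega>) {0..real i / real n}) \<in> borel_measurable (M a)" if "i \<in> {..n}" for i
        using that by (intro dirichlet_process_measurable[OF D] Icc) auto
      show "(\<lambda>\<omega>. exp (\<i> * of_real (\<Sum>i\<le>n. \<theta> i * (sqrt a * (measure (P a \<omega>) {0..real i / real n} - real i / real n)))))
          \<in> borel_measurable (M a)"
        by measurable
      show "AE \<omega> in M a. exp (\<i> * of_real (\<Sum>i\<le>n. \<theta> i * (sqrt a * (measure (P a \<omega>) {0..real i / real n} - real i / real n))))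
         = exp (\<i> * of_real (sqrt a * (\<Sum>j<n. c j * ?Y \<omega> j)))"
        using null AE_space
      proof eventually_elim
        case (elim \<omega>)
        note P = prob_algebra_D[OF dirichlet_process_D(4)[OF D] elim(2)]
        interpret P: prob_space "P a \<omega>" by (rule P(1))
        define y where "y j = measure (P a \<omega>) (?C j)" for j
        have cdf: "measure (P a \<omega>) {0..real i / real n} = (\<Sum>j<i. y j)" if "i \<le> n" for i
        proof (cases "i = 0")
          case True
          with elim(1) show ?thesis by simp
        next
          case False
          have "disjoint_family_on ?C {..<i}" using C(2) that by (elim disjoint_family_on_mono[rotated]) auto
          then have "measure (P a \<omega>) (\<Union>j<i. ?C j) = (\<Sum>j<i. y j)"
            unfolding y_def using C(1) P(2) by (intro P.finite_measure_finite_Union) auto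
          with C(5)[of i] False that show ?thesis by simp
        qed
        have "(\<Sum>j<n. y j) = 1"
          using cdf[of n] n P.prob_space P(3) by (simp add: space_unit_lebesgue)
        have "(\<Sum>i\<le>n. \<theta> i * (sqrt a * (measure (P a \<omega>) {0..real i / real n} - real i / real n)))
            = (\<Sum>i\<le>n. sqrt a * (\<theta> i * (\<Sum>j<i. y j) - \<theta> i * (real i / real n)))"
          by (intro sum.cong refl) (simp add: cdf algebra_simps)
        also have "\<dots> = sqrt a * ((\<Sum>j<n. d j * y j) - m * (\<Sum>j<n. y j))"
          by (simp only: sum_distrib_left[symmetric] sum_subtractf sum_d m_def \<open>(\<Sum>j<n. y j) = 1\<close> mult_1_right)
        also have "(\<Sum>j<n. d j * y j) - m * (\<Sum>j<n. y j) = (\<Sum>j<n. c j * ?Y \<omega> j)"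
          unfolding sum_distrib_left sum_subtractf[symmetric]
          by (intro sum.cong refl) (simp add: c_def y_def algebra_simps)
        finally show ?case by (simp only:)
      qed
    qed
    also have "\<dots> = (\<integral>y. exp (\<i> * of_real (sqrt a * (\<Sum>j<n. c j * y j))) \<partial>dirichlet {..<n} (\<lambda>j. a * p j))"
      unfolding part(2)[symmetric] by (rule integral_distr[OF part(1) em, symmetric])
    finally show ?thesis .
  qed
  then have "\<forall>\<^sub>F a in at_top. (\<integral>\<omega>. exp (\<i> * of_real (\<Sum>i\<le>n. \<theta> i * (sqrt a * (measure (P a \<omega>) {0..real i / real n} - real i / real n)))) \<partial>M a)
      = (\<integral>y. exp (\<i> * of_real (sqrt a * (\<Sum>j<n. c j * y j))) \<partial>dirichlet {..<n} (\<lambda>j. a * p j))"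
    by (rule eventually_mono[OF eventually_gt_at_top[of 0]])
  from tendsto_cong[OF this] lim show ?thesis by (simp only: var)
qed

section \<open>A multivariate continuity theorem\<close>

definition gauss_kernel :: "nat set \<Rightarrow> real \<Rightarrow> (nat \<Rightarrow> real) \<Rightarrow> (nat \<Rightarrow> real) \<Rightarrow> real" where
  "gauss_kernel I \<sigma> v z = (\<Prod>j\<in>I. normal_density (v j) \<sigma> (z j))"

context
  fixes I :: "nat set" and \<sigma> :: real
  assumes I: "finite I" and \<sigma>: "\<sigma> > 0"
begin

interpretation L: product_sigma_finite "\<lambda>_::nat. lborel :: real measure" by standard

lemma gauss_kernel_nonneg: "0 \<le> gauss_kernel I \<sigma> v z"
  unfolding gauss_kernel_def by (intro prod_nonneg) (simp add: normal_density_nonneg)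

lemma gauss_kernel_integrable: "integrable (Pi\<^sub>M I (\<lambda>_. lborel)) (gauss_kernel I \<sigma> v)"
  unfolding gauss_kernel_def using I \<sigma> by (intro L.product_integrable_prod) auto

lemma gauss_kernel_integral: "(\<integral>z. gauss_kernel I \<sigma> v z \<partial>Pi\<^sub>M I (\<lambda>_. lborel)) = 1"
  unfolding gauss_kernel_def using I \<sigma> by (subst L.product_integral_prod) auto

lemma gauss_kernel_moment:
  assumes k: "k \<in> I"
  shows "integrable (Pi\<^sub>M I (\<lambda>_. lborel)) (\<lambda>z. \<bar>z k - v k\<bar> * gauss_kernel I \<sigma> v z)"
    and "(\<integral>z. \<bar>z k - v k\<bar> * gauss_kernel I \<sigma> v z \<partial>Pi\<^sub>M I (\<lambda>_. lborel)) \<le> \<sigma>"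
proof -
  \<comment> \<open>The exponent 0 or 1 puts the weight into coordinate \<open>k\<close> alone, so
    that the integrand remains a product.\<close>
  define f where "f j x = normal_density (v j) \<sigma> x * \<bar>x - v j\<bar> ^ (if j = k then 1 else 0)" for j x
  have f: "integrable lborel (f j)" for j
    unfolding f_def by (rule integrable_normal_moment_abs[OF \<sigma>])
  have eq: "\<bar>z k - v k\<bar> * gauss_kernel I \<sigma> v z = (\<Prod>j\<in>I. f j (z j))" for z
    unfolding gauss_kernel_def f_def using I k by (simp add: prod.remove[of I k] mult_ac)
  show "integrable (Pi\<^sub>M I (\<lambda>_. lborel)) (\<lambda>z. \<bar>z k - v k\<bar> * gauss_kernel I \<sigma> v z)"
    unfolding eq using I f by (intro L.product_integrable_prod) auto
  have fk: "integral\<^sup>L lborel (f k) \<le> \<sigma>"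
  proof -
    have "integral\<^sup>L lborel (f k) = \<sigma> * sqrt (2 / pi)"
      using integral_normal_moment_abs_odd[OF \<sigma>, of "v k" 0] by (simp add: f_def[abs_def])
    also have "\<dots> \<le> \<sigma> * 1"
      using \<sigma> pi_gt3 by (intro mult_left_mono) (auto simp: real_sqrt_le_1_iff)
    finally show ?thesis by simp
  qed
  have "(\<integral>z. \<bar>z k - v k\<bar> * gauss_kernel I \<sigma> v z \<partial>Pi\<^sub>M I (\<lambda>_. lborel)) = (\<Prod>j\<in>I. integral\<^sup>L lborel (f j))"
    unfolding eq using I f by (intro L.product_integral_prod) auto
  also have "\<dots> = integral\<^sup>L lborel (f k) * (\<Prod>j\<in>I - {k}. integral\<^sup>L lborel (f j))"
    using I k by (rule prod.remove)
  also have "(\<Prod>j\<in>I - {k}. integral\<^sup>L lborel (f j)) = 1"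
    using \<sigma> by (intro prod.neutral) (auto simp: f_def[abs_def])
  finally show "(\<integral>z. \<bar>z k - v k\<bar> * gauss_kernel I \<sigma> v z \<partial>Pi\<^sub>M I (\<lambda>_. lborel)) \<le> \<sigma>" using fk by simp
qed

lemma sets_PiM_lborel: "sets (Pi\<^sub>M I (\<lambda>_. lborel :: real measure)) = sets (Pi\<^sub>M I (\<lambda>_. borel))"
  by (intro sets_PiM_cong) auto

lemma gauss_kernel_bounded_integrable:
  assumes g: "g \<in> borel_measurable (Pi\<^sub>M I (\<lambda>_. borel))" and C: "\<And>z. z \<in> space (Pi\<^sub>M I (\<lambda>_. borel)) \<Longrightarrow> \<bar>g z\<bar> \<le> C"
  shows "integrable (Pi\<^sub>M I (\<lambda>_. lborel)) (\<lambda>z. g z * gauss_kernel I \<sigma> v z)"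
proof (rule Bochner_Integration.integrable_bound)
  show "integrable (Pi\<^sub>M I (\<lambda>_. lborel)) (\<lambda>z. C * gauss_kernel I \<sigma> v z)"
    using gauss_kernel_integrable by simp
  have "g \<in> borel_measurable (Pi\<^sub>M I (\<lambda>_. lborel))"
    using g unfolding measurable_cong_sets[OF sets_PiM_lborel refl] .
  then show "(\<lambda>z. g z * gauss_kernel I \<sigma> v z) \<in> borel_measurable (Pi\<^sub>M I (\<lambda>_. lborel))"
    by (intro borel_measurable_times borel_measurable_integrable[OF gauss_kernel_integrable])
  show "AE z in Pi\<^sub>M I (\<lambda>_. lborel). norm (g z * gauss_kernel I \<sigma> v z) \<le> norm (C * gauss_kernel I \<sigma> v z)"
  proof (rule AE_I2)
    fix z assume "z \<in> space (Pi\<^sub>M I (\<lambda>_. lborel :: real measure))"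
    then have "\<bar>g z\<bar> \<le> C" using sets_eq_imp_space_eq[OF sets_PiM_lborel] by (intro C) simp
    then have "\<bar>g z\<bar> \<le> \<bar>C\<bar>" by linarith
    then show "norm (g z * gauss_kernel I \<sigma> v z) \<le> norm (C * gauss_kernel I \<sigma> v z)"
      by (simp add: abs_mult mult_right_mono)
  qed
qed

lemma gauss_kernel_Lipschitz:
  assumes g: "g \<in> borel_measurable (Pi\<^sub>M I (\<lambda>_. borel))" and C: "\<And>z. z \<in> space (Pi\<^sub>M I (\<lambda>_. borel)) \<Longrightarrow> \<bar>g z\<bar> \<le> C"
    and lip: "\<And>x y. x \<in> space (Pi\<^sub>M I (\<lambda>_. borel)) \<Longrightarrow> y \<in> space (Pi\<^sub>M I (\<lambda>_. borel)) \<Longrightarrow>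
        \<bar>g x - g y\<bar> \<le> B * (\<Sum>j\<in>I. \<bar>x j - y j\<bar>)"
    and B: "B \<ge> 0" and v: "v \<in> space (Pi\<^sub>M I (\<lambda>_. borel))"
  shows "\<bar>g v - (\<integral>z. g z * gauss_kernel I \<sigma> v z \<partial>Pi\<^sub>M I (\<lambda>_. lborel))\<bar> \<le> B * card I * \<sigma>"
proof -
  let ?L = "Pi\<^sub>M I (\<lambda>_. lborel :: real measure)" and ?K = "gauss_kernel I \<sigma> v"
  have sp: "space ?L = space (Pi\<^sub>M I (\<lambda>_. borel))" by (rule sets_eq_imp_space_eq[OF sets_PiM_lborel])
  have i1: "integrable ?L (\<lambda>z. g v * ?K z)" using gauss_kernel_integrable by simp
  note i2 = gauss_kernel_bounded_integrable[OF g C, of v]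
  have iM: "integrable ?L (\<lambda>z. B * (\<Sum>j\<in>I. \<bar>z j - v j\<bar> * ?K z))"
    by (intro Bochner_Integration.integrable_mult_right Bochner_Integration.integrable_sum gauss_kernel_moment)
  have "g v - (\<integral>z. g z * ?K z \<partial>?L) = (\<integral>z. g v * ?K z - g z * ?K z \<partial>?L)"
    using i1 i2 gauss_kernel_integral by (subst Bochner_Integration.integral_diff) auto
  also have "\<bar>\<dots>\<bar> \<le> (\<integral>z. \<bar>g v * ?K z - g z * ?K z\<bar> \<partial>?L)" by (rule integral_abs_bound)
  also have "\<dots> \<le> (\<integral>z. B * (\<Sum>j\<in>I. \<bar>z j - v j\<bar> * ?K z) \<partial>?L)"
  proof (rule integral_mono)
    show "integrable ?L (\<lambda>z. \<bar>g v * ?K z - g z * ?K z\<bar>)"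
      by (rule integrable_abs[OF Bochner_Integration.integrable_diff[OF i1 i2]])
    fix z assume "z \<in> space ?L"
    then have "\<bar>g z - g v\<bar> \<le> B * (\<Sum>j\<in>I. \<bar>z j - v j\<bar>)" using v sp by (intro lip) auto
    then have "\<bar>g z - g v\<bar> * ?K z \<le> B * (\<Sum>j\<in>I. \<bar>z j - v j\<bar>) * ?K z"
      using gauss_kernel_nonneg by (rule mult_right_mono)
    moreover have "\<bar>g v * ?K z - g z * ?K z\<bar> = \<bar>g z - g v\<bar> * ?K z"
      unfolding left_diff_distrib[symmetric] abs_mult using gauss_kernel_nonneg[of v z] by (simp add: abs_minus_commute)
    ultimately show "\<bar>g v * ?K z - g z * ?K z\<bar> \<le> B * (\<Sum>j\<in>I. \<bar>z j - v j\<bar> * ?K z)"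
      by (simp only: sum_distrib_right mult.assoc)
  qed (rule iM)
  also have "\<dots> = B * (\<Sum>j\<in>I. \<integral>z. \<bar>z j - v j\<bar> * ?K z \<partial>?L)"
    by (simp add: gauss_kernel_moment(1))
  also have "\<dots> \<le> B * (\<Sum>j\<in>I. \<sigma>)"
    using B by (intro mult_left_mono sum_mono gauss_kernel_moment(2))
  finally show ?thesis by (simp add: mult_ac)
qed

text \<open>Up to scaling the normal density is its own characteristic function. The frequency
  \<open>u\<close> is therefore averaged over a probability law, which makes Fubini and dominated
  convergence available with the bound 1.\<close>

lemma gauss_kernel_Fourier:
  "of_real (gauss_kernel I \<sigma> v z) = of_real ((1 / (\<sigma> * sqrt (2 * pi))) ^ card I) *
     (\<integral>u. (\<Prod>j\<in>I. exp (\<i> * of_real (u j * ((z j - v j) / \<sigma>)))) \<partial>Pi\<^sub>M I (\<lambda>_. std_normal_distribution))"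
proof -
  interpret std: prob_space std_normal_distribution by (rule prob_space_normal_density) simp
  interpret S: product_sigma_finite "\<lambda>_::nat. std_normal_distribution" by standard
  have nd: "of_real (normal_density (v j) \<sigma> (z j)) = of_real (1 / (\<sigma> * sqrt (2 * pi))) *
     (\<integral>x. exp (\<i> * of_real (x * ((z j - v j) / \<sigma>))) \<partial>std_normal_distribution)" for j
  proof -
    have "(\<integral>x. exp (\<i> * of_real (x * ((z j - v j) / \<sigma>))) \<partial>std_normal_distribution)
        = char std_normal_distribution ((z j - v j) / \<sigma>)"
      by (simp add: char_def mult_ac)
    also have "\<dots> = of_real (exp (- (((z j - v j) / \<sigma>)\<^sup>2) / 2))"
      by (simp only: char_std_normal_distribution)
    finally show ?thesis
      using \<sigma> by (simp add: normal_density_def real_sqrt_mult power_divide mult_ac)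
  qed
  have int: "integrable std_normal_distribution (\<lambda>x. exp (\<i> * of_real (x * c)))" for c
    by (intro std.integrable_const_bound[of _ 1]) auto
  have "of_real (gauss_kernel I \<sigma> v z) = (\<Prod>j\<in>I. of_real (1 / (\<sigma> * sqrt (2 * pi))) *
     (\<integral>x. exp (\<i> * of_real (x * ((z j - v j) / \<sigma>))) \<partial>std_normal_distribution))"
    unfolding gauss_kernel_def of_real_prod by (intro prod.cong refl nd)
  also have "\<dots> = of_real ((1 / (\<sigma> * sqrt (2 * pi))) ^ card I) *
     (\<Prod>j\<in>I. \<integral>x. exp (\<i> * of_real (x * ((z j - v j) / \<sigma>))) \<partial>std_normal_distribution)"
    by (simp only: prod.distrib prod_constant of_real_power)
  also have "(\<Prod>j\<in>I. \<integral>x. exp (\<i> * of_real (x * ((z j - v j) / \<sigma>))) \<partial>std_normal_distribution) =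
     (\<integral>u. (\<Prod>j\<in>I. exp (\<i> * of_real (u j * ((z j - v j) / \<sigma>)))) \<partial>Pi\<^sub>M I (\<lambda>_. std_normal_distribution))"
    by (rule S.product_integral_prod[OF I int, symmetric])
  finally show ?thesis .
qed

context
  fixes Q :: "'w measure" and V :: "'w \<Rightarrow> nat \<Rightarrow> real"
  assumes Q: "prob_space Q" and V: "V \<in> measurable Q (Pi\<^sub>M I (\<lambda>_. borel))"
begin

interpretation Q: prob_space Q by (rule Q)
interpretation LI: sigma_finite_measure "Pi\<^sub>M I (\<lambda>_. lborel :: real measure)"
  by (rule L.sigma_finite[OF I])
interpretation QL: pair_sigma_finite Q "Pi\<^sub>M I (\<lambda>_. lborel :: real measure)" by standard

lemma V_measurable: "j \<in> I \<Longrightarrow> (\<lambda>\<omega>. V \<omega> j) \<in> borel_measurable Q"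
  using measurable_compose[OF V measurable_component_singleton] .

lemma gauss_kernel_measurable:
  "(\<lambda>(\<omega>, z). gauss_kernel I \<sigma> (V \<omega>) z) \<in> borel_measurable (Q \<Otimes>\<^sub>M Pi\<^sub>M I (\<lambda>_. lborel))"
proof -
  have "(\<lambda>x. normal_density (V (fst x) j) \<sigma> (snd x j)) \<in> borel_measurable (Q \<Otimes>\<^sub>M Pi\<^sub>M I (\<lambda>_. lborel))"
    if j: "j \<in> I" for j
  proof -
    have [measurable]: "(\<lambda>x. V (fst x) j) \<in> borel_measurable (Q \<Otimes>\<^sub>M Pi\<^sub>M I (\<lambda>_. lborel :: real measure))"
      by (rule measurable_compose[OF measurable_fst V_measurable[OF j]])
    have "(\<lambda>x. snd x j) \<in> measurable (Q \<Otimes>\<^sub>M Pi\<^sub>M I (\<lambda>_. lborel :: real measure)) lborel"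
      by (rule measurable_compose[OF measurable_snd measurable_component_singleton[OF j]])
    then have [measurable]: "(\<lambda>x. snd x j) \<in> borel_measurable (Q \<Otimes>\<^sub>M Pi\<^sub>M I (\<lambda>_. lborel :: real measure))" by simp
    show ?thesis unfolding normal_density_def by measurable
  qed
  then show ?thesis unfolding gauss_kernel_def split_beta' by (intro borel_measurable_prod)
qed

text \<open>The density of \<open>V + \<sigma> * Z\<close>, where \<open>Z\<close> is a standard
  Gaussian vector independent of \<open>V\<close>.\<close>

definition smoothed_density :: "(nat \<Rightarrow> real) \<Rightarrow> real" where
  "smoothed_density z = (\<integral>\<omega>. gauss_kernel I \<sigma> (V \<omega>) z \<partial>Q)"

lemma smoothed_density_nonneg: "0 \<le> smoothed_density z"
  unfolding smoothed_density_def by (intro Bochner_Integration.integral_nonneg gauss_kernel_nonneg)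

lemma smoothed_density_Fubini:
  assumes g: "g \<in> borel_measurable (Pi\<^sub>M I (\<lambda>_. borel))" and C: "\<And>z. z \<in> space (Pi\<^sub>M I (\<lambda>_. borel)) \<Longrightarrow> \<bar>g z\<bar> \<le> C"
  shows "integrable (Pi\<^sub>M I (\<lambda>_. lborel)) (\<lambda>z. g z * smoothed_density z)"
    and "integrable Q (\<lambda>\<omega>. \<integral>z. g z * gauss_kernel I \<sigma> (V \<omega>) z \<partial>Pi\<^sub>M I (\<lambda>_. lborel))"
    and "(\<integral>\<omega>. (\<integral>z. g z * gauss_kernel I \<sigma> (V \<omega>) z \<partial>Pi\<^sub>M I (\<lambda>_. lborel)) \<partial>Q) =
      (\<integral>z. g z * smoothed_density z \<partial>Pi\<^sub>M I (\<lambda>_. lborel))"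
proof -
  let ?L = "Pi\<^sub>M I (\<lambda>_. lborel :: real measure)"
  have sp: "space ?L = space (Pi\<^sub>M I (\<lambda>_. borel))" by (rule sets_eq_imp_space_eq[OF sets_PiM_lborel])
  have gL: "g \<in> borel_measurable ?L" using g unfolding measurable_cong_sets[OF sets_PiM_lborel refl] .
  have m: "(\<lambda>(\<omega>, z). g z * gauss_kernel I \<sigma> (V \<omega>) z) \<in> borel_measurable (Q \<Otimes>\<^sub>M ?L)"
    using borel_measurable_times[OF measurable_compose[OF measurable_snd gL] gauss_kernel_measurable]
    by (simp add: split_beta')
  have int: "integrable (Q \<Otimes>\<^sub>M ?L) (\<lambda>(\<omega>, z). g z * gauss_kernel I \<sigma> (V \<omega>) z)"
  proof (rule QL.Fubini_integrable[OF m])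
    show "AE \<omega> in Q. integrable ?L (\<lambda>z. case (\<omega>, z) of (\<omega>, z) \<Rightarrow> g z * gauss_kernel I \<sigma> (V \<omega>) z)"
      using gauss_kernel_bounded_integrable[OF g C] by simp
    have mm: "(\<lambda>\<omega>. \<integral>z. norm (case (\<omega>, z) of (\<omega>, z) \<Rightarrow> g z * gauss_kernel I \<sigma> (V \<omega>) z) \<partial>?L) \<in> borel_measurable Q"
      by (rule LI.borel_measurable_lebesgue_integral) (use m in \<open>simp add: split_beta'\<close>)
    show "integrable Q (\<lambda>\<omega>. \<integral>z. norm (case (\<omega>, z) of (\<omega>, z) \<Rightarrow> g z * gauss_kernel I \<sigma> (V \<omega>) z) \<partial>?L)"
    proof (rule Q.integrable_const_bound[OF _ mm, of C], rule AE_I2)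
      fix \<omega>
      have "(\<integral>z. \<bar>g z * gauss_kernel I \<sigma> (V \<omega>) z\<bar> \<partial>?L) \<le> (\<integral>z. C * gauss_kernel I \<sigma> (V \<omega>) z \<partial>?L)"
      proof (rule integral_mono)
        show "integrable ?L (\<lambda>z. \<bar>g z * gauss_kernel I \<sigma> (V \<omega>) z\<bar>)"
          by (intro integrable_abs gauss_kernel_bounded_integrable[OF g C])
        show "integrable ?L (\<lambda>z. C * gauss_kernel I \<sigma> (V \<omega>) z)" using gauss_kernel_integrable by simp
        fix z assume "z \<in> space ?L"
        then have "\<bar>g z\<bar> \<le> C" using sp by (intro C) simp
        then show "\<bar>g z * gauss_kernel I \<sigma> (V \<omega>) z\<bar> \<le> C * gauss_kernel I \<sigma> (V \<omega>) z"
          using gauss_kernel_nonneg[of "V \<omega>" z] by (simp add: abs_mult mult_right_mono)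
      qed
      also have "\<dots> = C" by (simp add: gauss_kernel_integral)
      finally show "norm (\<integral>z. norm (case (\<omega>, z) of (\<omega>, z) \<Rightarrow> g z * gauss_kernel I \<sigma> (V \<omega>) z) \<partial>?L) \<le> C" by simp
    qed
  qed
  show "integrable ?L (\<lambda>z. g z * smoothed_density z)"
    using QL.integrable_snd[OF int] by (simp add: smoothed_density_def)
  show "integrable Q (\<lambda>\<omega>. \<integral>z. g z * gauss_kernel I \<sigma> (V \<omega>) z \<partial>?L)"
    using QL.integrable_fst[OF int] by simp
  show "(\<integral>\<omega>. (\<integral>z. g z * gauss_kernel I \<sigma> (V \<omega>) z \<partial>?L) \<partial>Q) = (\<integral>z. g z * smoothed_density z \<partial>?L)"
    using QL.Fubini_integral[OF int] by (simp add: smoothed_density_def)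
qed

lemma smoothed_density_integral:
  "integrable (Pi\<^sub>M I (\<lambda>_. lborel)) smoothed_density"
  "(\<integral>z. smoothed_density z \<partial>Pi\<^sub>M I (\<lambda>_. lborel)) = 1"
  using smoothed_density_Fubini[of "\<lambda>_. 1" 1] Q.prob_space by (simp_all add: gauss_kernel_integral)

text \<open>The law of \<open>V\<close> enters only through its characteristic function, so
  convergence of characteristic functions carries over. The integrability statement also provides
  the measurability of the integrand in \<open>u\<close> for that limit.\<close>

lemma smoothed_density_Fourier:
  "integrable (Pi\<^sub>M I (\<lambda>_. std_normal_distribution)) (\<lambda>u. (\<Prod>j\<in>I. exp (\<i> * of_real (u j * (z j / \<sigma>)))) *
       (\<integral>\<omega>. exp (\<i> * of_real (\<Sum>j\<in>I. (- u j / \<sigma>) * V \<omega> j)) \<partial>Q))"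
  "of_real (smoothed_density z) = of_real ((1 / (\<sigma> * sqrt (2 * pi))) ^ card I) *
    (\<integral>u. (\<Prod>j\<in>I. exp (\<i> * of_real (u j * (z j / \<sigma>)))) *
       (\<integral>\<omega>. exp (\<i> * of_real (\<Sum>j\<in>I. (- u j / \<sigma>) * V \<omega> j)) \<partial>Q) \<partial>Pi\<^sub>M I (\<lambda>_. std_normal_distribution))"
proof -
  let ?N = "Pi\<^sub>M I (\<lambda>_. std_normal_distribution)"
  interpret std: prob_space std_normal_distribution by (rule prob_space_normal_density) simp
  interpret N: prob_space ?N by (intro prob_space_PiM) (rule std.prob_space_axioms)
  interpret QN: pair_prob_space Q ?N by standard
  have split: "(\<Prod>j\<in>I. exp (\<i> * of_real (u j * ((z j - v j) / \<sigma>)))) =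
      (\<Prod>j\<in>I. exp (\<i> * of_real (u j * (z j / \<sigma>)))) * exp (\<i> * of_real (\<Sum>j\<in>I. (- u j / \<sigma>) * v j))" for u v
    unfolding of_real_sum sum_distrib_left exp_sum[OF I] prod.distrib[symmetric] exp_add[symmetric]
    by (intro prod.cong refl arg_cong[where f=exp]) (simp add: diff_divide_distrib algebra_simps)
  have m: "(\<lambda>(\<omega>, u). \<Prod>j\<in>I. exp (\<i> * of_real (u j * ((z j - V \<omega> j) / \<sigma>)))) \<in> borel_measurable (Q \<Otimes>\<^sub>M ?N)"
  proof -
    have "(\<lambda>x. exp (\<i> * of_real (snd x j * ((z j - V (fst x) j) / \<sigma>)))) \<in> borel_measurable (Q \<Otimes>\<^sub>M ?N)"
      if j: "j \<in> I" for j
    proof -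
      have [measurable]: "(\<lambda>x. V (fst x) j) \<in> borel_measurable (Q \<Otimes>\<^sub>M ?N)"
        by (rule measurable_compose[OF measurable_fst V_measurable[OF j]])
      have "(\<lambda>x. snd x j) \<in> measurable (Q \<Otimes>\<^sub>M ?N) std_normal_distribution"
        by (rule measurable_compose[OF measurable_snd measurable_component_singleton[OF j]])
      then have [measurable]: "(\<lambda>x. snd x j) \<in> borel_measurable (Q \<Otimes>\<^sub>M ?N)" by simp
      show ?thesis by measurable
    qed
    then show ?thesis unfolding split_beta' by (intro borel_measurable_prod)
  qed
  have int: "integrable (Q \<Otimes>\<^sub>M ?N) (\<lambda>(\<omega>, u). \<Prod>j\<in>I. exp (\<i> * of_real (u j * ((z j - V \<omega> j) / \<sigma>))))"
    by (rule QN.integrable_const_bound[OF _ m, of 1]) (auto simp: prod_norm[symmetric])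
  show "integrable ?N (\<lambda>u. (\<Prod>j\<in>I. exp (\<i> * of_real (u j * (z j / \<sigma>)))) *
       (\<integral>\<omega>. exp (\<i> * of_real (\<Sum>j\<in>I. (- u j / \<sigma>) * V \<omega> j)) \<partial>Q))"
    using QN.integrable_snd[OF int] unfolding split by (simp only: integral_mult_right_zero)
  have "complex_of_real (smoothed_density z) = (\<integral>\<omega>. of_real (gauss_kernel I \<sigma> (V \<omega>) z) \<partial>Q)"
    unfolding smoothed_density_def by (rule integral_complex_of_real[symmetric])
  also have "\<dots> = of_real ((1 / (\<sigma> * sqrt (2 * pi))) ^ card I) *
     (\<integral>\<omega>. \<integral>u. (\<Prod>j\<in>I. exp (\<i> * of_real (u j * ((z j - V \<omega> j) / \<sigma>)))) \<partial>?N \<partial>Q)"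
    unfolding gauss_kernel_Fourier by (rule integral_mult_right_zero)
  also have "(\<integral>\<omega>. \<integral>u. (\<Prod>j\<in>I. exp (\<i> * of_real (u j * ((z j - V \<omega> j) / \<sigma>)))) \<partial>?N \<partial>Q) =
      (\<integral>u. \<integral>\<omega>. (\<Prod>j\<in>I. exp (\<i> * of_real (u j * ((z j - V \<omega> j) / \<sigma>)))) \<partial>Q \<partial>?N)"
    by (rule QN.Fubini_integral[OF int, symmetric])
  also have "\<dots> = (\<integral>u. (\<Prod>j\<in>I. exp (\<i> * of_real (u j * (z j / \<sigma>)))) *
       (\<integral>\<omega>. exp (\<i> * of_real (\<Sum>j\<in>I. (- u j / \<sigma>) * V \<omega> j)) \<partial>Q) \<partial>?N)"
    unfolding split by (simp only: integral_mult_right_zero)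
  finally show "of_real (smoothed_density z) = of_real ((1 / (\<sigma> * sqrt (2 * pi))) ^ card I) *
    (\<integral>u. (\<Prod>j\<in>I. exp (\<i> * of_real (u j * (z j / \<sigma>)))) *
       (\<integral>\<omega>. exp (\<i> * of_real (\<Sum>j\<in>I. (- u j / \<sigma>) * V \<omega> j)) \<partial>Q) \<partial>?N)" .
qed

text \<open>Smoothing moves each coordinate by at most \<open>\<sigma>\<close> in the mean. The
  estimate is the same for every law of \<open>V\<close>, so one width serves a whole sequence and
  its limit.\<close>

lemma smoothed_density_approx:
  assumes g: "g \<in> borel_measurable (Pi\<^sub>M I (\<lambda>_. borel))" and C: "\<And>z. z \<in> space (Pi\<^sub>M I (\<lambda>_. borel)) \<Longrightarrow> \<bar>g z\<bar> \<le> C"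
    and lip: "\<And>x y. x \<in> space (Pi\<^sub>M I (\<lambda>_. borel)) \<Longrightarrow> y \<in> space (Pi\<^sub>M I (\<lambda>_. borel)) \<Longrightarrow>
        \<bar>g x - g y\<bar> \<le> B * (\<Sum>j\<in>I. \<bar>x j - y j\<bar>)"
    and B: "B \<ge> 0"
  shows "\<bar>(\<integral>\<omega>. g (V \<omega>) \<partial>Q) - (\<integral>z. g z * smoothed_density z \<partial>Pi\<^sub>M I (\<lambda>_. lborel))\<bar> \<le> B * card I * \<sigma>"
proof -
  let ?G = "\<lambda>\<omega>. \<integral>z. g z * gauss_kernel I \<sigma> (V \<omega>) z \<partial>Pi\<^sub>M I (\<lambda>_. lborel)"
  have Vs: "V \<omega> \<in> space (Pi\<^sub>M I (\<lambda>_. borel))" if "\<omega> \<in> space Q" for \<omega>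
    using measurable_space[OF V that] .
  have i1: "integrable Q (\<lambda>\<omega>. g (V \<omega>))"
    using C Vs by (intro Q.integrable_const_bound[of _ C] AE_I2 measurable_compose[OF V g]) auto
  note i2 = smoothed_density_Fubini(2)[OF g C]
  have "(\<integral>\<omega>. g (V \<omega>) \<partial>Q) - (\<integral>z. g z * smoothed_density z \<partial>Pi\<^sub>M I (\<lambda>_. lborel)) = (\<integral>\<omega>. g (V \<omega>) - ?G \<omega> \<partial>Q)"
    using i1 i2 by (simp add: smoothed_density_Fubini(3)[OF g C])
  also have "\<bar>\<dots>\<bar> \<le> (\<integral>\<omega>. \<bar>g (V \<omega>) - ?G \<omega>\<bar> \<partial>Q)" by (rule integral_abs_bound)
  also have "\<dots> \<le> (\<integral>\<omega>. B * card I * \<sigma> \<partial>Q)"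
  proof (rule integral_mono)
    show "integrable Q (\<lambda>\<omega>. \<bar>g (V \<omega>) - ?G \<omega>\<bar>)"
      by (rule integrable_abs[OF Bochner_Integration.integrable_diff[OF i1 i2]])
    show "\<bar>g (V \<omega>) - ?G \<omega>\<bar> \<le> B * card I * \<sigma>" if "\<omega> \<in> space Q" for \<omega>
      by (rule gauss_kernel_Lipschitz[OF g C lip B Vs[OF that]])
  qed simp
  finally show ?thesis using Q.prob_space by simp
qed

end

end

text \<open>Convolution with a narrow Gaussian kernel turns pointwise convergence of the characteristic
  functions into pointwise, hence \<open>L\<^sup>1\<close>, convergence of densities.\<close>

theorem multivariate_Levy_Lipschitz:
  fixes Q :: "nat \<Rightarrow> 'w measure" and V :: "nat \<Rightarrow> 'w \<Rightarrow> nat \<Rightarrow> real" and R :: "'v measure"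
  assumes I: "finite I"
    and Q: "\<And>n. prob_space (Q n)" "\<And>n. V n \<in> measurable (Q n) (Pi\<^sub>M I (\<lambda>_. borel))"
    and R: "prob_space R" "W \<in> measurable R (Pi\<^sub>M I (\<lambda>_. borel))"
    and char: "\<And>\<theta>. (\<lambda>n. \<integral>\<omega>. exp (\<i> * of_real (\<Sum>j\<in>I. \<theta> j * V n \<omega> j)) \<partial>Q n)
        \<longlonglongrightarrow> (\<integral>\<omega>. exp (\<i> * of_real (\<Sum>j\<in>I. \<theta> j * W \<omega> j)) \<partial>R)"
    and g: "g \<in> borel_measurable (Pi\<^sub>M I (\<lambda>_. borel))" and C: "\<And>z. z \<in> space (Pi\<^sub>M I (\<lambda>_. borel)) \<Longrightarrow> \<bar>g z\<bar> \<le> C"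
    and lip: "\<And>x y. x \<in> space (Pi\<^sub>M I (\<lambda>_. borel)) \<Longrightarrow> y \<in> space (Pi\<^sub>M I (\<lambda>_. borel)) \<Longrightarrow>
        \<bar>g x - g y\<bar> \<le> B * (\<Sum>j\<in>I. \<bar>x j - y j\<bar>)"
    and B: "B \<ge> 0"
  shows "(\<lambda>n. \<integral>\<omega>. g (V n \<omega>) \<partial>Q n) \<longlonglongrightarrow> (\<integral>\<omega>. g (W \<omega>) \<partial>R)"
proof (rule tendstoI)
  fix e :: real assume e: "e > 0"
  \<comment> \<open>The width makes each of the two smoothing errors at most \<open>e / 4\<close>;
    the \<open>+ 1\<close> avoids division by zero.\<close>
  define \<sigma> where "\<sigma> = e / (4 * (B * card I + 1))"
  have pos: "B * card I + 1 > 0" using B by (simp add: add_nonneg_pos)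
  have \<sigma>: "\<sigma> > 0" using e pos by (simp add: \<sigma>_def)
  have small: "B * card I * \<sigma> \<le> e / 4"
  proof -
    have "X * (e / (4 * X)) = e / 4" if "X > 0" for X :: real using that by simp
    from this[OF pos] have "(B * card I + 1) * \<sigma> = e / 4" by (simp only: \<sigma>_def)
    then show ?thesis using \<sigma> by (simp add: distrib_right)
  qed
  let ?L = "Pi\<^sub>M I (\<lambda>_. lborel :: real measure)" and ?N = "Pi\<^sub>M I (\<lambda>_. std_normal_distribution)"
  define h where "h n = smoothed_density I \<sigma> (Q n) (V n)" for n
  define k where "k = smoothed_density I \<sigma> R W"
  have sp: "space ?L = space (Pi\<^sub>M I (\<lambda>_. borel))" by (rule sets_eq_imp_space_eq[OF sets_PiM_lborel[OF I \<sigma>]])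
  note h_int = smoothed_density_integral[OF I \<sigma> Q, folded h_def]
  note k_int = smoothed_density_integral[OF I \<sigma> R, folded k_def]
  note h_pos = smoothed_density_nonneg[OF I \<sigma> Q, folded h_def]
  note k_pos = smoothed_density_nonneg[OF I \<sigma> R, folded k_def]
  have conv: "(\<lambda>n. h n z) \<longlonglongrightarrow> k z" for z
  proof -
    interpret std: prob_space std_normal_distribution by (rule prob_space_normal_density) simp
    interpret N: prob_space ?N by (intro prob_space_PiM) (rule std.prob_space_axioms)
    let ?E = "\<lambda>u. \<Prod>j\<in>I. exp (\<i> * complex_of_real (u j * (z j / \<sigma>)))"
    let ?f = "\<lambda>n u. ?E u * (\<integral>\<omega>. exp (\<i> * of_real (\<Sum>j\<in>I. (- u j / \<sigma>) * V n \<omega> j)) \<partial>Q n)"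
    let ?fk = "\<lambda>u. ?E u * (\<integral>\<omega>. exp (\<i> * of_real (\<Sum>j\<in>I. (- u j / \<sigma>) * W \<omega> j)) \<partial>R)"
    have bound: "norm (?f n u) \<le> 1" for n u
    proof -
      interpret Qn: prob_space "Q n" by (rule Q)
      have "norm (\<integral>\<omega>. exp (\<i> * of_real (\<Sum>j\<in>I. (- u j / \<sigma>) * V n \<omega> j)) \<partial>Q n)
          \<le> (\<integral>\<omega>. norm (exp (\<i> * of_real (\<Sum>j\<in>I. (- u j / \<sigma>) * V n \<omega> j))) \<partial>Q n)"
        by (rule integral_norm_bound)
      also have "\<dots> = 1" using Qn.prob_space by (simp del: of_real_sum)
      finally show ?thesis by (simp add: norm_mult prod_norm[symmetric] del: of_real_sum of_real_mult)
    qed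
    have "(\<lambda>n. \<integral>u. ?f n u \<partial>?N) \<longlonglongrightarrow> (\<integral>u. ?fk u \<partial>?N)"
    proof (rule integral_dominated_convergence[where w="\<lambda>_. 1"])
      show "?fk \<in> borel_measurable ?N"
        by (rule borel_measurable_integrable[OF smoothed_density_Fourier(1)[OF I \<sigma> R]])
      show "?f n \<in> borel_measurable ?N" for n
        by (rule borel_measurable_integrable[OF smoothed_density_Fourier(1)[OF I \<sigma> Q]])
      show "AE u in ?N. (\<lambda>n. ?f n u) \<longlonglongrightarrow> ?fk u"
        by (intro AE_I2 tendsto_mult tendsto_const char)
      show "AE u in ?N. norm (?f n u) \<le> 1" for n using bound by (intro AE_I2)
    qed simp
    then have "(\<lambda>n. complex_of_real (h n z)) \<longlonglongrightarrow> complex_of_real (k z)"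
      unfolding h_def k_def smoothed_density_Fourier(2)[OF I \<sigma> Q] smoothed_density_Fourier(2)[OF I \<sigma> R]
      by (intro tendsto_mult tendsto_const)
    then show ?thesis by (simp only: tendsto_of_real_iff)
  qed
  have dm: "(\<lambda>n. \<integral>z. max 0 (k z - h n z) \<partial>?L) \<longlonglongrightarrow> (\<integral>z. 0 \<partial>?L)"
  proof (rule integral_dominated_convergence[where w=k])
    show "AE z in ?L. (\<lambda>n. max 0 (k z - h n z)) \<longlonglongrightarrow> 0"
    proof (rule AE_I2)
      fix z
      have "(\<lambda>n. max 0 (k z - h n z)) \<longlonglongrightarrow> max 0 (k z - k z)"
        by (intro tendsto_max tendsto_const tendsto_diff conv)
      then show "(\<lambda>n. max 0 (k z - h n z)) \<longlonglongrightarrow> 0" by simp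
    qed
    show "AE z in ?L. norm (max 0 (k z - h n z)) \<le> k z" for n
      using h_pos k_pos by (intro AE_I2) (simp add: max_def)
    show "(\<lambda>z. max 0 (k z - h n z)) \<in> borel_measurable ?L" for n
      using borel_measurable_integrable[OF h_int(1)] borel_measurable_integrable[OF k_int(1)] by measurable
  qed (use k_int in auto)
  \<comment> \<open>Scheffe's argument: both densities have integral 1, so the positive and negative
    parts of \<open>h n - k\<close> have equal integrals. Only the part
    \<open>max 0 (k - h n)\<close> has to vanish, and it is dominated by \<open>k\<close>.\<close>
  have L1: "(\<integral>z. \<bar>h n z - k z\<bar> \<partial>?L) = 2 * (\<integral>z. max 0 (k z - h n z) \<partial>?L)" for n
  proof -
    have "integrable ?L (\<lambda>z. max 0 (k z - h n z))"
      by (intro integrable_max Bochner_Integration.integrable_diff h_int k_int) simp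
    moreover have "\<bar>h n z - k z\<bar> = 2 * max 0 (k z - h n z) + (h n z - k z)" for z by (simp add: max_def)
    ultimately show ?thesis using h_int[of n] k_int by simp
  qed
  define K where "K = \<bar>C\<bar> + 1"
  have K: "K > 0" by (simp add: K_def)
  have diff: "\<bar>(\<integral>z. g z * h n z \<partial>?L) - (\<integral>z. g z * k z \<partial>?L)\<bar> \<le> 2 * K * (\<integral>z. max 0 (k z - h n z) \<partial>?L)" for n
  proof -
    have i1: "integrable ?L (\<lambda>z. g z * h n z)"
      unfolding h_def by (rule smoothed_density_Fubini(1)[OF I \<sigma> Q g C])
    have i2: "integrable ?L (\<lambda>z. g z * k z)"
      unfolding k_def by (rule smoothed_density_Fubini(1)[OF I \<sigma> R g C])
    have "(\<integral>z. g z * h n z \<partial>?L) - (\<integral>z. g z * k z \<partial>?L) = (\<integral>z. g z * h n z - g z * k z \<partial>?L)"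
      using i1 i2 by simp
    also have "\<bar>\<dots>\<bar> \<le> (\<integral>z. \<bar>g z * h n z - g z * k z\<bar> \<partial>?L)" by (rule integral_abs_bound)
    also have "\<dots> \<le> (\<integral>z. K * \<bar>h n z - k z\<bar> \<partial>?L)"
    proof (rule integral_mono)
      show "integrable ?L (\<lambda>z. \<bar>g z * h n z - g z * k z\<bar>)"
        by (rule integrable_abs[OF Bochner_Integration.integrable_diff[OF i1 i2]])
      show "integrable ?L (\<lambda>z. K * \<bar>h n z - k z\<bar>)"
        by (intro Bochner_Integration.integrable_mult_right integrable_abs Bochner_Integration.integrable_diff h_int k_int)
      fix z assume "z \<in> space ?L"
      then have "\<bar>g z\<bar> \<le> K" using C[of z] sp by (simp add: K_def)
      then show "\<bar>g z * h n z - g z * k z\<bar> \<le> K * \<bar>h n z - k z\<bar>"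
        by (simp add: right_diff_distrib[symmetric] abs_mult mult_right_mono del: right_diff_distrib)
    qed
    also have "\<dots> = 2 * K * (\<integral>z. max 0 (k z - h n z) \<partial>?L)" by (simp add: L1)
    finally show ?thesis .
  qed
  have "\<forall>\<^sub>F n in sequentially. (\<integral>z. max 0 (k z - h n z) \<partial>?L) < e / (4 * K)"
    using dm e K by (intro order_tendstoD(2)[OF dm]) simp
  then show "\<forall>\<^sub>F n in sequentially. dist (\<integral>\<omega>. g (V n \<omega>) \<partial>Q n) (\<integral>\<omega>. g (W \<omega>) \<partial>R) < e"
  proof eventually_elim
    case (elim n)
    then have "2 * K * (\<integral>z. max 0 (k z - h n z) \<partial>?L) < e / 2"
      using K by (simp add: pos_less_divide_eq mult_ac)
    moreover have "\<bar>(\<integral>\<omega>. g (V n \<omega>) \<partial>Q n) - (\<integral>z. g z * h n z \<partial>?L)\<bar> \<le> e / 4"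
      unfolding h_def by (rule order_trans[OF smoothed_density_approx[OF I \<sigma> Q g C lip B] small])
    moreover have "\<bar>(\<integral>\<omega>. g (W \<omega>) \<partial>R) - (\<integral>z. g z * k z \<partial>?L)\<bar> \<le> e / 4"
      unfolding k_def by (rule order_trans[OF smoothed_density_approx[OF I \<sigma> R g C lip B] small])
    ultimately show ?case using diff[of n] unfolding dist_real_def by linarith
  qed
qed

section \<open>Linear combinations of the Brownian bridge\<close>

text \<open>The degenerate case is separated because it has no density; otherwise everything follows
  from the standard normal law by scaling.\<close>

lemma gaussian_centered:
  assumes M: "prob_space M" and X: "gaussian M X"
  shows "integrable M X" "integrable M (\<lambda>\<omega>. (X \<omega>)\<^sup>2)"
    and "(\<integral>\<omega>. X \<omega> \<partial>M) = 0 \<Longrightarrow> (\<integral>\<omega>. exp (\<i> * of_real (X \<omega>)) \<partial>M) = of_real (exp (- (\<integral>\<omega>. (X \<omega>)\<^sup>2 \<partial>M) / 2))"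
proof -
  interpret prob_space M by (rule M)
  have Xm: "X \<in> borel_measurable M" using X by (simp add: gaussian_def)
  have "integrable M X \<and> integrable M (\<lambda>\<omega>. (X \<omega>)\<^sup>2) \<and>
    ((\<integral>\<omega>. X \<omega> \<partial>M) = 0 \<longrightarrow> (\<integral>\<omega>. exp (\<i> * of_real (X \<omega>)) \<partial>M) = of_real (exp (- (\<integral>\<omega>. (X \<omega>)\<^sup>2 \<partial>M) / 2)))"
  proof (cases "\<exists>\<mu>. AE \<omega> in M. X \<omega> = \<mu>")
    case True
    then obtain \<mu> where \<mu>: "AE \<omega> in M. X \<omega> = \<mu>" ..
    \<comment> \<open>In the degenerate case every Borel function of \<open>X\<close> is almost
      surely constant. One statement, polymorphic in the range, covers the identity, the square and
      the complex exponential.\<close>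
    have f: "integrable M (\<lambda>\<omega>. f (X \<omega>)) \<and> (\<integral>\<omega>. f (X \<omega>) \<partial>M) = f \<mu>"
      if f: "f \<in> borel_measurable borel" for f :: "real \<Rightarrow> 'b::{banach, second_countable_topology}"
    proof
      have m: "(\<lambda>\<omega>. f (X \<omega>)) \<in> borel_measurable M" by (rule measurable_compose[OF Xm f])
      have ae: "AE \<omega> in M. f (X \<omega>) = f \<mu>" using \<mu> by eventually_elim simp
      show "integrable M (\<lambda>\<omega>. f (X \<omega>))"
        by (subst integrable_cong_AE[OF m _ ae]) auto
      have "(\<integral>\<omega>. f (X \<omega>) \<partial>M) = (\<integral>\<omega>. f \<mu> \<partial>M)" by (rule integral_cong_AE[OF m _ ae]) simp
      then show "(\<integral>\<omega>. f (X \<omega>) \<partial>M) = f \<mu>" using prob_space by simp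
    qed
    show ?thesis
      using f[of "\<lambda>x. x"] f[of "\<lambda>x. x\<^sup>2"] f[of "\<lambda>x. exp (\<i> * of_real x)"] by simp
  next
    case False
    then obtain \<mu> \<sigma> where \<sigma>: "\<sigma> > 0" and D: "distributed M lborel X (\<lambda>x. ennreal (normal_density \<mu> \<sigma> x))"
      using X by (auto simp: gaussian_def)
    have i1: "integrable M X"
      using integrable_normal_moment_nz_1[OF \<sigma>, of \<mu>] distributed_integrable[OF D, of "\<lambda>x. x"]
      by (simp add: normal_density_nonneg)
    have i2c: "integrable M (\<lambda>\<omega>. (X \<omega> - \<mu>)\<^sup>2)"
      using integrable_normal_moment[OF \<sigma>, of \<mu> 2] distributed_integrable[OF D, of "\<lambda>x. (x - \<mu>)\<^sup>2"]
      by (simp add: normal_density_nonneg)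
    have "integrable M (\<lambda>\<omega>. (X \<omega> - \<mu>)\<^sup>2 + 2 * \<mu> * X \<omega> - \<mu>\<^sup>2)"
      using i1 i2c by simp
    moreover have "(\<lambda>\<omega>. (X \<omega> - \<mu>)\<^sup>2 + 2 * \<mu> * X \<omega> - \<mu>\<^sup>2) = (\<lambda>\<omega>. (X \<omega>)\<^sup>2)"
      by (simp add: fun_eq_iff power2_eq_square algebra_simps)
    ultimately have i2: "integrable M (\<lambda>\<omega>. (X \<omega>)\<^sup>2)" by simp
    have "(\<integral>\<omega>. exp (\<i> * of_real (X \<omega>)) \<partial>M) = of_real (exp (- (\<integral>\<omega>. (X \<omega>)\<^sup>2 \<partial>M) / 2))"
      if mean: "(\<integral>\<omega>. X \<omega> \<partial>M) = 0"
    proof -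
      have \<mu>: "\<mu> = 0" using normal_distributed_expectation[OF \<sigma> D] mean by simp
      have var: "(\<integral>\<omega>. (X \<omega>)\<^sup>2 \<partial>M) = \<sigma>\<^sup>2"
        using normal_distributed_variance[OF \<sigma> D] mean by simp
      have "distributed M lborel (\<lambda>\<omega>. X \<omega> / \<sigma>) std_normal_density"
        using normal_standard_normal_convert[OF \<sigma>, of X \<mu>] D \<mu> by simp
      then have "distr M lborel (\<lambda>\<omega>. X \<omega> / \<sigma>) = std_normal_distribution"
        by (simp add: distributed_def)
      moreover have "distr M borel (\<lambda>\<omega>. X \<omega> / \<sigma>) = distr M lborel (\<lambda>\<omega>. X \<omega> / \<sigma>)"
        by (rule distr_cong) auto
      ultimately have d: "distr M borel (\<lambda>\<omega>. X \<omega> / \<sigma>) = std_normal_distribution" by simp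
      have "char std_normal_distribution \<sigma> = (\<integral>\<omega>. exp (\<i> * of_real (\<sigma> * (X \<omega> / \<sigma>))) \<partial>M)"
        unfolding d[symmetric] char_def using Xm by (subst integral_distr) auto
      then show ?thesis using \<sigma> by (simp add: char_std_normal_distribution var)
    qed
    with i1 i2 show ?thesis by blast
  qed
  then show "integrable M X" "integrable M (\<lambda>\<omega>. (X \<omega>)\<^sup>2)"
    "(\<integral>\<omega>. X \<omega> \<partial>M) = 0 \<Longrightarrow> (\<integral>\<omega>. exp (\<i> * of_real (X \<omega>)) \<partial>M) = of_real (exp (- (\<integral>\<omega>. (X \<omega>)\<^sup>2 \<partial>M) / 2))"
    by blast+
qed

text \<open>A linear combination is centred Gaussian, so only its variance is needed. Products of
  coordinates are integrable since
  \<open>\<bar>x * y\<bar> \<le> x\<^sup>2 + y\<^sup>2\<close>.\<close>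

lemma brownian_bridge_char:
  assumes B: "brownian_bridge N B" and S: "finite S" "S \<subseteq> {0..1}"
  shows "(\<integral>\<omega>. exp (\<i> * of_real (\<Sum>t\<in>S. c t * B t \<omega>)) \<partial>N) =
    of_real (exp (- (\<Sum>s\<in>S. \<Sum>t\<in>S. c s * c t * (min s t - s * t)) / 2))"
proof -
  have N: "prob_space N" and G: "\<And>S c. finite S \<Longrightarrow> S \<subseteq> {0..1} \<Longrightarrow> gaussian N (\<lambda>\<omega>. \<Sum>t\<in>S. c t * B t \<omega>)"
    and mean: "\<And>t. t \<in> {0..1} \<Longrightarrow> (\<integral>\<omega>. B t \<omega> \<partial>N) = 0"
    and cov0: "\<And>s t. s \<in> {0..1} \<Longrightarrow> t \<in> {0..1} \<Longrightarrow>
        (\<integral>\<omega>. (B s \<omega> - (\<integral>\<omega>'. B s \<omega>' \<partial>N)) * (B t \<omega> - (\<integral>\<omega>'. B t \<omega>' \<partial>N)) \<partial>N) = min s t - s * t"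
    using B unfolding brownian_bridge_def gaussian_process_def by blast+
  interpret prob_space N by (rule N)
  have cov: "(\<integral>\<omega>. B s \<omega> * B t \<omega> \<partial>N) = min s t - s * t" if "s \<in> {0..1}" "t \<in> {0..1}" for s t
    using cov0[OF that] by (simp only: mean that diff_zero)
  have G1: "gaussian N (B t)" if "t \<in> {0..1}" for t
    using G[of "{t}" "\<lambda>_. 1"] that by simp
  note int = gaussian_centered(1,2)[OF N G1]
  have int2: "integrable N (\<lambda>\<omega>. B s \<omega> * B t \<omega>)" if "s \<in> {0..1}" "t \<in> {0..1}" for s t
  proof (rule Bochner_Integration.integrable_bound)
    show "integrable N (\<lambda>\<omega>. (B s \<omega>)\<^sup>2 + (B t \<omega>)\<^sup>2)" using int that by simp
    show "(\<lambda>\<omega>. B s \<omega> * B t \<omega>) \<in> borel_measurable N"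
      using int(1)[OF that(1)] int(1)[OF that(2)] by (intro borel_measurable_times borel_measurable_integrable)
    have "\<bar>x * y\<bar> \<le> x\<^sup>2 + y\<^sup>2" for x y :: real
    proof -
      have "0 \<le> (\<bar>x\<bar> - \<bar>y\<bar>)\<^sup>2" by simp
      then have "2 * (\<bar>x\<bar> * \<bar>y\<bar>) \<le> x\<^sup>2 + y\<^sup>2" by (simp add: power2_diff)
      moreover have "0 \<le> \<bar>x\<bar> * \<bar>y\<bar>" by simp
      ultimately show ?thesis unfolding abs_mult by linarith
    qed
    then show "AE \<omega> in N. norm (B s \<omega> * B t \<omega>) \<le> norm ((B s \<omega>)\<^sup>2 + (B t \<omega>)\<^sup>2)" by simp
  qed
  have "(\<integral>\<omega>. (\<Sum>t\<in>S. c t * B t \<omega>)\<^sup>2 \<partial>N) = (\<integral>\<omega>. (\<Sum>s\<in>S. \<Sum>t\<in>S. c s * c t * (B s \<omega> * B t \<omega>)) \<partial>N)"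
    by (simp add: power2_eq_square sum_product mult_ac)
  also have "\<dots> = (\<Sum>s\<in>S. \<Sum>t\<in>S. c s * c t * (\<integral>\<omega>. B s \<omega> * B t \<omega> \<partial>N))"
  proof -
    have "integrable N (\<lambda>\<omega>. c s * c t * (B s \<omega> * B t \<omega>))" if "s \<in> S" "t \<in> S" for s t
      using that S by (intro Bochner_Integration.integrable_mult_right int2) blast+
    then show ?thesis by (simp add: Bochner_Integration.integral_sum)
  qed
  also have "\<dots> = (\<Sum>s\<in>S. \<Sum>t\<in>S. c s * c t * (min s t - s * t))"
    using S by (intro sum.cong refl arg_cong2[where f="(*)"] cov) auto
  finally have var: "(\<integral>\<omega>. (\<Sum>t\<in>S. c t * B t \<omega>)\<^sup>2 \<partial>N) = \<dots>" .
  have "(\<integral>\<omega>. (\<Sum>t\<in>S. c t * B t \<omega>) \<partial>N) = (\<Sum>t\<in>S. c t * (\<integral>\<omega>. B t \<omega> \<partial>N))"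
    using int(1) S by (subst Bochner_Integration.integral_sum) auto
  also have "\<dots> = 0" using mean S by (intro sum.neutral) auto
  finally show ?thesis
    using gaussian_centered(3)[OF N G[OF S, of c]] by (simp only: var)
qed

lemma brownian_bridge_grid_char:
  assumes B: "brownian_bridge N B" and n: "n > 0"
  shows "(\<integral>\<omega>. exp (\<i> * of_real (\<Sum>i\<le>n. \<theta> i * B (real i / real n) \<omega>)) \<partial>N) =
    of_real (exp (- (\<Sum>i\<le>n. \<Sum>k\<le>n. \<theta> i * \<theta> k *
        (min (real i / real n) (real k / real n) - real i / real n * (real k / real n))) / 2))"
proof -
  let ?t = "\<lambda>i. real i / real n"
  have inj: "inj_on ?t {..n}" using n by (auto simp: inj_on_def)
  \<comment> \<open>Gaussian processes are tested on finite sets of times; the weights on grid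
    indices are carried over along the injection from indices to times.\<close>
  define c where "c t = \<theta> (the_inv_into {..n} ?t t)" for t
  have c: "c (?t i) = \<theta> i" if "i \<in> {..n}" for i
    unfolding c_def using the_inv_into_f_f[OF inj that] by simp
  have S: "finite (?t ` {..n})" "?t ` {..n} \<subseteq> {0..1}" using n by auto
  have "(\<Sum>t\<in>?t ` {..n}. c t * B t \<omega>) = (\<Sum>i\<le>n. \<theta> i * B (?t i) \<omega>)" for \<omega>
    unfolding sum.reindex[OF inj] o_def by (intro sum.cong refl) (simp only: c)
  moreover have "(\<Sum>s\<in>?t ` {..n}. \<Sum>t\<in>?t ` {..n}. c s * c t * (min s t - s * t)) =
      (\<Sum>i\<le>n. \<Sum>k\<le>n. \<theta> i * \<theta> k * (min (?t i) (?t k) - ?t i * ?t k))"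
    unfolding sum.reindex[OF inj] o_def by (intro sum.cong refl) (simp only: c)
  ultimately show ?thesis using brownian_bridge_char[OF B S, of c] by (simp only:)
qed

section \<open>Dyadic chaining\<close>

text \<open>Lets value vectors be taken in the product space over \<open>{..n}\<close>, whose
  elements are undefined at other indices.\<close>

lemma step_path_restrict: "step_path n (restrict v {..n}) = step_path n v"
proof
  fix t :: real
  show "step_path n (restrict v {..n}) t = step_path n v t"
  proof (cases "t \<in> {0..1}")
    case True
    then have "real n * t \<le> real n * 1" by (intro mult_left_mono) auto
    then have "nat \<lfloor>real n * t\<rfloor> \<le> n" by linarith
    then show ?thesis using True by (simp add: step_path_def)
  next
    case False
    then show ?thesis unfolding step_path_def restrict_apply by (simp only: if_False)
  qed
qed

lemma step_path_measurable:
  assumes n: "n > 0"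
  shows "step_path n \<in> measurable (Pi\<^sub>M {..n} (\<lambda>_. borel)) (borel_of skorokhod_topology)"
proof (rule measurable_skorokhod)
  fix t :: real assume t: "t \<in> {0..1}"
  then have "real n * t \<le> real n * 1" by (intro mult_left_mono) auto
  then have i: "nat \<lfloor>real n * t\<rfloor> \<in> {..n}" unfolding atMost_iff by linarith
  have "(\<lambda>v. step_path n v t) = (\<lambda>v. v (nat \<lfloor>real n * t\<rfloor>))" using t by (simp add: step_path_def)
  then show "(\<lambda>v. step_path n v t) \<in> borel_measurable (Pi\<^sub>M {..n} (\<lambda>_. borel))"
    using measurable_component_singleton[OF i, of "\<lambda>_. borel :: real measure"] by simp
qed (rule step_path_cadlag[OF n])

text \<open>Makes a Lipschitz function of the step path a Lipschitz function of the value vector in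
  the l1 norm, the form asked for by \<open>multivariate_Levy_Lipschitz\<close>.\<close>

lemma skorokhod_dist_step_path_le:
  assumes n: "n > 0"
  shows "skorokhod_dist (step_path n v) (step_path n w) \<le> (\<Sum>j\<le>n. \<bar>v j - w j\<bar>)"
proof (rule skorokhod_dist_sup[OF step_path_cadlag[OF n] step_path_cadlag[OF n]])
  fix t :: real assume t: "t \<in> {0..1}"
  then have "real n * t \<le> real n * 1" by (intro mult_left_mono) auto
  then have i: "nat \<lfloor>real n * t\<rfloor> \<in> {..n}" unfolding atMost_iff by linarith
  have "\<bar>v (nat \<lfloor>real n * t\<rfloor>) - w (nat \<lfloor>real n * t\<rfloor>)\<bar> \<le> (\<Sum>j\<le>n. \<bar>v j - w j\<bar>)"
    using i by (intro member_le_sum) auto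
  then show "\<bar>step_path n v t - step_path n w t\<bar> \<le> (\<Sum>j\<le>n. \<bar>v j - w j\<bar>)"
    using t by (simp add: step_path_def)
qed

text \<open>Young's inequality with exponents 4 and 4/3; \<open>q\<close> is the size of
  \<open>\<bar>y\<bar>\<close> for which it is sharp.\<close>

lemma young_4:
  fixes y q :: real
  assumes "q > 0"
  shows "\<bar>y\<bar> \<le> (y ^ 4 / q ^ 3 + 3 * q) / 4"
proof -
  \<comment> \<open>The polynomial \<open>y ^ 4 + 3 * q ^ 4 - 4 * y * q ^ 3\<close> has a double
    root at \<open>y = q\<close>.\<close>
  have "0 \<le> (\<bar>y\<bar> - q)\<^sup>2 * (\<bar>y\<bar>\<^sup>2 + 2 * \<bar>y\<bar> * q + 3 * q\<^sup>2)" using assms by simp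
  also have "\<dots> = \<bar>y\<bar> ^ 4 + 3 * q ^ 4 - 4 * \<bar>y\<bar> * q ^ 3" by (simp add: power2_eq_square power4_eq_xxxx power3_eq_cube algebra_simps)
  also have "\<bar>y\<bar> ^ 4 = y ^ 4" by (simp add: power_even_abs)
  finally have "4 * \<bar>y\<bar> * q ^ 3 \<le> y ^ 4 + 3 * q * q ^ 3" by (simp add: power4_eq_xxxx power3_eq_cube)
  then have "4 * \<bar>y\<bar> \<le> (y ^ 4 + 3 * q * q ^ 3) / q ^ 3" using assms by (simp add: pos_le_divide_eq)
  also have "\<dots> = y ^ 4 / q ^ 3 + 3 * q" using assms by (simp add: add_divide_distrib)
  finally show ?thesis by simp
qed

text \<open>Consecutive dyadic truncations of \<open>t\<close> either coincide or are neighbours on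
  the finer grid, so each level contributes at most one increment.\<close>

lemma dyadic_chain:
  fixes x :: "real \<Rightarrow> real" and t :: real
  assumes R: "\<And>k i. m < k \<Longrightarrow> k \<le> K \<Longrightarrow> i < 2 ^ k \<Longrightarrow> \<bar>x (real (Suc i) / 2 ^ k) - x (real i / 2 ^ k)\<bar> \<le> R k"
    and mK: "m \<le> K" and t: "t \<in> {0..1}"
  shows "\<bar>x (of_int \<lfloor>2 ^ K * t\<rfloor> / 2 ^ K) - x (of_int \<lfloor>2 ^ m * t\<rfloor> / 2 ^ m)\<bar> \<le> (\<Sum>k\<in>{m<..K}. R k)"
  using mK R
proof (induction K rule: dec_induct)
  case base
  then show ?case by simp
next
  case (step K)
  have IH: "\<bar>x (of_int \<lfloor>2 ^ K * t\<rfloor> / 2 ^ K) - x (of_int \<lfloor>2 ^ m * t\<rfloor> / 2 ^ m)\<bar> \<le> (\<Sum>k\<in>{m<..K}. R k)"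
    using step.prems by (intro step.IH) simp
  have incr: "\<bar>x (of_int \<lfloor>2 ^ Suc K * t\<rfloor> / 2 ^ Suc K) - x (of_int \<lfloor>2 ^ K * t\<rfloor> / 2 ^ K)\<bar> \<le> R (Suc K)"
  proof -
    define f where "f = \<lfloor>2 ^ K * t\<rfloor>"
    have f0: "0 \<le> f" using t by (simp add: f_def)
    have same: "of_int (2 * f) / 2 ^ Suc K = (of_int f / 2 ^ K :: real)" by simp
    have "\<lfloor>2 ^ Suc K * t\<rfloor> = 2 * f \<or> \<lfloor>2 ^ Suc K * t\<rfloor> = 2 * f + 1"
      unfolding f_def power_Suc mult.assoc by linarith
    then show ?thesis
    proof
      assume eq: "\<lfloor>2 ^ Suc K * t\<rfloor> = 2 * f"
      have "0 \<le> R (Suc K)" using step.prems[of "Suc K" 0] step.hyps by fastforce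
      then show ?thesis unfolding eq same f_def[symmetric] by simp
    next
      assume eq: "\<lfloor>2 ^ Suc K * t\<rfloor> = 2 * f + 1"
      \<comment> \<open>Because \<open>t \<le> 1\<close>, the even index \<open>2 * f\<close> is
        below \<open>2 ^ Suc K\<close>, the range in which increments are controlled.\<close>
      have "2 ^ Suc K * t \<le> 2 ^ Suc K * 1" using t by (intro mult_left_mono) auto
      then have "\<lfloor>2 ^ Suc K * t\<rfloor> \<le> \<lfloor>2 ^ Suc K :: real\<rfloor>" by (intro floor_mono) simp
      also have "\<lfloor>2 ^ Suc K :: real\<rfloor> = 2 ^ Suc K" using floor_of_int[of "2 ^ Suc K"] by (simp only: of_int_power of_int_numeral)
      finally have "2 * f + 1 \<le> 2 ^ Suc K" unfolding eq .
      then have "2 * nat f < 2 ^ Suc K" using f0 by (simp add: nat_less_iff zless_nat_eq_int_zless flip: of_nat_less_iff[where 'a=int])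
      then have "\<bar>x (real (Suc (2 * nat f)) / 2 ^ Suc K) - x (real (2 * nat f) / 2 ^ Suc K)\<bar> \<le> R (Suc K)"
        using step.hyps by (intro step.prems) auto
      moreover have "real (2 * nat f) = of_int (2 * f)" "real (Suc (2 * nat f)) = of_int (2 * f + 1)" using f0 by simp_all
      ultimately show ?thesis unfolding eq f_def[symmetric] same[symmetric] by (simp only:)
    qed
  qed
  have "{m<..Suc K} = insert (Suc K) {m<..K}" using step.hyps by auto
  then have "(\<Sum>k\<in>{m<..Suc K}. R k) = R (Suc K) + (\<Sum>k\<in>{m<..K}. R k)" by simp
  with IH incr show ?case by linarith
qed

text \<open>Below the finest dyadic level monotonicity of \<open>F\<close> replaces chaining.\<close>

lemma monotone_dyadic_bound:
  fixes F :: "real \<Rightarrow> real" and b t :: real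
  defines "x \<equiv> \<lambda>t. b * (F t - t)"
  assumes b: "b \<ge> 0" and F: "\<And>s t. 0 \<le> s \<Longrightarrow> s \<le> t \<Longrightarrow> t \<le> 1 \<Longrightarrow> F s \<le> F t"
    and R: "\<And>k i. m < k \<Longrightarrow> k \<le> K \<Longrightarrow> i < 2 ^ k \<Longrightarrow> \<bar>x (real (Suc i) / 2 ^ k) - x (real i / 2 ^ k)\<bar> \<le> R k"
    and mK: "m < K" and t: "t \<in> {0..1}"
  shows "\<bar>x t - x (of_int \<lfloor>2 ^ m * t\<rfloor> / 2 ^ m)\<bar> \<le> 2 * (\<Sum>k\<in>{m<..K}. R k) + b / 2 ^ K"
proof -
  have chain: "\<bar>x (of_int \<lfloor>2 ^ K * t\<rfloor> / 2 ^ K) - x (of_int \<lfloor>2 ^ m * t\<rfloor> / 2 ^ m)\<bar> \<le> (\<Sum>k\<in>{m<..K}. R k)"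
    using R mK t by (intro dyadic_chain) auto
  have Rpos: "0 \<le> R k" if "m < k" "k \<le> K" for k
    using R[OF that, of 0] abs_ge_zero order_trans by fastforce
  have RK: "R K \<le> (\<Sum>k\<in>{m<..K}. R k)" "0 \<le> R K"
    using mK Rpos[of K] by (auto intro!: member_le_sum Rpos)
  define i where "i = nat \<lfloor>2 ^ K * t\<rfloor>"
  have i: "real i = of_int \<lfloor>2 ^ K * t\<rfloor>" using t by (simp add: i_def)
  have lo: "real i / 2 ^ K \<le> t" unfolding i by (simp add: pos_divide_le_eq mult.commute)
  have hi: "t \<le> real (Suc i) / 2 ^ K"
  proof -
    have "2 ^ K * t \<le> real (Suc i)" using i by linarith
    then show ?thesis by (simp add: pos_le_divide_eq mult.commute)
  qed
  have "\<bar>x t - x (real i / 2 ^ K)\<bar> \<le> R K + b / 2 ^ K"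
  \<comment> \<open>At \<open>t = 1\<close> there is no cell to the right, but the truncation is
    exact.\<close>
  proof (cases "t = 1")
    case True
    have "\<lfloor>2 ^ K :: real\<rfloor> = 2 ^ K" using floor_of_int[of "2 ^ K"] by (simp only: of_int_power of_int_numeral)
    then have "real i / 2 ^ K = t" using True i by simp
    then show ?thesis using RK b by simp
  next
    case False
    then have "2 ^ K * t < 2 ^ K * 1" using t by (intro mult_strict_left_mono) auto
    then have "real i < 2 ^ K" using i by linarith
    then have "real i < real (2 ^ K)" by simp
    then have iK: "i < 2 ^ K" by (simp only: of_nat_less_iff)
    have s1: "real (Suc i) / 2 ^ K \<le> 1"
    proof -
      have "Suc i \<le> 2 ^ K" using iK by simp
      then have "real (Suc i) \<le> 2 ^ K" by (metis of_nat_le_iff of_nat_numeral of_nat_power)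
      then show ?thesis by simp
    qed
    let ?s = "real i / 2 ^ K" and ?u = "real (Suc i) / 2 ^ K"
    have us: "?u - ?s = 1 / 2 ^ K" by (simp add: diff_divide_distrib[symmetric])
    have "0 \<le> F t - F ?s" "F t \<le> F ?u" using lo hi s1 t by (auto intro!: F)
    then have F1: "0 \<le> b * (F t - F ?s)" "b * (F t - F ?s) \<le> b * (F ?u - F ?s)"
      using b by (auto intro!: mult_left_mono)
    have t1: "0 \<le> b * (t - ?s)" "b * (t - ?s) \<le> b * (1 / 2 ^ K)" "b * (?u - ?s) = b * (1 / 2 ^ K)"
      unfolding us[symmetric] using b lo hi by (auto intro!: mult_left_mono mult_nonneg_nonneg)
    have incr: "\<bar>b * (F ?u - F ?s) - b * (1 / 2 ^ K)\<bar> \<le> R K"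
      using R[OF mK order_refl iK] unfolding x_def t1(3)[symmetric] by (simp add: algebra_simps)
    \<comment> \<open>\<open>p\<close> and \<open>d\<close> are the scaled increments of
      \<open>F\<close> and of the drift up to \<open>t\<close>; \<open>A\<close> and
      \<open>h\<close> are those over the whole cell. Monotonicity gives
      \<open>p \<le> A \<le> h + r\<close>, so the difference of two nonnegative numbers stays below
      \<open>r + h\<close>.\<close>
    have arith: "\<bar>p - d\<bar> \<le> r + h" if "\<bar>A - h\<bar> \<le> r" "0 \<le> p" "p \<le> A" "0 \<le> d" "d \<le> h" "0 \<le> r" for A h p d r :: real
      using that by linarith
    have "x t - x ?s = b * (F t - F ?s) - b * (t - ?s)" by (simp add: x_def algebra_simps)
    with arith[OF incr F1 t1(1,2) RK(2)] show ?thesis by simp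
  qed
  \<comment> \<open>The factor 2 in front of the sum pays for the second use of
    \<open>R K\<close>.\<close>
  then show ?thesis using chain RK unfolding i by linarith
qed

section \<open>Fluctuations of the distribution function and their tightness\<close>

lemma scaled_cdf_cadlag:
  assumes Q: "prob_space Q" "sets Q = sets unit_lebesgue"
  shows "(\<lambda>t\<in>{0..1}. b * (measure Q {0..t} - measure unit_lebesgue {0..t})) \<in> cadlag"
proof -
  interpret Q: prob_space Q by (rule Q)
  have sp: "space Q = {0..1}" using sets_eq_imp_space_eq[OF Q(2)] by (simp add: space_unit_lebesgue)
  have m: "(\<lambda>x. x) \<in> borel_measurable Q"
    unfolding measurable_cong_sets[OF Q(2) refl] unit_lebesgue_def
    by (intro measurable_restrict_space1) simp
  \<comment> \<open>\<open>Q\<close> lives on the trace of the Borel sets on the unit interval. Its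
    image on the line is a real distribution, whose distribution function is right-continuous with
    left limits.\<close>
  define \<mu> where "\<mu> = distr Q borel (\<lambda>x. x)"
  interpret \<mu>: real_distribution \<mu>
    unfolding \<mu>_def by (intro Q.real_distribution_distr m)
  have cdf: "cdf \<mu> t = measure Q {0..t}" if "t \<in> {0..1}" for t
  proof -
    have "cdf \<mu> t = measure Q ((\<lambda>x. x) -` {..t} \<inter> space Q)"
      unfolding cdf_def \<mu>_def by (rule measure_distr[OF m]) simp
    also have "(\<lambda>x. x) -` {..t} \<inter> space Q = {0..t}" using that sp by auto
    finally show ?thesis .
  qed
  have "(\<lambda>t\<in>{0..1}. b * (measure Q {0..t} - measure unit_lebesgue {0..t})) = (\<lambda>t\<in>{0..1}. b * (cdf \<mu> t - t))"
    by (intro restrict_ext) (simp add: cdf measure_unit_lebesgue)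
  also have "\<dots> \<in> cadlag"
  proof (rule restrict_cadlag)
    fix t :: real
    have "(cdf \<mu> \<longlongrightarrow> cdf \<mu> t) (at_right t)"
      using \<mu>.cdf_is_right_cont[of t] by (simp add: continuous_within)
    then show "((\<lambda>t. b * (cdf \<mu> t - t)) \<longlongrightarrow> b * (cdf \<mu> t - t)) (at_right t)"
      by (intro tendsto_intros)
    have "((\<lambda>t. b * (cdf \<mu> t - t)) \<longlongrightarrow> b * (measure \<mu> {..<t} - t)) (at_left t)"
      by (intro tendsto_intros \<mu>.cdf_at_left)
    then show "\<exists>l. ((\<lambda>t. b * (cdf \<mu> t - t)) \<longlongrightarrow> l) (at_left t)" by blast
  qed
  finally show ?thesis .
qed

lemma Lipschitz_measurable:
  assumes "\<And>x y. x \<in> cadlag \<Longrightarrow> y \<in> cadlag \<Longrightarrow> \<bar>f x - f y\<bar> \<le> L * skorokhod_dist x y"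
  shows "f \<in> borel_measurable (borel_of skorokhod_topology)"
  using assms by (intro continuous_map_measurable skorokhod.Lipschitz_continuous_map)

context
  fixes M :: "real \<Rightarrow> 'w measure" and P :: "real \<Rightarrow> 'w \<Rightarrow> real measure"
  assumes DP: "\<And>a. a > 0 \<Longrightarrow> dirichlet_process (M a) a unit_lebesgue (P a)"
begin

definition fluctuation :: "real \<Rightarrow> 'w \<Rightarrow> real \<Rightarrow> real" where
  "fluctuation a \<omega> = (\<lambda>t\<in>{0..1}. sqrt a * (measure (P a \<omega>) {0..t} - measure unit_lebesgue {0..t}))"

lemma fluctuation_eq: "t \<in> {0..1} \<Longrightarrow> fluctuation a \<omega> t = sqrt a * (measure (P a \<omega>) {0..t} - t)"
  by (simp add: fluctuation_def measure_unit_lebesgue)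

lemma P_prob:
  assumes "a > 0" "\<omega> \<in> space (M a)"
  shows "prob_space (P a \<omega>)" "sets (P a \<omega>) = sets unit_lebesgue"
  using prob_algebra_D[OF dirichlet_process_D(4)[OF DP[OF assms(1)]] assms(2)] by auto

lemma fluctuation_cadlag: "a > 0 \<Longrightarrow> \<omega> \<in> space (M a) \<Longrightarrow> fluctuation a \<omega> \<in> cadlag"
  unfolding fluctuation_def by (intro scaled_cdf_cadlag P_prob)

lemma fluctuation_coordinate_measurable:
  assumes "a > 0" "t \<in> {0..1}"
  shows "(\<lambda>\<omega>. fluctuation a \<omega> t) \<in> borel_measurable (M a)"
proof -
  have "{0..t} \<in> sets unit_lebesgue" using assms by (auto simp: sets_unit_lebesgue)
  from dirichlet_process_measurable[OF DP[OF assms(1)] this] show ?thesis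
    unfolding fluctuation_eq[OF assms(2)] by measurable
qed

lemma fluctuation_measurable: "a > 0 \<Longrightarrow> fluctuation a \<in> measurable (M a) (borel_of skorokhod_topology)"
  by (intro measurable_skorokhod fluctuation_cadlag fluctuation_coordinate_measurable)

lemma fluctuation_grid_measurable:
  assumes "a > 0" "n > 0"
  shows "(\<lambda>\<omega>. \<lambda>i\<in>{..n}. fluctuation a \<omega> (real i / real n)) \<in> measurable (M a) (Pi\<^sub>M {..n} (\<lambda>_. borel))"
  using assms by (intro measurable_restrict fluctuation_coordinate_measurable) auto

lemma fluctuation_increment:
  assumes a: "a > 0" and \<omega>: "\<omega> \<in> space (M a)" and st: "0 \<le> s" "s \<le> t" "t \<le> 1"
  shows "fluctuation a \<omega> t - fluctuation a \<omega> s = sqrt a * (measure (P a \<omega>) {s<..t} - (t - s))"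
proof -
  interpret P: prob_space "P a \<omega>" by (rule P_prob(1)[OF a \<omega>])
  have "measure (P a \<omega>) ({0..t} - {0..s}) = measure (P a \<omega>) {0..t} - measure (P a \<omega>) {0..s}"
    using st by (intro P.finite_measure_Diff) (auto simp: P_prob(2)[OF a \<omega>] sets_unit_lebesgue)
  moreover have "{0..t} - {0..s} = {s<..t}" using st by auto
  ultimately have eq: "measure (P a \<omega>) {s<..t} = measure (P a \<omega>) {0..t} - measure (P a \<omega>) {0..s}" by simp
  have "s \<in> {0..1}" "t \<in> {0..1}" using st by auto
  then show ?thesis unfolding eq by (simp only: fluctuation_eq) (simp add: algebra_simps)
qed

lemma fluctuation_increment_moment:
  assumes a: "a > 0" and st: "0 \<le> s" "s < t" "t \<le> 1" "t - s < 1"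
  shows "integrable (M a) (\<lambda>\<omega>. (fluctuation a \<omega> t - fluctuation a \<omega> s) ^ 4)"
    and "(\<integral>\<omega>. (fluctuation a \<omega> t - fluctuation a \<omega> s) ^ 4 \<partial>M a) \<le> 3 * (t - s)\<^sup>2 + 6 * (t - s) / a"
proof -
  have eq: "(fluctuation a \<omega> t - fluctuation a \<omega> s) ^ 4 = (sqrt a * (measure (P a \<omega>) {s<..t} - (t - s))) ^ 4"
    if "\<omega> \<in> space (M a)" for \<omega>
    using fluctuation_increment[OF a that] st by simp
  have "integrable (M a) (\<lambda>\<omega>. (fluctuation a \<omega> t - fluctuation a \<omega> s) ^ 4) =
      integrable (M a) (\<lambda>\<omega>. (sqrt a * (measure (P a \<omega>) {s<..t} - (t - s))) ^ 4)"
    by (intro Bochner_Integration.integrable_cong refl eq)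
  then show "integrable (M a) (\<lambda>\<omega>. (fluctuation a \<omega> t - fluctuation a \<omega> s) ^ 4)"
    using dirichlet_increment_moment(1)[OF DP a st] by simp
  have "(\<integral>\<omega>. (fluctuation a \<omega> t - fluctuation a \<omega> s) ^ 4 \<partial>M a) =
      (\<integral>\<omega>. (sqrt a * (measure (P a \<omega>) {s<..t} - (t - s))) ^ 4 \<partial>M a)"
    by (intro Bochner_Integration.integral_cong refl eq)
  then show "(\<integral>\<omega>. (fluctuation a \<omega> t - fluctuation a \<omega> s) ^ 4 \<partial>M a) \<le> 3 * (t - s)\<^sup>2 + 6 * (t - s) / a"
    using dirichlet_increment_moment(2)[OF DP a st] by simp
qed

text \<open>Each level of the chain is bounded in \<open>L\<^sup>1\<close> by Young's inequality with the weight
  \<open>q ^ k\<close>, where \<open>q ^ 4 = 1 / 2\<close>, which is the size of the increments of level \<open>k\<close>.\<close>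

definition level_bound :: "real \<Rightarrow> real \<Rightarrow> nat \<Rightarrow> 'w \<Rightarrow> real" where
  "level_bound q a k \<omega> =
     ((\<Sum>i<2 ^ k. (fluctuation a \<omega> (real (Suc i) / 2 ^ k) - fluctuation a \<omega> (real i / 2 ^ k)) ^ 4) / (q ^ k) ^ 3 + 3 * q ^ k) / 4"

text \<open>The sum of all fourth powers stands in for the maximum over the level, so one random
  variable bounds all increments simultaneously.\<close>

lemma level_bound_increment:
  assumes q: "q > 0" and i: "i < 2 ^ k"
  shows "\<bar>fluctuation a \<omega> (real (Suc i) / 2 ^ k) - fluctuation a \<omega> (real i / 2 ^ k)\<bar> \<le> level_bound q a k \<omega>"
proof -
  let ?d = "\<lambda>i. fluctuation a \<omega> (real (Suc i) / 2 ^ k) - fluctuation a \<omega> (real i / 2 ^ k)"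
  have "?d i ^ 4 \<le> (\<Sum>i<2 ^ k. ?d i ^ 4)" using i by (intro member_le_sum) auto
  then have "(?d i ^ 4 / (q ^ k) ^ 3 + 3 * q ^ k) / 4 \<le> level_bound q a k \<omega>"
    unfolding level_bound_def using q by (intro divide_right_mono add_right_mono) auto
  with young_4[of "q ^ k" "?d i"] show ?thesis using q by (meson order_trans zero_less_power)
qed

text \<open>With \<open>h = 1 / 2 ^ k\<close> and \<open>1 / a \<le> h\<close>, each fourth moment
  is at most \<open>9 * h\<^sup>2\<close>, and the \<open>2 ^ k\<close> of them sum to
  \<open>9 * h = 9 * (q ^ k) ^ 4\<close>. Young's inequality then gives
  \<open>(9 + 3) / 4 = 3\<close> times \<open>q ^ k\<close>. The condition \<open>k > 0\<close>
  makes \<open>h < 1\<close>, as the moment bound demands.\<close>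

lemma level_bound_expectation:
  assumes q: "q > 0" "q ^ 4 = 1 / 2" and k: "k > 0" and a: "2 ^ k \<le> a"
  shows "integrable (M a) (level_bound q a k)" "(\<integral>\<omega>. level_bound q a k \<omega> \<partial>M a) \<le> 3 * q ^ k"
proof -
  have "0 < (2::real) ^ k" by simp
  then have a0: "a > 0" using a by linarith
  interpret prob_space "M a" by (rule dirichlet_process_D(1)[OF DP[OF a0]])
  let ?d = "\<lambda>i \<omega>. fluctuation a \<omega> (real (Suc i) / 2 ^ k) - fluctuation a \<omega> (real i / 2 ^ k)"
  define h where "h = (1 / 2 ^ k :: real)"
  have h: "h > 0" "h < 1" using k by (auto simp: h_def intro!: one_less_power)
  have step: "real (Suc i) / 2 ^ k - real i / 2 ^ k = h" for i
    by (simp add: h_def diff_divide_distrib[symmetric])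
  have "integrable (M a) (\<lambda>\<omega>. ?d i \<omega> ^ 4) \<and> (\<integral>\<omega>. ?d i \<omega> ^ 4 \<partial>M a) \<le> 9 * h\<^sup>2"
    if i: "i < 2 ^ k" for i
  proof -
    have "Suc i \<le> 2 ^ k" using i by simp
    then have "real (Suc i) \<le> 2 ^ k" by (metis of_nat_le_iff of_nat_numeral of_nat_power)
    then have s1: "real (Suc i) / 2 ^ k \<le> 1" by simp
    have s0: "0 \<le> real i / 2 ^ k" by simp
    have s2: "real i / 2 ^ k < real (Suc i) / 2 ^ k" "real (Suc i) / 2 ^ k - real i / 2 ^ k < 1"
      using step[of i] h by linarith+
    have "1 / a \<le> h" unfolding h_def using a by (intro divide_left_mono) (auto simp: a0)
    then have "6 * h * (1 / a) \<le> 6 * h * h" using h by (intro mult_left_mono) auto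
    then have "3 * h\<^sup>2 + 6 * h / a \<le> 9 * h\<^sup>2" by (simp add: power2_eq_square)
    with fluctuation_increment_moment[OF a0 s0 s2(1) s1 s2(2)] show ?thesis unfolding step by linarith
  qed
  then have d: "\<And>i. i < 2 ^ k \<Longrightarrow> integrable (M a) (\<lambda>\<omega>. ?d i \<omega> ^ 4)"
    "\<And>i. i < 2 ^ k \<Longrightarrow> (\<integral>\<omega>. ?d i \<omega> ^ 4 \<partial>M a) \<le> 9 * h\<^sup>2" by blast+
  have sum_int: "integrable (M a) (\<lambda>\<omega>. \<Sum>i<2 ^ k. ?d i \<omega> ^ 4)"
    by (intro Bochner_Integration.integrable_sum d) simp
  show "integrable (M a) (level_bound q a k)"
    unfolding level_bound_def using sum_int by (intro integrable_divide Bochner_Integration.integrable_add) auto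
  have "(\<integral>\<omega>. (\<Sum>i<2 ^ k. ?d i \<omega> ^ 4) \<partial>M a) = (\<Sum>i<2 ^ k. \<integral>\<omega>. ?d i \<omega> ^ 4 \<partial>M a)"
    by (intro Bochner_Integration.integral_sum d) simp
  also have "\<dots> \<le> (\<Sum>i<(2::nat) ^ k. 9 * h\<^sup>2)" by (intro sum_mono d) simp
  also have "\<dots> = 9 * h" by (simp add: h_def power2_eq_square)
  also have "h = (q ^ k) ^ 4"
  proof -
    have "(q ^ k) ^ 4 = (q ^ 4) ^ k" by (simp add: power_mult[symmetric] mult.commute)
    then show ?thesis by (simp add: q h_def power_one_over)
  qed
  finally have S: "(\<integral>\<omega>. (\<Sum>i<2 ^ k. ?d i \<omega> ^ 4) \<partial>M a) \<le> 9 * (q ^ k) ^ 4" .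
  have "(\<integral>\<omega>. level_bound q a k \<omega> \<partial>M a) = ((\<integral>\<omega>. (\<Sum>i<2 ^ k. ?d i \<omega> ^ 4) \<partial>M a) / (q ^ k) ^ 3 + 3 * q ^ k) / 4"
    unfolding level_bound_def using sum_int prob_space by (subst integral_divide_zero, subst Bochner_Integration.integral_add) auto
  also have "\<dots> \<le> (9 * (q ^ k) ^ 4 / (q ^ k) ^ 3 + 3 * q ^ k) / 4"
    using S q by (intro divide_right_mono add_right_mono) auto
  also have "9 * (q ^ k) ^ 4 / (q ^ k) ^ 3 = 9 * q ^ k"
    using q by (simp add: power_numeral_reduce)
  finally show "(\<integral>\<omega>. level_bound q a k \<omega> \<partial>M a) \<le> 3 * q ^ k" by simp
qed

text \<open>The bound already holds for the uniform distance: at \<open>t\<close> the step path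
  equals the fluctuation at the dyadic truncation of \<open>t\<close>.\<close>

lemma fluctuation_step_path_dist:
  assumes a: "a > 0" and \<omega>: "\<omega> \<in> space (M a)" and q: "q > 0" and mK: "m < K"
  shows "skorokhod_dist (fluctuation a \<omega>) (step_path (2 ^ m) (\<lambda>i. fluctuation a \<omega> (real i / real (2 ^ m))))
    \<le> 2 * (\<Sum>k\<in>{m<..K}. level_bound q a k \<omega>) + sqrt a / 2 ^ K"
proof (rule skorokhod_dist_sup[OF fluctuation_cadlag[OF a \<omega>] step_path_cadlag])
  show "0 < (2::nat) ^ m" by simp
  fix t :: real assume t: "t \<in> {0..1}"
  interpret P: prob_space "P a \<omega>" by (rule P_prob(1)[OF a \<omega>])
  define F where "F t = measure (P a \<omega>) {0..t}" for t
  have F: "F s \<le> F t" if "0 \<le> s" "s \<le> t" "t \<le> 1" for s t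
    unfolding F_def using that
    by (intro P.finite_measure_mono) (auto simp: P_prob(2)[OF a \<omega>] sets_unit_lebesgue)
  have x: "fluctuation a \<omega> t = sqrt a * (F t - t)" if "t \<in> {0..1}" for t
    using that by (simp add: fluctuation_eq F_def)
  define g where "g = of_int \<lfloor>2 ^ m * t\<rfloor> / (2 ^ m :: real)"
  have g: "g \<in> {0..1}"
  proof -
    have "2 ^ m * t \<le> 2 ^ m * 1" using t by (intro mult_left_mono) auto
    then have "of_int \<lfloor>2 ^ m * t\<rfloor> \<le> (2 ^ m :: real)" by linarith
    then show ?thesis using t by (simp add: g_def)
  qed
  have R: "\<bar>sqrt a * (F (real (Suc i) / 2 ^ k) - real (Suc i) / 2 ^ k) - sqrt a * (F (real i / 2 ^ k) - real i / 2 ^ k)\<bar>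
      \<le> level_bound q a k \<omega>" if i: "i < 2 ^ k" for k i
  proof -
    have "real (Suc i) \<le> real (2 ^ k)" using i by (intro of_nat_mono) simp
    then have "real (Suc i) \<le> 2 ^ k" by simp
    then have u: "real (Suc i) / 2 ^ k \<in> {0..1}" by simp
    have "i \<le> 2 ^ k" using i by simp
    then have l: "real i / 2 ^ k \<in> {0..1}" by simp
    from level_bound_increment[OF q i, of a \<omega>] show ?thesis unfolding x[OF u] x[OF l] .
  qed
  have "step_path (2 ^ m) (\<lambda>i. fluctuation a \<omega> (real i / real (2 ^ m))) t = fluctuation a \<omega> g"
    using t by (simp add: step_path_def g_def)
  moreover have "\<bar>fluctuation a \<omega> t - fluctuation a \<omega> g\<bar> \<le> 2 * (\<Sum>k\<in>{m<..K}. level_bound q a k \<omega>) + sqrt a / 2 ^ K"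
    unfolding x[OF t] x[OF g] unfolding g_def
    using a by (intro monotone_dyadic_bound F R mK t) auto
  ultimately show "\<bar>fluctuation a \<omega> t - step_path (2 ^ m) (\<lambda>i. fluctuation a \<omega> (real i / real (2 ^ m))) t\<bar>
      \<le> 2 * (\<Sum>k\<in>{m<..K}. level_bound q a k \<omega>) + sqrt a / 2 ^ K" by simp
qed

lemma step_path_fluctuation_measurable:
  assumes "a > 0" "n > 0"
  shows "(\<lambda>\<omega>. step_path n (\<lambda>i. fluctuation a \<omega> (real i / real n))) \<in> measurable (M a) (borel_of skorokhod_topology)"
  using measurable_compose[OF fluctuation_grid_measurable[OF assms] step_path_measurable[OF assms(2)]]
  by (simp only: step_path_restrict)

text \<open>The first error term does not depend on \<open>a\<close>, so it is made small by the
  choice of \<open>m\<close> alone. The constant 6 is the factor 2 from the pathwise bound times the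
  3 from the expectation of a level.\<close>

lemma fluctuation_tightness:
  assumes f: "\<And>x y. x \<in> cadlag \<Longrightarrow> y \<in> cadlag \<Longrightarrow> \<bar>f x - f y\<bar> \<le> L * skorokhod_dist x y"
    and C: "\<And>x. x \<in> cadlag \<Longrightarrow> \<bar>f x\<bar> \<le> C" and L: "L \<ge> 0"
    and q: "q > 0" "q ^ 4 = 1 / 2" and a: "2 ^ Suc m \<le> a"
  shows "\<bar>(\<integral>\<omega>. f (fluctuation a \<omega>) \<partial>M a) - (\<integral>\<omega>. f (step_path (2 ^ m) (\<lambda>i. fluctuation a \<omega> (real i / real (2 ^ m)))) \<partial>M a)\<bar>
    \<le> L * (6 * (q ^ m / (1 - q)) + 2 / sqrt a)"
proof -
  have "(1::real) \<le> 2 ^ Suc m" by (intro one_le_power) simp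
  then have a1: "a \<ge> 1" "a > 0" using a by linarith+
  interpret prob_space "M a" by (rule dirichlet_process_D(1)[OF DP[OF a1(2)]])
  have q1: "q < 1"
  proof (rule ccontr)
    assume "\<not> q < 1"
    then have "1 \<le> q ^ 4" by (intro one_le_power) simp
    with q show False by simp
  qed
  let ?S = "\<lambda>\<omega>. step_path (2 ^ m) (\<lambda>i. fluctuation a \<omega> (real i / real (2 ^ m)))"
  \<comment> \<open>The finest level at which chaining is allowed. The upper bound
    \<open>a < 2 ^ Suc K\<close> turns the leftover drift \<open>sqrt a / 2 ^ K\<close> into at most
    \<open>2 / sqrt a\<close>.\<close>
  obtain K where K: "2 ^ K \<le> a" "a < 2 ^ Suc K"
  proof -
    obtain n where n: "a < 2 ^ n" using real_arch_pow[of 2 a] by auto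
    define N where "N = (LEAST n. a < 2 ^ n)"
    have N: "a < 2 ^ N" unfolding N_def by (rule LeastI[where P="\<lambda>n. a < 2 ^ n"]) (rule n)
    have "N \<noteq> 0" using N a1 by (cases N) auto
    then obtain K where K: "N = Suc K" by (cases N) auto
    have "\<not> a < 2 ^ K" using not_less_Least[of K "\<lambda>n. a < 2 ^ n"] K unfolding N_def[symmetric] by simp
    with N K show ?thesis by (intro that[of K]) auto
  qed
  have mK: "m < K"
  proof -
    have "(2::real) ^ Suc m < 2 ^ Suc K" using a K by linarith
    then show ?thesis by simp
  qed
  let ?R = "\<lambda>\<omega>. 2 * (\<Sum>k\<in>{m<..K}. level_bound q a k \<omega>) + sqrt a / 2 ^ K"
  have lb: "integrable (M a) (level_bound q a k)" "(\<integral>\<omega>. level_bound q a k \<omega> \<partial>M a) \<le> 3 * q ^ k"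
    if "k \<in> {m<..K}" for k
  proof -
    have "(2::real) ^ k \<le> 2 ^ K" using that by (intro power_increasing) auto
    then have "2 ^ k \<le> a" using K by linarith
    from level_bound_expectation[OF q _ this] that
    show "integrable (M a) (level_bound q a k)" "(\<integral>\<omega>. level_bound q a k \<omega> \<partial>M a) \<le> 3 * q ^ k" by auto
  qed
  have iR: "integrable (M a) ?R"
    by (intro Bochner_Integration.integrable_add Bochner_Integration.integrable_mult_right Bochner_Integration.integrable_sum lb) auto
  have "(\<integral>\<omega>. ?R \<omega> \<partial>M a) = 2 * (\<Sum>k\<in>{m<..K}. \<integral>\<omega>. level_bound q a k \<omega> \<partial>M a) + sqrt a / 2 ^ K"
  proof -
    have "integrable (M a) (\<lambda>\<omega>. \<Sum>k\<in>{m<..K}. level_bound q a k \<omega>)" by (intro Bochner_Integration.integrable_sum lb)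
    then have "(\<integral>\<omega>. ?R \<omega> \<partial>M a) = 2 * (\<integral>\<omega>. (\<Sum>k\<in>{m<..K}. level_bound q a k \<omega>) \<partial>M a) + sqrt a / 2 ^ K"
      using prob_space by (subst Bochner_Integration.integral_add) auto
    also have "(\<integral>\<omega>. (\<Sum>k\<in>{m<..K}. level_bound q a k \<omega>) \<partial>M a) = (\<Sum>k\<in>{m<..K}. \<integral>\<omega>. level_bound q a k \<omega> \<partial>M a)"
      by (intro Bochner_Integration.integral_sum lb)
    finally show ?thesis .
  qed
  also have "\<dots> \<le> 2 * (3 * (q ^ m / (1 - q))) + 2 / sqrt a"
  proof (intro add_mono mult_left_mono)
    have "(\<Sum>k\<in>{m<..K}. \<integral>\<omega>. level_bound q a k \<omega> \<partial>M a) \<le> (\<Sum>k\<in>{m<..K}. 3 * q ^ k)"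
      by (intro sum_mono lb)
    also have "\<dots> \<le> (\<Sum>k\<in>{m..K}. 3 * q ^ k)" using q by (intro sum_mono2) auto
    also have "\<dots> = 3 * ((q ^ m - q ^ Suc K) / (1 - q))"
      using q1 mK by (simp add: sum_distrib_left[symmetric] sum_gp)
    also have "\<dots> \<le> 3 * (q ^ m / (1 - q))"
      using q q1 by (intro mult_left_mono divide_right_mono) auto
    finally show "(\<Sum>k\<in>{m<..K}. \<integral>\<omega>. level_bound q a k \<omega> \<partial>M a) \<le> 3 * (q ^ m / (1 - q))" .
    have "sqrt a * sqrt a \<le> 2 * 2 ^ K" using K a1 by simp
    then show "sqrt a / 2 ^ K \<le> 2 / sqrt a" using a1 by (simp add: divide_le_eq pos_le_divide_eq)
  qed simp
  finally have ER: "(\<integral>\<omega>. ?R \<omega> \<partial>M a) \<le> 6 * (q ^ m / (1 - q)) + 2 / sqrt a" by simp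
  have fm: "f \<in> borel_measurable (borel_of skorokhod_topology)" using f by (rule Lipschitz_measurable)
  have cad: "fluctuation a \<omega> \<in> cadlag" "?S \<omega> \<in> cadlag" if "\<omega> \<in> space (M a)" for \<omega>
    using fluctuation_cadlag[OF a1(2) that] by (auto intro: step_path_cadlag)
  have i1: "integrable (M a) (\<lambda>\<omega>. f (fluctuation a \<omega>))"
    using C cad by (intro integrable_const_bound[of _ C] AE_I2 measurable_compose[OF fluctuation_measurable[OF a1(2)] fm]) auto
  have i2: "integrable (M a) (\<lambda>\<omega>. f (?S \<omega>))"
  proof (rule integrable_const_bound[of _ C])
    show "(\<lambda>\<omega>. f (?S \<omega>)) \<in> borel_measurable (M a)"
      by (rule measurable_compose[OF step_path_fluctuation_measurable[OF a1(2)] fm]) simp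
    show "AE \<omega> in M a. norm (f (?S \<omega>)) \<le> C" using C cad by (intro AE_I2) auto
  qed
  have "(\<integral>\<omega>. f (fluctuation a \<omega>) \<partial>M a) - (\<integral>\<omega>. f (?S \<omega>) \<partial>M a) = (\<integral>\<omega>. f (fluctuation a \<omega>) - f (?S \<omega>) \<partial>M a)"
    by (rule Bochner_Integration.integral_diff[OF i1 i2, symmetric])
  also have "\<bar>\<dots>\<bar> \<le> (\<integral>\<omega>. \<bar>f (fluctuation a \<omega>) - f (?S \<omega>)\<bar> \<partial>M a)" by (rule integral_abs_bound)
  also have "\<dots> \<le> (\<integral>\<omega>. L * ?R \<omega> \<partial>M a)"
  proof (rule integral_mono)
    show "integrable (M a) (\<lambda>\<omega>. \<bar>f (fluctuation a \<omega>) - f (?S \<omega>)\<bar>)"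
      by (rule integrable_abs[OF Bochner_Integration.integrable_diff[OF i1 i2]])
    show "integrable (M a) (\<lambda>\<omega>. L * ?R \<omega>)" by (rule Bochner_Integration.integrable_mult_right[OF iR])
    fix \<omega> assume \<omega>: "\<omega> \<in> space (M a)"
    have "\<bar>f (fluctuation a \<omega>) - f (?S \<omega>)\<bar> \<le> L * skorokhod_dist (fluctuation a \<omega>) (?S \<omega>)"
      by (rule f[OF cad[OF \<omega>]])
    also have "\<dots> \<le> L * ?R \<omega>"
      by (rule mult_left_mono[OF fluctuation_step_path_dist[OF a1(2) \<omega> q(1) mK] L])
    finally show "\<bar>f (fluctuation a \<omega>) - f (?S \<omega>)\<bar> \<le> L * ?R \<omega>" .
  qed
  also have "\<dots> = L * (\<integral>\<omega>. ?R \<omega> \<partial>M a)" by (rule integral_mult_right_zero)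
  also have "\<dots> \<le> L * (6 * (q ^ m / (1 - q)) + 2 / sqrt a)" by (rule mult_left_mono[OF ER L])
  finally show ?thesis .
qed

end

section \<open>Convergence to the Brownian bridge\<close>

lemma brownian_bridge_measurable:
  assumes B: "brownian_bridge N B"
  shows "prob_space N" "\<And>t. t \<in> {0..1} \<Longrightarrow> B t \<in> borel_measurable N"
    "\<And>\<omega>. \<omega> \<in> space N \<Longrightarrow> (\<lambda>t\<in>{0..1}. B t \<omega>) \<in> cadlag"
    "(\<lambda>\<omega>. \<lambda>t\<in>{0..1}. B t \<omega>) \<in> measurable N (borel_of skorokhod_topology)"
proof -
  have N: "prob_space N"
    and G: "\<forall>S c. finite S \<and> S \<subseteq> {0..1} \<longrightarrow> gaussian N (\<lambda>\<omega>. \<Sum>t\<in>S. c t * B t \<omega>)"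
    and cont: "\<forall>\<omega>\<in>space N. continuous_on {0..1} (\<lambda>t. B t \<omega>)"
    using B unfolding brownian_bridge_def gaussian_process_def by - (elim conjE, assumption)+
  show "prob_space N" by (rule N)
  show meas: "B t \<in> borel_measurable N" if "t \<in> {0..1}" for t
  proof -
    have "gaussian N (\<lambda>\<omega>. \<Sum>s\<in>{t}. 1 * B s \<omega>)"
      using that by (intro G[rule_format]) simp
    then show ?thesis by (simp add: gaussian_def)
  qed
  show cad: "(\<lambda>t\<in>{0..1}. B t \<omega>) \<in> cadlag" if "\<omega> \<in> space N" for \<omega>
    using cont that by (intro continuous_cadlag) simp
  show "(\<lambda>\<omega>. \<lambda>t\<in>{0..1}. B t \<omega>) \<in> measurable N (borel_of skorokhod_topology)"
    using cad meas by (intro measurable_skorokhod) auto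
qed

lemma fluctuation_step_path_limit:
  assumes DP: "\<And>a. a > 0 \<Longrightarrow> dirichlet_process (M a) a unit_lebesgue (P a)"
    and B: "brownian_bridge N B" and n: "n > 0"
    and f: "\<And>x y. x \<in> cadlag \<Longrightarrow> y \<in> cadlag \<Longrightarrow> \<bar>f x - f y\<bar> \<le> L * skorokhod_dist x y"
    and C: "\<And>x. x \<in> cadlag \<Longrightarrow> \<bar>f x\<bar> \<le> C" and L: "L \<ge> 0"
  shows "((\<lambda>a. \<integral>\<omega>. f (step_path n (\<lambda>i. fluctuation P a \<omega> (real i / real n))) \<partial>M a) \<longlongrightarrow>
    (\<integral>\<omega>. f (step_path n (\<lambda>i. B (real i / real n) \<omega>)) \<partial>N)) at_top"
proof (rule tendsto_at_topI_sequentially)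
  fix X :: "nat \<Rightarrow> real" assume X: "filterlim X at_top sequentially"
  \<comment> \<open>The continuity theorem speaks about sequences all of whose members are
    probability laws. Cutting off at 1 makes every parameter positive and changes only finitely many
    terms.\<close>
  define s where "s k = max 1 (X k)" for k
  have s: "s k > 0" for k by (simp add: s_def)
  have s_eq: "\<forall>\<^sub>F k in sequentially. s k = X k"
    using X[unfolded filterlim_at_top, rule_format, of 1] by eventually_elim (simp add: s_def)
  have s_lim: "filterlim s at_top sequentially"
    using filterlim_cong[OF refl refl s_eq] X by simp
  let ?V = "\<lambda>k \<omega>. \<lambda>i\<in>{..n}. fluctuation P (s k) \<omega> (real i / real n)"
  let ?W = "\<lambda>\<omega>. \<lambda>i\<in>{..n}. B (real i / real n) \<omega>"
  have fm: "f \<in> borel_measurable (borel_of skorokhod_topology)" using f by (rule Lipschitz_measurable)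
  have "(\<lambda>k. \<integral>\<omega>. f (step_path n (?V k \<omega>)) \<partial>M (s k)) \<longlonglongrightarrow> (\<integral>\<omega>. f (step_path n (?W \<omega>)) \<partial>N)"
  proof (rule multivariate_Levy_Lipschitz[where I="{..n}" and g="\<lambda>v. f (step_path n v)" and C=C and B=L])
    show "prob_space (M (s k))" for k by (rule dirichlet_process_D(1)[OF DP[OF s]])
    show "?V k \<in> measurable (M (s k)) (Pi\<^sub>M {..n} (\<lambda>_. borel))" for k
      using DP s n by (rule fluctuation_grid_measurable)
    show "prob_space N" by (rule brownian_bridge_measurable(1)[OF B])
    show "?W \<in> measurable N (Pi\<^sub>M {..n} (\<lambda>_. borel))"
      using n by (intro measurable_restrict brownian_bridge_measurable(2)[OF B]) auto
    fix \<theta> :: "nat \<Rightarrow> real"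
    have "(\<Sum>j\<le>n. \<theta> j * ?V k \<omega> j) = (\<Sum>i\<le>n. \<theta> i * (sqrt (s k) * (measure (P (s k) \<omega>) {0..real i / real n} - real i / real n)))" for k \<omega>
    proof (intro sum.cong refl)
      fix i assume i: "i \<in> {..n}"
      then have "real i / real n \<in> {0..1}" using n by auto
      from fluctuation_eq[OF DP this] i
      show "\<theta> i * ?V k \<omega> i = \<theta> i * (sqrt (s k) * (measure (P (s k) \<omega>) {0..real i / real n} - real i / real n))" by simp
    qed
    moreover have "(\<Sum>j\<le>n. \<theta> j * ?W \<omega> j) = (\<Sum>i\<le>n. \<theta> i * B (real i / real n) \<omega>)" for \<omega>
      by (intro sum.cong refl) simp
    ultimately show "(\<lambda>k. \<integral>\<omega>. exp (\<i> * of_real (\<Sum>j\<le>n. \<theta> j * ?V k \<omega> j)) \<partial>M (s k))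
        \<longlonglongrightarrow> (\<integral>\<omega>. exp (\<i> * of_real (\<Sum>j\<le>n. \<theta> j * ?W \<omega> j)) \<partial>N)"
      using filterlim_compose[OF dirichlet_grid_char_limit[OF DP n, of \<theta>] s_lim]
      by (simp only: brownian_bridge_grid_char[OF B n] exp_of_real)
  next
    show "(\<lambda>v. f (step_path n v)) \<in> borel_measurable (Pi\<^sub>M {..n} (\<lambda>_. borel))"
      by (rule measurable_compose[OF step_path_measurable[OF n] fm])
    show "\<bar>f (step_path n v)\<bar> \<le> C" for v by (rule C[OF step_path_cadlag[OF n]])
    show "\<bar>f (step_path n v) - f (step_path n w)\<bar> \<le> L * (\<Sum>j\<le>n. \<bar>v j - w j\<bar>)" for v w
      by (rule order_trans[OF f[OF step_path_cadlag[OF n] step_path_cadlag[OF n]]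
        mult_left_mono[OF skorokhod_dist_step_path_le[OF n] L]])
  qed (use L in auto)
  then have "(\<lambda>k. \<integral>\<omega>. f (step_path n (\<lambda>i. fluctuation P (s k) \<omega> (real i / real n))) \<partial>M (s k)) \<longlonglongrightarrow>
      (\<integral>\<omega>. f (step_path n (\<lambda>i. B (real i / real n) \<omega>)) \<partial>N)"
    by (simp only: step_path_restrict)
  moreover have "\<forall>\<^sub>F k in sequentially. (\<integral>\<omega>. f (step_path n (\<lambda>i. fluctuation P (s k) \<omega> (real i / real n))) \<partial>M (s k)) =
      (\<integral>\<omega>. f (step_path n (\<lambda>i. fluctuation P (X k) \<omega> (real i / real n))) \<partial>M (X k))"
    using s_eq by eventually_elim (simp only:)
  ultimately show "(\<lambda>k. \<integral>\<omega>. f (step_path n (\<lambda>i. fluctuation P (X k) \<omega> (real i / real n))) \<partial>M (X k)) \<longlonglongrightarrow>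
      (\<integral>\<omega>. f (step_path n (\<lambda>i. B (real i / real n) \<omega>)) \<partial>N)"
    by (rule Lim_transform_eventually)
qed

text \<open>The level \<open>m\<close> is fixed first, so that the \<open>a\<close>-independent tail
  of the chain and the interpolation error of the bridge are each below \<open>e / 4\<close>. Then
  \<open>a\<close> is taken large for \<open>2 / sqrt a\<close> and for the convergence on the
  grid.\<close>

lemma fluctuation_Lipschitz_limit:
  assumes DP: "\<And>a. a > 0 \<Longrightarrow> dirichlet_process (M a) a unit_lebesgue (P a)"
    and B: "brownian_bridge N B"
    and f: "\<And>x y. x \<in> cadlag \<Longrightarrow> y \<in> cadlag \<Longrightarrow> \<bar>f x - f y\<bar> \<le> L * skorokhod_dist x y"
    and C: "\<And>x. x \<in> cadlag \<Longrightarrow> \<bar>f x\<bar> \<le> C" and L: "L \<ge> 0"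
  shows "((\<lambda>a. \<integral>\<omega>. f (fluctuation P a \<omega>) \<partial>M a) \<longlongrightarrow> (\<integral>\<omega>. f (\<lambda>t\<in>{0..1}. B t \<omega>) \<partial>N)) at_top"
proof (rule tendstoI)
  fix e :: real assume e: "e > 0"
  interpret N: prob_space N by (rule brownian_bridge_measurable(1)[OF B])
  have fm: "f \<in> borel_measurable (borel_of skorokhod_topology)" using f by (rule Lipschitz_measurable)
  let ?Y = "\<lambda>\<omega>. \<lambda>t\<in>{0..1}. B t \<omega>" and ?T = "\<lambda>n \<omega>. step_path n (\<lambda>i. B (real i / real n) \<omega>)"
  \<comment> \<open>The value \<open>2 powr (-1/4)\<close>: then \<open>q ^ k\<close> is the square
    root of the standard deviation scale \<open>2 powr (- k / 2)\<close>, and its fourth power is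
    the mesh \<open>2 powr (- k)\<close>.\<close>
  define q where "q = root 4 (1 / 2 :: real)"
  have q: "q > 0" "q ^ 4 = 1 / 2" by (simp_all add: q_def real_root_pow_pos)
  have q1: "q < 1"
  proof (rule ccontr)
    assume "\<not> q < 1"
    then have "1 \<le> q ^ 4" by (intro one_le_power) simp
    with q show False by simp
  qed
  \<comment> \<open>For indices up to \<open>n\<close> the times lie in the unit interval, where
    \<open>B\<close> and its restriction agree; larger indices are never read.\<close>
  have T_Y: "?T n \<omega> = step_path n (\<lambda>i. ?Y \<omega> (real i / real n))" if "n > 0" for n \<omega>
  proof -
    have "restrict (\<lambda>i. B (real i / real n) \<omega>) {..n} = restrict (\<lambda>i. ?Y \<omega> (real i / real n)) {..n}"
      using that by (intro restrict_ext) auto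
    then show ?thesis by (metis step_path_restrict)
  qed
  have "(\<lambda>m. \<integral>\<omega>. f (?T (2 ^ m) \<omega>) \<partial>N) \<longlonglongrightarrow> (\<integral>\<omega>. f (?Y \<omega>) \<partial>N)"
  proof (rule integral_dominated_convergence[where w="\<lambda>_. C"])
    show "(\<lambda>\<omega>. f (?Y \<omega>)) \<in> borel_measurable N"
      by (rule measurable_compose[OF brownian_bridge_measurable(4)[OF B] fm])
    show "(\<lambda>\<omega>. f (?T (2 ^ m) \<omega>)) \<in> borel_measurable N" for m
    proof -
      have "?T (2 ^ m) \<in> measurable N (borel_of skorokhod_topology)"
      proof -
        have "(\<lambda>\<omega>. \<lambda>i\<in>{..2 ^ m}. B (real i / real (2 ^ m)) \<omega>) \<in> measurable N (Pi\<^sub>M {..2 ^ m} (\<lambda>_. borel))"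
          by (intro measurable_restrict brownian_bridge_measurable(2)[OF B]) auto
        from measurable_compose[OF this step_path_measurable] show ?thesis
          by (simp only: step_path_restrict) simp
      qed
      then show ?thesis by (rule measurable_compose[OF _ fm])
    qed
    show "AE \<omega> in N. norm (f (?T (2 ^ m) \<omega>)) \<le> C" for m
      by (intro AE_I2) (simp add: C step_path_cadlag)
    show "AE \<omega> in N. (\<lambda>m. f (?T (2 ^ m) \<omega>)) \<longlonglongrightarrow> f (?Y \<omega>)"
    proof (rule AE_I2)
      fix \<omega> assume "\<omega> \<in> space N"
      then have Y: "?Y \<omega> \<in> cadlag" by (rule brownian_bridge_measurable(3)[OF B])
      have pow: "filterlim (\<lambda>m. 2 ^ m :: nat) at_top sequentially"
        by (intro filterlim_subseq) (simp add: strict_mono_def)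
      have T_Y': "?T (2 ^ m) \<omega> = step_path (2 ^ m) (\<lambda>i. ?Y \<omega> (real i / real (2 ^ m)))" for m
        by (rule T_Y) simp
      have "(\<lambda>m. skorokhod_dist (?T (2 ^ m) \<omega>) (?Y \<omega>)) \<longlonglongrightarrow> 0"
        unfolding T_Y' by (rule filterlim_compose[OF skorokhod_dist_step_path[OF Y] pow])
      then have d: "(\<lambda>m. L * skorokhod_dist (?T (2 ^ m) \<omega>) (?Y \<omega>)) \<longlonglongrightarrow> L * 0"
        by (intro tendsto_mult tendsto_const)
      show "(\<lambda>m. f (?T (2 ^ m) \<omega>)) \<longlonglongrightarrow> f (?Y \<omega>)"
      proof (rule LIM_zero_cancel, rule Lim_null_comparison)
        show "\<forall>\<^sub>F m in sequentially. norm (f (?T (2 ^ m) \<omega>) - f (?Y \<omega>)) \<le> L * skorokhod_dist (?T (2 ^ m) \<omega>) (?Y \<omega>)"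
          using f[OF step_path_cadlag Y] by (intro always_eventually allI) simp
        show "(\<lambda>m. L * skorokhod_dist (?T (2 ^ m) \<omega>) (?Y \<omega>)) \<longlonglongrightarrow> 0" using d by simp
      qed
    qed
  qed simp
  then have "\<forall>\<^sub>F m in sequentially. dist (\<integral>\<omega>. f (?T (2 ^ m) \<omega>) \<partial>N) (\<integral>\<omega>. f (?Y \<omega>) \<partial>N) < e / 4"
    by (rule tendstoD) (use e in simp)
  moreover have "(\<lambda>m. L * (6 * (q ^ m / (1 - q)))) \<longlonglongrightarrow> L * (6 * (0 / (1 - q)))"
    using q q1 by (intro tendsto_intros LIMSEQ_realpow_zero) auto
  then have "\<forall>\<^sub>F m in sequentially. L * (6 * (q ^ m / (1 - q))) < e / 4"
    by (rule order_tendstoD(2)) (use e in simp)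
  ultimately have "\<forall>\<^sub>F m in sequentially. dist (\<integral>\<omega>. f (?T (2 ^ m) \<omega>) \<partial>N) (\<integral>\<omega>. f (?Y \<omega>) \<partial>N) < e / 4 \<and>
      L * (6 * (q ^ m / (1 - q))) < e / 4" by (rule eventually_conj)
  then obtain m where m: "\<bar>(\<integral>\<omega>. f (?T (2 ^ m) \<omega>) \<partial>N) - (\<integral>\<omega>. f (?Y \<omega>) \<partial>N)\<bar> < e / 4"
    "L * (6 * (q ^ m / (1 - q))) < e / 4"
    unfolding eventually_sequentially dist_real_def by blast
  let ?S = "\<lambda>a \<omega>. step_path (2 ^ m) (\<lambda>i. fluctuation P a \<omega> (real i / real (2 ^ m)))"
  have "((\<lambda>a. \<integral>\<omega>. f (?S a \<omega>) \<partial>M a) \<longlongrightarrow> (\<integral>\<omega>. f (?T (2 ^ m) \<omega>) \<partial>N)) at_top"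
  proof (rule fluctuation_step_path_limit[OF DP B _ f C L])
    show "0 < (2::nat) ^ m" by (rule zero_less_power) simp
  qed
  then have "\<forall>\<^sub>F a in at_top. dist (\<integral>\<omega>. f (?S a \<omega>) \<partial>M a) (\<integral>\<omega>. f (?T (2 ^ m) \<omega>) \<partial>N) < e / 4"
    by (rule tendstoD) (use e in simp)
  moreover have "((\<lambda>a. L * (2 / sqrt a)) \<longlongrightarrow> 0) at_top" by real_asymp
  then have "\<forall>\<^sub>F a in at_top. L * (2 / sqrt a) < e / 4"
    by (rule order_tendstoD(2)) (use e in simp)
  ultimately show "\<forall>\<^sub>F a in at_top. dist (\<integral>\<omega>. f (fluctuation P a \<omega>) \<partial>M a) (\<integral>\<omega>. f (?Y \<omega>) \<partial>N) < e"
    using eventually_ge_at_top[of "2 ^ Suc m"]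
  proof eventually_elim
    case (elim a)
    have "\<bar>(\<integral>\<omega>. f (fluctuation P a \<omega>) \<partial>M a) - (\<integral>\<omega>. f (?S a \<omega>) \<partial>M a)\<bar> \<le> L * (6 * (q ^ m / (1 - q)) + 2 / sqrt a)"
      by (rule fluctuation_tightness[OF DP f C L q elim(3)])
    also have "\<dots> < e / 2" using m(2) elim(2) by (simp only: distrib_left)
    finally show ?case using elim(1) m(1) unfolding dist_real_def by linarith
  qed
qed

theorem theorem1:
  fixes M :: "real \<Rightarrow> 'w measure" and P :: "real \<Rightarrow> 'w \<Rightarrow> real measure"
    and N :: "'v measure" and B :: "real \<Rightarrow> 'v \<Rightarrow> real"
  assumes "\<And>a. a > 0 \<Longrightarrow> dirichlet_process (M a) a unit_lebesgue (P a)"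
    and "brownian_bridge N B"
  shows "converges_in_distribution skorokhod_topology at_top
           M (\<lambda>a \<omega>. \<lambda>t\<in>{0..1}. sqrt a * (measure (P a \<omega>) {0..t} - measure unit_lebesgue {0..t}))
           N (\<lambda>\<omega>. \<lambda>t\<in>{0..1}. B t \<omega>)"
proof (rule skorokhod.converges_in_distributionI_Lipschitz)
  note DP = assms(1) and B = assms(2)
  have emp: "(\<lambda>\<omega>. \<lambda>t\<in>{0..1}. sqrt a * (measure (P a \<omega>) {0..t} - measure unit_lebesgue {0..t})) = fluctuation P a" for a
    by (simp add: fun_eq_iff fluctuation_def[OF DP])
  show "\<forall>\<^sub>F a in at_top. prob_space (M a) \<and>
      (\<lambda>\<omega>. \<lambda>t\<in>{0..1}. sqrt a * (measure (P a \<omega>) {0..t} - measure unit_lebesgue {0..t})) \<in> measurable (M a) (borel_of skorokhod_topology)"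
    using eventually_gt_at_top[of 0]
  proof eventually_elim
    case (elim a)
    show ?case unfolding emp
      using dirichlet_process_D(1)[OF DP[OF elim]] fluctuation_measurable[OF DP elim] by blast
  qed
  show "prob_space N" "(\<lambda>\<omega>. \<lambda>t\<in>{0..1}. B t \<omega>) \<in> measurable N (borel_of skorokhod_topology)"
    by (rule brownian_bridge_measurable[OF B])+
  fix f :: "(real \<Rightarrow> real) \<Rightarrow> real" and L C
  assume f: "\<And>x y. x \<in> cadlag \<Longrightarrow> y \<in> cadlag \<Longrightarrow> \<bar>f x - f y\<bar> \<le> L * skorokhod_dist x y"
    and C: "\<And>x. x \<in> cadlag \<Longrightarrow> \<bar>f x\<bar> \<le> C"
  \<comment> \<open>The reduction supplies an arbitrary constant, while the estimates multiply
    inequalities by it; its absolute value is nonnegative.\<close>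
  have f': "\<bar>f x - f y\<bar> \<le> \<bar>L\<bar> * skorokhod_dist x y" if "x \<in> cadlag" "y \<in> cadlag" for x y
    using f[OF that] mult_right_mono[OF abs_ge_self[of L] skorokhod.nonneg[of x y]] by linarith
  have "((\<lambda>a. \<integral>\<omega>. f (fluctuation P a \<omega>) \<partial>M a) \<longlongrightarrow> (\<integral>\<omega>. f (\<lambda>t\<in>{0..1}. B t \<omega>) \<partial>N)) at_top"
    by (rule fluctuation_Lipschitz_limit[OF DP B f' C abs_ge_zero])
  then show "((\<lambda>a. \<integral>\<omega>. f (\<lambda>t\<in>{0..1}. sqrt a * (measure (P a \<omega>) {0..t} - measure unit_lebesgue {0..t})) \<partial>M a) \<longlongrightarrow>
      (\<integral>\<omega>. f (\<lambda>t\<in>{0..1}. B t \<omega>) \<partial>N)) at_top"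
    by (simp only: fluctuation_def[OF DP])
qed

end
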